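(* Let the setting and notation be those described in the context. Assume that the projected stationary hydrostatic solution satisfies $$\rho_h^e({\bf x})>0,\qquad p_h^e({\bf x})>0,\qquad\forall{\bf x}\in\mathbb S_K,\ \forall K\in\mathcal T_h,$$ and that the numerical solution ${\bf U}_h\in[\mathbb V_h^k]^4$ satisfies $${\bf U}_h({\bf x})\in G,\qquad\forall{\bf x}\in\mathbb S_K,\ \forall K\in\mathcal T_h.$$ Then $$\overline{\bf U}_K+\Delta t\,{\bf L}_K({\bf U}_h)\in G,\qquad\forall K\in\mathcal T_h,$$ under the CFL-type condition $$\Delta t\left(\widetilde\alpha_K^F\,\frac{2|\mathscr E|\,p^{e,\star}_{\mathscr E,\mu}}{|K|\,p^{e,{\tt int}(K)}_{\mathscr E,\mu}}+\widetilde\alpha_K^S\,\frac{\widehat\varpi_{\mathscr E}^{(\mu)}}{\omega_\mu}\right)\le\frac{\widehat\varpi_{\mathscr E}^{(\mu)}}{\omega_\mu},\qquad 1\le\mu\le N,\ \forall\mathscr E\in\partial K,\ \forall K\in\mathcal T_h.$$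
   Context: **States ($d=2$).** Fix $\gamma>1$. ${\bf U}=(\rho,{\bf m},E)^\top\in\mathbb R^4$, ${\bf m}\in\mathbb R^2$, ${\bf u}={\bf m}/\rho$, $e=\frac1\rho\big(E-\frac{\|{\bf m}\|^2}{2\rho}\big)$, $p=(\gamma-1)\rho e$. ${\bf F}({\bf U})\cdot{\bf n}=(\rho\,{\bf u}\cdot{\bf n},\ \rho({\bf u}\cdot{\bf n}){\bf u}+p{\bf n},\ (E+p){\bf u}\cdot{\bf n})^\top$. $G=\{(\rho,{\bf m},E)^\top:\rho>0,\ E-\frac{\|{\bf m}\|^2}{2\rho}>0\}$. For a unit vector ${\bf n}$, $\alpha_{\bf n}({\bf U})=|{\bf u}\cdot{\bf n}|+\sqrt{\gamma p/\rho}$. **2D HLLC flux.** For ${\bf U}_L,{\bf U}_R\in G$ and a unit vector ${\bf n}$, let $q_i={\bf u}_i\cdot{\bf n}$, $c_i=\sqrt{\gamma p_i/\rho_i}$ for $i\in\{L,R\}$, $S_L=\min\{q_L-c_L,q_R-c_R\}$, $S_R=\max\{q_L+c_L,q_R+c_R\}$, $$S_*=\frac{p_R-p_L+\rho_Lq_L(S_L-q_L)-\rho_Rq_R(S_R-q_R)}{\rho_L(S_L-q_L)-\rho_R(S_R-q_R)},$$ $${\bf U}_{*i}=\rho_i\frac{S_i-q_i}{S_i-S_*}\Big(1,\ {\bf u}_i+(S_*-q_i){\bf n},\ \frac{E_i}{\rho_i}+(S_*-q_i)\Big(S_*+\frac{p_i}{\rho_i(S_i-q_i)}\Big)\Big)^\top,\quad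 {\bf F}_{*i}={\bf F}({\bf U}_i)\cdot{\bf n}+S_i({\bf U}_{*i}-{\bf U}_i).$$ ${\bf F}^{hllc}({\bf U}_L,{\bf U}_R;{\bf n})$ equals ${\bf F}({\bf U}_L)\cdot{\bf n}$ if $0\le S_L$; ${\bf F}_{*L}$ if $S_L\le0\le S_*$; ${\bf F}_{*R}$ if $S_*\le0\le S_R$; ${\bf F}({\bf U}_R)\cdot{\bf n}$ if $0\ge S_R$. **Mesh and spaces.** $\mathcal T_h$ is a partition of the domain into polygonal cells $K$ (possibly unstructured); $|K|$ is the area, $\mathscr E\in\partial K$ runs over the edges of $K$, $|\mathscr E|$ is the length, ${\bf n}_{\mathscr E,K}$ the outward unit normal. $\mathbb V_h^k$ ($k\ge1$) is the space of $L^2$ functions that are polynomials of total degree at most $k$ on each $K$. Superscripts ${\tt int}(K)$, ${\tt ext}(K)$ denote limits at edges from the interior/exterior of $K$; each edge of $K$ is shared with a neighbouring cell, or at the domain boundary exterior values are those supplied by boundary conditions and satisfy the same hypotheses. Values on $\mathbb S_K$ are taken from the polynomial on $K$. ${\bf U}_h=(\rho_h,{\bf m}_h,E_h)^\top$, with cell average $\overline{\bf U}_K=(\overline\rho_K,\overline{\bf m}_K,\overline E_K)^\top$ over $K$; $\overline e_K=\frac1{\overline\rho_K}\big(\overline E_K-\frac{\|\overline{\bf m}_K\|^2}{2\overline\rho_K}\big)$; $e_h({\bf x})$ is the value of $e$ at ${\bf U}_h({\bf x})$. $\rho_h^e,p_h^e\in\mathbb V_h^k$ are projections of the density and pressure of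 a given stationary hydrostatic solution ($\nabla p^e=-\rho^e\nabla\phi$, zero velocity, $\phi$ the static gravitational potential); $\overline\rho_K^e$ is the cell average of $\rho_h^e$. **Quadratures.** $\{{\bf x}_{\mathscr E}^{(\mu)},\omega_\mu\}_{\mu=1}^N$, $N=k+1$, are Gauss nodes and normalized weights ($\sum\omega_\mu=1$) on $\mathscr E$. $\{{\bf x}_K^{(q)},\varpi_q\}_{q=1}^Q$ are nodes and positive normalized weights of a 2D quadrature on $K$, exact for polynomials of degree up to $k$. In addition, on each $K$ there is assumed to exist a special quadrature with positive weights $\widehat\varpi_{\mathscr E}^{(\mu)},\widetilde\varpi_q$ and points $\{{\bf x}_{\mathscr E}^{(\mu)}\}\cup\{\widetilde{\bf x}_K^{(q)}\}_{q=1}^{\widetilde Q}\subset K$ (closed) such that $$\frac1{|K|}\int_Ku\,d{\bf x}=\sum_{\mathscr E\in\partial K}\sum_{\mu=1}^N\widehat\varpi_{\mathscr E}^{(\mu)}u({\bf x}_{\mathscr E}^{(\mu)})+\sum_{q=1}^{\widetilde Q}\widetilde\varpi_qu(\widetilde{\bf x}_K^{(q)})\qquad\forall u\in\mathbb P^k(K).$$ $\mathbb S_K=\{{\bf x}_{\mathscr E}^{(\mu)}:\mathscr E\in\partial K,1\le\mu\le N\}\cup\{\widetilde{\bf x}_K^{(q)}\}_{q=1}^{\widetilde Q}\cup\{{\bf x}_K^{(q)}\}_{q=1}^Q$. **Notation at edge nodes.** ${\bf U}_{\mathscr E,\mu}^{{\tt int}(K)},{\bf U}_{\mathscr E,\mu}^{{\tt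 ext}(K)},p_{\mathscr E,\mu}^{e,{\tt int}(K)},p_{\mathscr E,\mu}^{e,{\tt ext}(K)}$ are the interior/exterior limits of ${\bf U}_h$, $p_h^e$ at ${\bf x}_{\mathscr E}^{(\mu)}$; $p_{\mathscr E,\mu}^{e,\star}=\frac12\big(p_{\mathscr E,\mu}^{e,{\tt int}(K)}+p_{\mathscr E,\mu}^{e,{\tt ext}(K)}\big)$; $[\![p_h^e({\bf x}_{\mathscr E}^{(\mu)})]\!]=p_{\mathscr E,\mu}^{e,{\tt ext}(K)}-p_{\mathscr E,\mu}^{e,{\tt int}(K)}$. **Cell-average operator of the DG scheme.** $$\widehat{\bf F}_{{\bf n}_{\mathscr E,K}}({\bf x}_{\mathscr E}^{(\mu)})={\bf F}^{hllc}\Big(\frac{p_{\mathscr E,\mu}^{e,\star}}{p_{\mathscr E,\mu}^{e,{\tt int}(K)}}{\bf U}_{\mathscr E,\mu}^{{\tt int}(K)},\ \frac{p_{\mathscr E,\mu}^{e,\star}}{p_{\mathscr E,\mu}^{e,{\tt ext}(K)}}{\bf U}_{\mathscr E,\mu}^{{\tt ext}(K)};\ {\bf n}_{\mathscr E,K}\Big),$$ $${\bf L}_K({\bf U}_h)=-\frac1{|K|}\sum_{\mathscr E\in\partial K}|\mathscr E|\sum_{\mu=1}^N\omega_\mu\widehat{\bf F}_{{\bf n}_{\mathscr E,K}}({\bf x}_{\mathscr E}^{(\mu)})+\big(0,\overline{\bf S}_K^{[2]},\overline S_K^{[3]}\big)^\top,$$ where, with ${\bf b}_K=\sum_{\mathscr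 E\in\partial K}|\mathscr E|\sum_{\mu=1}^N\omega_\mu p_{\mathscr E,\mu}^{e,\star}{\bf n}_{\mathscr E,K}$, $$\overline{\bf S}_K^{[2]}=\sum_{q=1}^Q\varpi_q\Big(\frac{\rho_h({\bf x}_K^{(q)})}{\rho_h^e({\bf x}_K^{(q)})}-\frac{\overline\rho_K}{\overline\rho_K^e}\Big)\nabla p_h^e({\bf x}_K^{(q)})+\frac{\overline\rho_K}{\overline\rho_K^e|K|}{\bf b}_K,\qquad \overline S_K^{[3]}=\sum_{q=1}^Q\varpi_q\Big(\frac{{\bf m}_h({\bf x}_K^{(q)})}{\rho_h^e({\bf x}_K^{(q)})}-\frac{\overline{\bf m}_K}{\overline\rho_K^e}\Big)\cdot\nabla p_h^e({\bf x}_K^{(q)})+\frac{\overline{\bf m}_K}{\overline\rho_K^e|K|}\cdot{\bf b}_K.$$ $\Delta t>0$ is the time step. **CFL quantities.** $$\widetilde\alpha_K^F=\max\Big\{\max_{\mathscr E\in\partial K,1\le\mu\le N}\alpha_{{\bf n}_{\mathscr E,K}}({\bf U}_{\mathscr E,\mu}^{{\tt int}(K)}),\ \max_{\mathscr E\in\partial K,1\le\mu\le N}\alpha_{{\bf n}_{\mathscr E,K}}({\bf U}_{\mathscr E,\mu}^{{\tt ext}(K)})\Big\},\qquad\widetilde\alpha_K^S=\widetilde\alpha_K^{S,1}+\widetilde\alpha_K^{S,2},$$ $$\widetilde\alpha_K^{S,1}=\max_{1\le q\le Q}\frac{\|\nabla p_h^e({\bf x}_K^{(q)})\|}{\rho_h^e({\bf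 x}_K^{(q)})\sqrt{2e_h({\bf x}_K^{(q)})}},\qquad\widetilde\alpha_K^{S,2}=\frac{\Big\|\sum_{\mathscr E\in\partial K}\Big(|\mathscr E|\sum_{\mu=1}^N\omega_\mu[\![p_h^e({\bf x}_{\mathscr E}^{(\mu)})]\!]\Big){\bf n}_{\mathscr E,K}\Big\|}{2|K|\overline\rho_K^e\sqrt{2\overline e_K}}.$$ *)

theory Defs
  imports "HOL-Analysis.Analysis" "HOL-Computational_Algebra.Polynomial"
begin

section \<open>Compressible Euler equations in two space dimensions\<close>

text \<open>A state is the triple of density, momentum and total energy.\<close>

type_synonym point = "real^2"
type_synonym state = "real \<times> (real^2) \<times> real"

definition dens :: "state \<Rightarrow> real" where "dens U = fst U"
definition mom :: "state \<Rightarrow> real^2" where "mom U = fst (snd U)"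
definition ener :: "state \<Rightarrow> real" where "ener U = snd (snd U)"

definition vel :: "state \<Rightarrow> real^2" where
  "vel U = (1 / dens U) *\<^sub>R mom U"

text \<open>Specific internal energy.\<close>

definition eint :: "state \<Rightarrow> real" where
  "eint U = (1 / dens U) * (ener U - (norm (mom U))\<^sup>2 / (2 * dens U))"

definition pres :: "real \<Rightarrow> state \<Rightarrow> real" where
  "pres \<gamma> U = (\<gamma> - 1) * dens U * eint U"

definition admissible :: "state set" where
  "admissible = {(\<rho>, m, E). \<rho> > 0 \<and> E - (norm m)\<^sup>2 / (2 * \<rho>) > 0}"

definition flux :: "real \<Rightarrow> state \<Rightarrow> real^2 \<Rightarrow> state" where
  "flux \<gamma> U n =
    (dens U * (vel U \<bullet> n),
     (dens U * (vel U \<bullet> n)) *\<^sub>R vel U + pres \<gamma> U *\<^sub>R n,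
     (ener U + pres \<gamma> U) * (vel U \<bullet> n))"

definition sound_speed :: "real \<Rightarrow> state \<Rightarrow> real" where
  "sound_speed \<gamma> U = sqrt (\<gamma> * pres \<gamma> U / dens U)"

definition max_speed :: "real \<Rightarrow> real^2 \<Rightarrow> state \<Rightarrow> real" where
  "max_speed \<gamma> n U = \<bar>vel U \<bullet> n\<bar> + sqrt (\<gamma> * pres \<gamma> U / dens U)"


section \<open>HLLC flux\<close>

definition hllc_SL :: "real \<Rightarrow> state \<Rightarrow> state \<Rightarrow> real^2 \<Rightarrow> real" where
  "hllc_SL \<gamma> UL UR n =
    min (vel UL \<bullet> n - sound_speed \<gamma> UL) (vel UR \<bullet> n - sound_speed \<gamma> UR)"

definition hllc_SR :: "real \<Rightarrow> state \<Rightarrow> state \<Rightarrow> real^2 \<Rightarrow> real" where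
  "hllc_SR \<gamma> UL UR n =
    max (vel UL \<bullet> n + sound_speed \<gamma> UL) (vel UR \<bullet> n + sound_speed \<gamma> UR)"

definition hllc_Sstar :: "real \<Rightarrow> state \<Rightarrow> state \<Rightarrow> real^2 \<Rightarrow> real" where
  "hllc_Sstar \<gamma> UL UR n =
    (let qL = vel UL \<bullet> n; qR = vel UR \<bullet> n;
         SL = hllc_SL \<gamma> UL UR n; SR = hllc_SR \<gamma> UL UR n
     in (pres \<gamma> UR - pres \<gamma> UL + dens UL * qL * (SL - qL) - dens UR * qR * (SR - qR))
          / (dens UL * (SL - qL) - dens UR * (SR - qR)))"

text \<open>The intermediate state and flux adjacent to the state \<open>U\<close> with outer wave speed \<open>S\<close>
  and contact speed \<open>Ss\<close>.\<close>

definition hllc_mid_state :: "real \<Rightarrow> state \<Rightarrow> real^2 \<Rightarrow> real \<Rightarrow> real \<Rightarrow> state" where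
  "hllc_mid_state \<gamma> U n S Ss =
    (let q = vel U \<bullet> n
     in (dens U * ((S - q) / (S - Ss))) *\<^sub>R
          (1,
           vel U + (Ss - q) *\<^sub>R n,
           ener U / dens U + (Ss - q) * (Ss + pres \<gamma> U / (dens U * (S - q)))))"

definition hllc_mid_flux :: "real \<Rightarrow> state \<Rightarrow> real^2 \<Rightarrow> real \<Rightarrow> real \<Rightarrow> state" where
  "hllc_mid_flux \<gamma> U n S Ss = flux \<gamma> U n + S *\<^sub>R (hllc_mid_state \<gamma> U n S Ss - U)"

text \<open>For admissible states \<open>SL < Ss < SR\<close>, and the four formulas agree where their closed
  ranges of validity meet, so the order of the tests does not matter.\<close>

definition hllc_flux :: "real \<Rightarrow> state \<Rightarrow> state \<Rightarrow> real^2 \<Rightarrow> state" where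
  "hllc_flux \<gamma> UL UR n =
    (let SL = hllc_SL \<gamma> UL UR n; SR = hllc_SR \<gamma> UL UR n; Ss = hllc_Sstar \<gamma> UL UR n
     in if 0 \<le> SL then flux \<gamma> UL n
        else if SL \<le> 0 \<and> 0 \<le> Ss then hllc_mid_flux \<gamma> UL n SL Ss
        else if Ss \<le> 0 \<and> 0 \<le> SR then hllc_mid_flux \<gamma> UR n SR Ss
        else flux \<gamma> UR n)"


section \<open>Polygonal cells\<close>

text \<open>A cell is the list of its vertices in cyclic order (either orientation). Consecutive edges
  may be collinear, so a hanging node counts as a vertex. Edges are closed segments, which makes
  an edge shared by two cells the same object for both.\<close>

type_synonym cell = "point list"

definition side :: "cell \<Rightarrow> nat \<Rightarrow> point set" where
  "side K i = closed_segment (K ! i) (K ! (Suc i mod length K))"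

definition edges :: "cell \<Rightarrow> point set set" where
  "edges K = side K ` {..<length K}"

definition simple_polygon :: "cell \<Rightarrow> bool" where
  "simple_polygon K \<longleftrightarrow> 3 \<le> length K \<and> distinct K \<and>
    (\<forall>i<length K. \<forall>j<length K. i \<noteq> j \<longrightarrow>
      side K i \<inter> side K j =
        {K ! i, K ! (Suc i mod length K)} \<inter> {K ! j, K ! (Suc j mod length K)})"

text \<open>The closed region enclosed by the polygon.\<close>

definition region :: "cell \<Rightarrow> point set" where
  "region K = \<Union>(edges K) \<union> inside (\<Union>(edges K))"

definition area :: "cell \<Rightarrow> real" where
  "area K = measure lebesgue (region K)"

definition cell_avg :: "cell \<Rightarrow> (point \<Rightarrow> 'a::euclidean_space) \<Rightarrow> 'a" where
  "cell_avg K f = (1 / area K) *\<^sub>R integral (region K) f"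

text \<open>The length of a segment is its diameter.\<close>

definition edge_length :: "point set \<Rightarrow> real" where
  "edge_length E = diameter E"

definition outward_normal :: "cell \<Rightarrow> point set \<Rightarrow> real^2" where
  "outward_normal K E =
    (THE n. norm n = 1 \<and> (\<forall>x\<in>E. \<forall>y\<in>E. n \<bullet> (x - y) = 0) \<and>
       (\<forall>x\<in>rel_interior E. \<exists>\<epsilon>>0. \<forall>t\<in>{0<..<\<epsilon>}. x + t *\<^sub>R n \<notin> region K))"

definition polygonal_mesh :: "point set \<Rightarrow> cell set \<Rightarrow> bool" where
  "polygonal_mesh \<Omega> T \<longleftrightarrow> open \<Omega> \<and> connected \<Omega> \<and> finite T \<and>
    (\<forall>K\<in>T. simple_polygon K) \<and>
    (\<Union>K\<in>T. region K) = closure \<Omega> \<and>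
    (\<forall>K\<in>T. \<forall>K'\<in>T. K \<noteq> K' \<longrightarrow> interior (region K) \<inter> interior (region K') = {}) \<and>
    (\<forall>K\<in>T. \<forall>E\<in>edges K. E \<subseteq> frontier \<Omega> \<or> (\<exists>K'\<in>T. K' \<noteq> K \<and> E \<in> edges K'))"


section \<open>Polynomials and quadrature rules\<close>

text \<open>Bivariate polynomial functions of total degree at most \<open>k\<close>.\<close>

definition poly2 :: "nat \<Rightarrow> (point \<Rightarrow> real) set" where
  "poly2 k = {f. \<exists>c :: nat \<Rightarrow> nat \<Rightarrow> real.
     \<forall>x. f x = (\<Sum>i\<le>k. \<Sum>j\<le>k - i. c i j * (x $ 1) ^ i * (x $ 2) ^ j)}"

definition gradient :: "(point \<Rightarrow> real) \<Rightarrow> point \<Rightarrow> real^2" where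
  "gradient f x = (THE D. GDERIV f x :> D)"

text \<open>The \<open>N\<close>-point Gauss rule on the unit interval: \<open>N\<close> distinct nodes, exact up to
  degree \<open>2 * N - 1\<close>.\<close>

definition gauss_rule :: "nat \<Rightarrow> (nat \<Rightarrow> real) \<Rightarrow> (nat \<Rightarrow> real) \<Rightarrow> bool" where
  "gauss_rule N \<xi> \<omega> \<longleftrightarrow>
    inj_on \<xi> {1..N} \<and> \<xi> ` {1..N} \<subseteq> {0..1} \<and> (\<Sum>\<mu>=1..N. \<omega> \<mu>) = 1 \<and>
    (\<forall>p :: real poly. degree p \<le> 2 * N - 1 \<longrightarrow>
       (\<Sum>\<mu>=1..N. \<omega> \<mu> * poly p (\<xi> \<mu>)) = integral {0..1} (poly p))"

text \<open>Mesh, polynomial degree and quadratures. The record fields carry, in this order: the domain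
  \<open>\<Omega>\<close>, the cells, \<open>k\<close>; \<open>x\<^sub>E\<^sup>\<mu>\<close> and \<open>\<omega>\<^sub>\<mu>\<close>; \<open>Q\<close>, the points \<open>x\<^sub>K\<^sup>q\<close> and their weights;
  and, for the special quadrature, the weights at edge nodes, the number of additional points,
  these points and their weights. The numbers of points of the cell quadratures, and all their
  weights, may depend on the cell.\<close>

record discretization =
  domain :: "point set"
  cells :: "cell set"
  deg :: nat
  edge_node :: "point set \<Rightarrow> nat \<Rightarrow> point"
  edge_wt :: "nat \<Rightarrow> real"
  cq_num :: "cell \<Rightarrow> nat"
  cq_node :: "cell \<Rightarrow> nat \<Rightarrow> point"
  cq_wt :: "cell \<Rightarrow> nat \<Rightarrow> real"
  sq_edge_wt :: "cell \<Rightarrow> point set \<Rightarrow> nat \<Rightarrow> real"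
  sq_num :: "cell \<Rightarrow> nat"
  sq_node :: "cell \<Rightarrow> nat \<Rightarrow> point"
  sq_wt :: "cell \<Rightarrow> nat \<Rightarrow> real"

definition edge_num :: "discretization \<Rightarrow> nat" where
  "edge_num D = deg D + 1"

definition edge_quadrature :: "discretization \<Rightarrow> bool" where
  "edge_quadrature D \<longleftrightarrow>
    (\<exists>\<xi>. gauss_rule (edge_num D) \<xi> (edge_wt D) \<and>
      (\<forall>K\<in>cells D. \<forall>E\<in>edges K. \<exists>a b. E = closed_segment a b \<and>
        (\<forall>\<mu>\<in>{1..edge_num D}. edge_node D E \<mu> = linepath a b (\<xi> \<mu>))))"

definition cell_quadrature :: "discretization \<Rightarrow> cell \<Rightarrow> bool" where
  "cell_quadrature D K \<longleftrightarrow>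
    (\<forall>q\<in>{1..cq_num D K}. cq_wt D K q > 0) \<and> (\<Sum>q=1..cq_num D K. cq_wt D K q) = 1 \<and>
    (\<forall>f\<in>poly2 (deg D).
       cell_avg K f = (\<Sum>q=1..cq_num D K. cq_wt D K q * f (cq_node D K q)))"

definition special_quadrature :: "discretization \<Rightarrow> cell \<Rightarrow> bool" where
  "special_quadrature D K \<longleftrightarrow>
    (\<forall>E\<in>edges K. \<forall>\<mu>\<in>{1..edge_num D}. sq_edge_wt D K E \<mu> > 0) \<and>
    (\<forall>q\<in>{1..sq_num D K}. sq_wt D K q > 0 \<and> sq_node D K q \<in> region K) \<and>
    (\<forall>f\<in>poly2 (deg D).
       cell_avg K f =
         (\<Sum>E\<in>edges K. \<Sum>\<mu>=1..edge_num D. sq_edge_wt D K E \<mu> * f (edge_node D E \<mu>)) +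
         (\<Sum>q=1..sq_num D K. sq_wt D K q * f (sq_node D K q)))"

definition dg_discretization :: "discretization \<Rightarrow> bool" where
  "dg_discretization D \<longleftrightarrow> 1 \<le> deg D \<and> polygonal_mesh (domain D) (cells D) \<and>
    edge_quadrature D \<and> (\<forall>K\<in>cells D. cell_quadrature D K \<and> special_quadrature D K)"

text \<open>The point set \<open>S\<^sub>K\<close>.\<close>

definition points :: "discretization \<Rightarrow> cell \<Rightarrow> point set" where
  "points D K =
    {edge_node D E \<mu> |E \<mu>. E \<in> edges K \<and> \<mu> \<in> {1..edge_num D}} \<union>
    sq_node D K ` {1..sq_num D K} \<union> cq_node D K ` {1..cq_num D K}"


section \<open>Discontinuous finite element functions\<close>

text \<open>A discontinuous piecewise polynomial is given by its polynomial on each cell; hence the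
  interior trace at an edge is a plain evaluation.\<close>

definition Vh :: "discretization \<Rightarrow> (cell \<Rightarrow> point \<Rightarrow> real) set" where
  "Vh D = {v. \<forall>K\<in>cells D. v K \<in> poly2 (deg D)}"

definition Vh_state :: "discretization \<Rightarrow> (cell \<Rightarrow> point \<Rightarrow> state) set" where
  "Vh_state D = {U. (\<lambda>K x. dens (U K x)) \<in> Vh D \<and>
     (\<forall>i. (\<lambda>K x. mom (U K x) $ i) \<in> Vh D) \<and> (\<lambda>K x. ener (U K x)) \<in> Vh D}"

text \<open>A projection onto the discrete space: any map with values in it that fixes its elements.\<close>

definition Vh_projector ::
    "discretization \<Rightarrow> ((point \<Rightarrow> real) \<Rightarrow> cell \<Rightarrow> point \<Rightarrow> real) \<Rightarrow> bool" where
  "Vh_projector D P \<longleftrightarrow> (\<forall>f. P f \<in> Vh D) \<and>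
    (\<forall>f. \<forall>v\<in>Vh D. (\<forall>K\<in>cells D. \<forall>x\<in>interior (region K). f x = v K x) \<longrightarrow>
      (\<forall>K\<in>cells D. P f K = v K))"

definition Vh_projection_of ::
    "discretization \<Rightarrow> (point \<Rightarrow> real) \<Rightarrow> (cell \<Rightarrow> point \<Rightarrow> real) \<Rightarrow> bool" where
  "Vh_projection_of D f fh \<longleftrightarrow> (\<exists>P. Vh_projector D P \<and> (\<forall>K\<in>cells D. fh K = P f K))"

text \<open>Density and pressure of a solution at rest in the gravitational potential \<open>\<phi>\<close>.\<close>

definition hydrostatic ::
    "point set \<Rightarrow> (point \<Rightarrow> real) \<Rightarrow> (point \<Rightarrow> real) \<Rightarrow> (point \<Rightarrow> real) \<Rightarrow> bool" where
  "hydrostatic \<Omega> \<phi> \<rho> p \<longleftrightarrow>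
    (\<forall>x\<in>\<Omega>. \<exists>g. GDERIV \<phi> x :> g \<and> GDERIV p x :> - (\<rho> x *\<^sub>R g))"

text \<open>Interior and exterior limits at the edge nodes. The neighbour across an edge inside the
  domain is unique because cells do not overlap; \<open>vb\<close> holds the exterior values that the
  boundary conditions provide.\<close>

definition int_trace ::
    "discretization \<Rightarrow> (cell \<Rightarrow> point \<Rightarrow> 'a) \<Rightarrow> cell \<Rightarrow> point set \<Rightarrow> nat \<Rightarrow> 'a" where
  "int_trace D v K E \<mu> = v K (edge_node D E \<mu>)"

definition neighbour :: "discretization \<Rightarrow> cell \<Rightarrow> point set \<Rightarrow> cell" where
  "neighbour D K E = (SOME K'. K' \<in> cells D \<and> K' \<noteq> K \<and> E \<in> edges K')"

definition ext_trace ::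
    "discretization \<Rightarrow> (cell \<Rightarrow> point set \<Rightarrow> nat \<Rightarrow> 'a) \<Rightarrow> (cell \<Rightarrow> point \<Rightarrow> 'a) \<Rightarrow>
     cell \<Rightarrow> point set \<Rightarrow> nat \<Rightarrow> 'a" where
  "ext_trace D vb v K E \<mu> =
    (if E \<subseteq> frontier (domain D) then vb K E \<mu>
     else v (neighbour D K E) (edge_node D E \<mu>))"

definition p_star ::
    "discretization \<Rightarrow> (cell \<Rightarrow> point set \<Rightarrow> nat \<Rightarrow> real) \<Rightarrow> (cell \<Rightarrow> point \<Rightarrow> real) \<Rightarrow>
     cell \<Rightarrow> point set \<Rightarrow> nat \<Rightarrow> real" where
  "p_star D pb pe K E \<mu> = (1/2) * (int_trace D pe K E \<mu> + ext_trace D pb pe K E \<mu>)"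

definition jump ::
    "discretization \<Rightarrow> (cell \<Rightarrow> point set \<Rightarrow> nat \<Rightarrow> real) \<Rightarrow> (cell \<Rightarrow> point \<Rightarrow> real) \<Rightarrow>
     cell \<Rightarrow> point set \<Rightarrow> nat \<Rightarrow> real" where
  "jump D pb pe K E \<mu> = ext_trace D pb pe K E \<mu> - int_trace D pe K E \<mu>"


section \<open>Cell-average operator of the scheme\<close>

text \<open>Throughout, \<open>U\<close> is the numerical solution with boundary data \<open>Ub\<close>; \<open>re\<close> and \<open>pe\<close> are the
  projected stationary density and pressure, the latter with boundary data \<open>pb\<close>.\<close>

definition num_flux ::
    "real \<Rightarrow> discretization \<Rightarrow> (cell \<Rightarrow> point set \<Rightarrow> nat \<Rightarrow> state) \<Rightarrow>
     (cell \<Rightarrow> point set \<Rightarrow> nat \<Rightarrow> real) \<Rightarrow> (cell \<Rightarrow> point \<Rightarrow> real) \<Rightarrow> (cell \<Rightarrow> point \<Rightarrow> state) \<Rightarrow>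
     cell \<Rightarrow> point set \<Rightarrow> nat \<Rightarrow> state" where
  "num_flux \<gamma> D Ub pb pe U K E \<mu> =
    hllc_flux \<gamma>
      ((p_star D pb pe K E \<mu> / int_trace D pe K E \<mu>) *\<^sub>R int_trace D U K E \<mu>)
      ((p_star D pb pe K E \<mu> / ext_trace D pb pe K E \<mu>) *\<^sub>R ext_trace D Ub U K E \<mu>)
      (outward_normal K E)"

definition b_vec ::
    "discretization \<Rightarrow> (cell \<Rightarrow> point set \<Rightarrow> nat \<Rightarrow> real) \<Rightarrow> (cell \<Rightarrow> point \<Rightarrow> real) \<Rightarrow>
     cell \<Rightarrow> real^2" where
  "b_vec D pb pe K =
    (\<Sum>E\<in>edges K. edge_length E *\<^sub>R
      (\<Sum>\<mu>=1..edge_num D. (edge_wt D \<mu> * p_star D pb pe K E \<mu>) *\<^sub>R outward_normal K E))"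

definition source_mom ::
    "discretization \<Rightarrow> (cell \<Rightarrow> point set \<Rightarrow> nat \<Rightarrow> real) \<Rightarrow> (cell \<Rightarrow> point \<Rightarrow> real) \<Rightarrow>
     (cell \<Rightarrow> point \<Rightarrow> real) \<Rightarrow> (cell \<Rightarrow> point \<Rightarrow> state) \<Rightarrow> cell \<Rightarrow> real^2" where
  "source_mom D pb re pe U K =
    (\<Sum>q=1..cq_num D K.
      (cq_wt D K q *
        (dens (U K (cq_node D K q)) / re K (cq_node D K q)
          - dens (cell_avg K (U K)) / cell_avg K (re K))) *\<^sub>R
      gradient (pe K) (cq_node D K q))
    + (dens (cell_avg K (U K)) / (cell_avg K (re K) * area K)) *\<^sub>R b_vec D pb pe K"

definition source_ener ::
    "discretization \<Rightarrow> (cell \<Rightarrow> point set \<Rightarrow> nat \<Rightarrow> real) \<Rightarrow> (cell \<Rightarrow> point \<Rightarrow> real) \<Rightarrow>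
     (cell \<Rightarrow> point \<Rightarrow> real) \<Rightarrow> (cell \<Rightarrow> point \<Rightarrow> state) \<Rightarrow> cell \<Rightarrow> real" where
  "source_ener D pb re pe U K =
    (\<Sum>q=1..cq_num D K.
      cq_wt D K q *
        (((1 / re K (cq_node D K q)) *\<^sub>R mom (U K (cq_node D K q))
           - (1 / cell_avg K (re K)) *\<^sub>R mom (cell_avg K (U K)))
         \<bullet> gradient (pe K) (cq_node D K q)))
    + ((1 / (cell_avg K (re K) * area K)) *\<^sub>R mom (cell_avg K (U K))) \<bullet> b_vec D pb pe K"

definition L_op ::
    "real \<Rightarrow> discretization \<Rightarrow> (cell \<Rightarrow> point set \<Rightarrow> nat \<Rightarrow> state) \<Rightarrow>
     (cell \<Rightarrow> point set \<Rightarrow> nat \<Rightarrow> real) \<Rightarrow> (cell \<Rightarrow> point \<Rightarrow> real) \<Rightarrow> (cell \<Rightarrow> point \<Rightarrow> real) \<Rightarrow>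
     (cell \<Rightarrow> point \<Rightarrow> state) \<Rightarrow> cell \<Rightarrow> state" where
  "L_op \<gamma> D Ub pb re pe U K =
    - (1 / area K) *\<^sub>R
      (\<Sum>E\<in>edges K. edge_length E *\<^sub>R
        (\<Sum>\<mu>=1..edge_num D. edge_wt D \<mu> *\<^sub>R num_flux \<gamma> D Ub pb pe U K E \<mu>))
    + (0, source_mom D pb re pe U K, source_ener D pb re pe U K)"


section \<open>Quantities in the CFL condition\<close>

definition alpha_F ::
    "real \<Rightarrow> discretization \<Rightarrow> (cell \<Rightarrow> point set \<Rightarrow> nat \<Rightarrow> state) \<Rightarrow>
     (cell \<Rightarrow> point \<Rightarrow> state) \<Rightarrow> cell \<Rightarrow> real" where
  "alpha_F \<gamma> D Ub U K =
    max (Max {max_speed \<gamma> (outward_normal K E) (int_trace D U K E \<mu>) |E \<mu>.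
              E \<in> edges K \<and> \<mu> \<in> {1..edge_num D}})
        (Max {max_speed \<gamma> (outward_normal K E) (ext_trace D Ub U K E \<mu>) |E \<mu>.
              E \<in> edges K \<and> \<mu> \<in> {1..edge_num D}})"

definition alpha_S1 ::
    "discretization \<Rightarrow> (cell \<Rightarrow> point \<Rightarrow> real) \<Rightarrow> (cell \<Rightarrow> point \<Rightarrow> real) \<Rightarrow>
     (cell \<Rightarrow> point \<Rightarrow> state) \<Rightarrow> cell \<Rightarrow> real" where
  "alpha_S1 D re pe U K =
    Max ((\<lambda>q. norm (gradient (pe K) (cq_node D K q)) /
              (re K (cq_node D K q) * sqrt (2 * eint (U K (cq_node D K q)))))
         ` {1..cq_num D K})"

definition alpha_S2 ::
    "discretization \<Rightarrow> (cell \<Rightarrow> point set \<Rightarrow> nat \<Rightarrow> real) \<Rightarrow> (cell \<Rightarrow> point \<Rightarrow> real) \<Rightarrow>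
     (cell \<Rightarrow> point \<Rightarrow> real) \<Rightarrow> (cell \<Rightarrow> point \<Rightarrow> state) \<Rightarrow> cell \<Rightarrow> real" where
  "alpha_S2 D pb re pe U K =
    norm (\<Sum>E\<in>edges K.
           (edge_length E * (\<Sum>\<mu>=1..edge_num D. edge_wt D \<mu> * jump D pb pe K E \<mu>)) *\<^sub>R
           outward_normal K E)
    / (2 * area K * cell_avg K (re K) * sqrt (2 * eint (cell_avg K (U K))))"

definition alpha_S ::
    "discretization \<Rightarrow> (cell \<Rightarrow> point set \<Rightarrow> nat \<Rightarrow> real) \<Rightarrow> (cell \<Rightarrow> point \<Rightarrow> real) \<Rightarrow>
     (cell \<Rightarrow> point \<Rightarrow> real) \<Rightarrow> (cell \<Rightarrow> point \<Rightarrow> state) \<Rightarrow> cell \<Rightarrow> real" where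
  "alpha_S D pb re pe U K = alpha_S1 D re pe U K + alpha_S2 D pb re pe U K"

end

theory Submission
  imports Defs
begin

text \<open>A state is admissible if it lies in the interior of the cone $\rho \ge 0$, $E \ge 0$,
$\|{\bf m}\|^2 \le 2 \rho E$. This cone is closed under sums and nonnegative multiples, and adding
one of its elements to an admissible state keeps the state admissible. So it suffices to write the
updated cell average as a sum of elements of the cone, at least one of which is admissible.

The cell average is split in the proportions \<open>\<theta> = 1 - \<Delta>t (\<alpha>\<^sub>1 + \<alpha>\<^sub>2)\<close>, \<open>\<Delta>t \<alpha>\<^sub>1\<close> and \<open>\<Delta>t \<alpha>\<^sub>2\<close>,
where \<open>\<alpha>\<^sub>1\<close>, \<open>\<alpha>\<^sub>2\<close> are the two summands of the source speed. The first share pays for the fluxes and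
the other two for the source.

\<^item> Fluxes. The special quadrature expresses the first share by point values. At an edge node
  with interior state \<open>U\<close>, rescaled to \<open>V = a U\<close> with \<open>a = p\<^sup>\<star> / p\<^sup>i\<^sup>n\<^sup>t\<close>, the CFL condition leaves at
  least \<open>2 \<alpha> V\<close> for every unit of numerical flux. This is enough: \<open>\<alpha> V - F(V)\<cdot>n\<close> is in
  the cone (\<open>flux_dominated\<close>), and \<open>\<alpha> V\<close> minus the difference between the HLLC flux and
  \<open>F(V)\<cdot>n\<close> is the integral of the approximate Riemann solution over the interval from \<open>-\<alpha>\<close> to
  \<open>0\<close> of wave speeds, which consists of admissible states (\<open>hllc_left_average_admissible\<close>).

\<^item> Source. A source of the form \<open>(0, \<rho> g, m\<cdot>g)\<close> is tangent to the level sets of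
  $2 \rho E - \|{\bf m}\|^2$, so adding it to \<open>\<alpha> U\<close> has only a quadratic effect on this quantity and
  stays in the cone as long as \<open>\<parallel>g\<parallel> \<le> \<alpha> sqrt(2 e)\<close> (\<open>source_dominated\<close>). The source of the
  scheme is a sum of such terms. Indeed, the terms with the cell average \<open>\<rho>\<^sub>K / \<rho>\<^sub>K\<^sup>e\<close> combine the
  quadrature of \<open>\<nabla>p\<^sup>e\<close> with the boundary sum of \<open>p\<^sup>\<star> n\<close>; the divergence theorem turns the former
  into a boundary sum of interior values of \<open>p\<^sup>e\<close>, so only half the jumps survive
  (\<open>source_split\<close>). These are what the second summand of the source speed measures.

The divergence theorem on a simple polygon (\<open>polygon_divergence\<close>) is proved by slicing with the
lines parallel to a coordinate axis. The Jordan-Brouwer theorem shows that at each interior point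
of an edge one side is inside and the other outside; by connectedness the outer side is the same
along the whole edge. Hence the fundamental theorem of calculus on almost every line gives a sum over the
crossed edges, with the sign of the outward normal, and integrating over the lines gives the edge
integrals.\<close>


section \<open>The cone of admissible states\<close>

lemma state_components [simp]:
  "dens (U + V) = dens U + dens V" "mom (U + V) = mom U + mom V" "ener (U + V) = ener U + ener V"
  "dens (U - V) = dens U - dens V" "mom (U - V) = mom U - mom V" "ener (U - V) = ener U - ener V"
  "dens (c *\<^sub>R U) = c * dens U" "mom (c *\<^sub>R U) = c *\<^sub>R mom U" "ener (c *\<^sub>R U) = c * ener U"
  "dens (r, m, E) = r" "mom (r, m, E) = m" "ener (r, m, E) = E"
  "dens 0 = 0" "mom 0 = 0" "ener 0 = 0"
  by (simp_all add: dens_def mom_def ener_def)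

lemma state_eqI: "dens U = dens V \<Longrightarrow> mom U = mom V \<Longrightarrow> ener U = ener V \<Longrightarrow> U = V"
  by (simp add: dens_def mom_def ener_def prod_eq_iff)

text \<open>In the variables \<open>(\<rho> + 2 E, \<rho> - 2 E, 2 m)\<close> this is a second-order cone; its interior is the
set of admissible states.\<close>

definition energy_cone :: "state set" where
  "energy_cone = {U. 0 \<le> dens U \<and> 0 \<le> ener U \<and> (norm (mom U))\<^sup>2 \<le> 2 * dens U * ener U}"

lemma admissible_iff:
  "U \<in> admissible \<longleftrightarrow> 0 < dens U \<and> (norm (mom U))\<^sup>2 < 2 * dens U * ener U"
  by (cases U) (auto simp: admissible_def field_simps)

lemma admissible_subset_cone: "admissible \<subseteq> energy_cone"
proof
  fix U assume U: "U \<in> admissible"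
  then have "0 < dens U" "0 < 2 * dens U * ener U"
    unfolding admissible_iff using order.strict_trans1[OF zero_le_power2] by blast+
  with U show "U \<in> energy_cone"
    by (auto simp: admissible_iff energy_cone_def zero_less_mult_iff)
qed

text \<open>By Cauchy-Schwarz and the inequality between the arithmetic and geometric means, the cross term
\<open>2 m\<cdot>m'\<close> is at most \<open>4 sqrt (r E' r' E)\<close> and hence at most \<open>2 (r E' + r' E)\<close>, which is exactly
the cross term of \<open>2 (r + r') (E + E')\<close>.\<close>

lemma cone_cross_term:
  fixes m m' :: "real^2" and r E r' E' :: real
  assumes "0 \<le> r" "0 \<le> E" "(norm m)\<^sup>2 \<le> 2 * r * E" "0 \<le> r'" "0 \<le> E'" "(norm m')\<^sup>2 \<le> 2 * r' * E'"
  shows "(norm (m + m'))\<^sup>2 \<le> (norm m)\<^sup>2 + (norm m')\<^sup>2 + 2 * (r * E' + r' * E)"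
proof -
  have "(norm m * norm m')\<^sup>2 \<le> (2 * r * E) * (2 * r' * E')"
    unfolding power_mult_distrib using assms by (intro mult_mono) auto
  also have "\<dots> \<le> (r * E' + r' * E)\<^sup>2"
    using zero_le_power2[of "r * E' - r' * E"] by (simp add: power2_eq_square algebra_simps)
  finally have "norm m * norm m' \<le> r * E' + r' * E"
    by (rule power2_le_imp_le) (use assms in auto)
  moreover have "(norm (m + m'))\<^sup>2 \<le> (norm m + norm m')\<^sup>2"
    by (intro power_mono norm_triangle_ineq norm_ge_zero)
  ultimately show ?thesis by (simp add: power2_eq_square algebra_simps)
qed

lemma energy_cone_add:
  assumes "U \<in> energy_cone" "V \<in> energy_cone" shows "U + V \<in> energy_cone"
  using cone_cross_term[of "dens U" "ener U" "mom U" "dens V" "ener V" "mom V"] assms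
  by (auto simp: energy_cone_def algebra_simps)

lemma admissible_add_cone:
  assumes "U \<in> admissible" "V \<in> energy_cone" shows "U + V \<in> admissible"
proof -
  have "U \<in> energy_cone" using assms(1) admissible_subset_cone by auto
  then show ?thesis
    using cone_cross_term[of "dens U" "ener U" "mom U" "dens V" "ener V" "mom V"] assms
    by (auto simp: energy_cone_def admissible_iff algebra_simps)
qed

lemma energy_cone_scale:
  assumes "U \<in> energy_cone" "0 \<le> c" shows "c *\<^sub>R U \<in> energy_cone"
proof -
  have "c\<^sup>2 * (norm (mom U))\<^sup>2 \<le> c\<^sup>2 * (2 * dens U * ener U)"
    using assms by (intro mult_left_mono) (auto simp: energy_cone_def)
  then show ?thesis using assms
    by (auto simp: energy_cone_def power_mult_distrib power2_eq_square algebra_simps)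
qed

lemma admissible_scale:
  assumes "U \<in> admissible" "0 < c" shows "c *\<^sub>R U \<in> admissible"
proof -
  have "c\<^sup>2 * (norm (mom U))\<^sup>2 < c\<^sup>2 * (2 * dens U * ener U)"
    using assms by (intro mult_strict_left_mono) (auto simp: admissible_iff)
  then show ?thesis using assms
    by (auto simp: admissible_iff power_mult_distrib power2_eq_square algebra_simps)
qed

lemma zero_in_cone [simp]: "0 \<in> energy_cone"
  by (simp add: energy_cone_def)

lemma energy_cone_sum: "(\<And>i. i \<in> A \<Longrightarrow> f i \<in> energy_cone) \<Longrightarrow> sum f A \<in> energy_cone"
  by (induction A rule: infinite_finite_induct) (auto intro: energy_cone_add)

lemma admissible_sum:
  assumes "finite A" "A \<noteq> {}" "\<And>i. i \<in> A \<Longrightarrow> f i \<in> admissible"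
  shows "sum f A \<in> admissible"
proof -
  obtain i where i: "i \<in> A" using assms by auto
  have "f i + sum f (A - {i}) \<in> admissible"
    using assms i admissible_subset_cone by (intro admissible_add_cone energy_cone_sum) auto
  then show ?thesis using assms i by (simp add: sum.remove)
qed

lemma admissible_combination:
  assumes "U \<in> admissible" "V \<in> admissible" "0 \<le> a" "0 \<le> b" "0 < a + b"
  shows "a *\<^sub>R U + b *\<^sub>R V \<in> admissible"
proof (cases "a = 0")
  case True
  then show ?thesis using assms admissible_scale by simp
next
  case False
  then show ?thesis using assms admissible_subset_cone
    by (intro admissible_add_cone admissible_scale energy_cone_scale) auto
qed


section \<open>Fluxes and sources dominated by the state\<close>

lemma admissible_decomp:
  assumes "U \<in> admissible"
  shows "0 < dens U" "0 < eint U" "mom U = dens U *\<^sub>R vel U"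
    "ener U = dens U * (eint U + (norm (vel U))\<^sup>2 / 2)"
  using assms
  by (auto simp: admissible_iff vel_def eint_def field_simps power2_eq_square)

lemma pres_pos: "\<gamma> > 1 \<Longrightarrow> U \<in> admissible \<Longrightarrow> 0 < pres \<gamma> U"
  using admissible_decomp by (simp add: pres_def)

lemma sound_speed_pos: "\<gamma> > 1 \<Longrightarrow> U \<in> admissible \<Longrightarrow> 0 < sound_speed \<gamma> U"
  using admissible_decomp pres_pos by (simp add: sound_speed_def)

lemma sound_speed_sq:
  assumes "\<gamma> > 1" "U \<in> admissible"
  shows "dens U * (sound_speed \<gamma> U)\<^sup>2 = \<gamma> * pres \<gamma> U"
    "(sound_speed \<gamma> U)\<^sup>2 = \<gamma> * (\<gamma> - 1) * eint U"
  using admissible_decomp(1,2)[OF assms(2)] pres_pos[OF assms] assms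
  by (auto simp: sound_speed_def pres_def)

lemma norm_sq_diff: "(norm (a - b))\<^sup>2 = (norm a)\<^sup>2 - 2 * (a \<bullet> b) + (norm (b::real^2))\<^sup>2"
  by (simp add: power2_norm_eq_inner inner_diff inner_commute)

lemma norm_sq_add: "(norm (a + b))\<^sup>2 = (norm a)\<^sup>2 + 2 * (a \<bullet> b) + (norm (b::real^2))\<^sup>2"
  by (simp add: power2_norm_eq_inner inner_add inner_commute)

text \<open>With \<open>b = \<alpha> - u\<cdot>n\<close>, the terms with the normal velocity cancel from the cone inequality, which
becomes \<open>p\<^sup>2 \<le> 2 \<rho>\<^sup>2 e b\<^sup>2\<close>. Since \<open>b\<close> is at least the sound speed, the right-hand side is at
least \<open>2 \<gamma> p\<^sup>2 / (\<gamma> - 1)\<close>.\<close>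

lemma flux_dominated:
  assumes g: "\<gamma> > 1" and U: "U \<in> admissible" and n: "norm n = 1"
    and a: "max_speed \<gamma> n U \<le> \<alpha>"
  shows "\<alpha> *\<^sub>R U - flux \<gamma> U n \<in> energy_cone"
proof -
  note d = admissible_decomp[OF U]
  define r e u q c b where "r = dens U" and "e = eint U" and "u = vel U" and "q = u \<bullet> n"
    and "c = sound_speed \<gamma> U" and "b = \<alpha> - q"
  have r: "0 < r" and e: "0 < e" using d by (auto simp: r_def e_def)
  have c: "0 < c" "c\<^sup>2 = \<gamma> * (\<gamma> - 1) * e"
    using sound_speed_pos[OF g U] sound_speed_sq[OF g U] by (auto simp: c_def e_def)
  have p: "pres \<gamma> U = (\<gamma> - 1) * r * e" by (simp add: pres_def r_def e_def)
  have bc: "c \<le> b" using a by (auto simp: max_speed_def sound_speed_def c_def b_def q_def u_def)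
  have V: "\<alpha> *\<^sub>R U - flux \<gamma> U n = (b * r, (b * r) *\<^sub>R u - ((\<gamma> - 1) * r * e) *\<^sub>R n,
      b * r * (e + (norm u)\<^sup>2 / 2) - (\<gamma> - 1) * r * e * q)"
    by (rule state_eqI)
      (simp_all add: flux_def d(3,4) p b_def field_simps flip: r_def e_def u_def q_def)
  have nm: "(norm ((b * r) *\<^sub>R u - ((\<gamma> - 1) * r * e) *\<^sub>R n))\<^sup>2
      = (b * r)\<^sup>2 * (norm u)\<^sup>2 - 2 * (b * r) * ((\<gamma> - 1) * r * e) * q + ((\<gamma> - 1) * r * e)\<^sup>2"
    by (simp add: norm_sq_diff power_mult_distrib n q_def)
  have "c\<^sup>2 \<le> b\<^sup>2" using bc c by (intro power_mono) auto
  then have "2 * r\<^sup>2 * e * (\<gamma> * (\<gamma> - 1) * e) \<le> 2 * r\<^sup>2 * e * b\<^sup>2"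
    using c r e by (intro mult_left_mono) auto
  moreover have "0 \<le> (r * e)\<^sup>2 * ((\<gamma> - 1) * (\<gamma> + 1))"
    using g by (intro mult_nonneg_nonneg) auto
  ultimately have "((\<gamma> - 1) * r * e)\<^sup>2 \<le> 2 * r\<^sup>2 * e * b\<^sup>2"
    by (simp add: power2_eq_square algebra_simps)
  then have le: "(norm ((b * r) *\<^sub>R u - ((\<gamma> - 1) * r * e) *\<^sub>R n))\<^sup>2
      \<le> 2 * (b * r) * (b * r * (e + (norm u)\<^sup>2 / 2) - (\<gamma> - 1) * r * e * q)"
    unfolding nm by (simp add: power2_eq_square algebra_simps)
  have br: "0 < b * r" using bc c r by auto
  have "0 \<le> 2 * (b * r) * (b * r * (e + (norm u)\<^sup>2 / 2) - (\<gamma> - 1) * r * e * q)"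
    by (rule order_trans[OF zero_le_power2 le])
  then have "0 \<le> b * r * (e + (norm u)\<^sup>2 / 2) - (\<gamma> - 1) * r * e * q"
    using br by (simp add: zero_le_mult_iff)
  then show ?thesis unfolding V energy_cone_def using br le by simp
qed

text \<open>The internal energy of the intermediate state is the quadratic \<open>e + x\<^sup>2/2 + x p / (\<rho> (S - q))\<close> in
\<open>x = Ss - q\<close>. Its discriminant is negative because the outer wave moves relative to the fluid at
no less than the sound speed.\<close>

lemma mid_state_admissible:
  assumes g: "\<gamma> > 1" and U: "U \<in> admissible" and n: "norm n = 1"
    and S: "sound_speed \<gamma> U \<le> \<bar>S - vel U \<bullet> n\<bar>" and pos: "0 < (S - vel U \<bullet> n) / (S - Ss)"
  shows "hllc_mid_state \<gamma> U n S Ss \<in> admissible"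
proof -
  note d = admissible_decomp[OF U]
  define r e u q c s x where "r = dens U" and "e = eint U" and "u = vel U" and "q = u \<bullet> n"
    and "c = sound_speed \<gamma> U" and "s = S - q" and "x = Ss - q"
  have r: "0 < r" and e: "0 < e" using d by (auto simp: r_def e_def)
  have c: "0 < c" "c\<^sup>2 = \<gamma> * (\<gamma> - 1) * e"
    using sound_speed_pos[OF g U] sound_speed_sq[OF g U] by (auto simp: c_def e_def)
  have cs: "c \<le> \<bar>s\<bar>" using S by (simp add: c_def s_def q_def u_def)
  then have s0: "s \<noteq> 0" using c by auto
  have p: "pres \<gamma> U / (r * s) = (\<gamma> - 1) * e / s" using r by (simp add: pres_def r_def e_def)
  have E: "ener U / dens U = e + (norm u)\<^sup>2 / 2" using d by (simp add: e_def u_def)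
  have "c\<^sup>2 \<le> s\<^sup>2" using cs c by (metis abs_le_square_iff abs_of_pos)
  then have cs2: "\<gamma> * (\<gamma> - 1) * e \<le> s\<^sup>2" using c by simp
  have "((\<gamma> - 1) * e)\<^sup>2 < 2 * e * (\<gamma> * (\<gamma> - 1) * e)"
  proof -
    have "0 < e\<^sup>2 * ((\<gamma> - 1) * (\<gamma> + 1))" using g e by (intro mult_pos_pos) auto
    then show ?thesis by (simp add: power2_eq_square algebra_simps)
  qed
  also have "\<dots> \<le> 2 * e * s\<^sup>2" using cs2 e by (intro mult_left_mono) auto
  finally have disc: "((\<gamma> - 1) * e / s)\<^sup>2 < 2 * e"
    using s0 by (simp add: power_divide divide_less_eq)
  have "0 \<le> (x + (\<gamma> - 1) * e / s)\<^sup>2" by simp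
  with disc have quad: "0 < 2 * e + x\<^sup>2 + 2 * x * ((\<gamma> - 1) * e / s)"
    unfolding power2_sum by linarith
  let ?V = "(1, u + x *\<^sub>R n, e + (norm u)\<^sup>2 / 2 + x * (Ss + (\<gamma> - 1) * e / s)) :: state"
  have "(norm (u + x *\<^sub>R n))\<^sup>2 = (norm u)\<^sup>2 + 2 * x * q + x\<^sup>2"
    by (simp add: norm_sq_add n q_def power_mult_distrib)
  moreover have "Ss = x + q" by (simp add: x_def)
  ultimately have "?V \<in> admissible"
    using quad by (simp add: admissible_iff power2_eq_square algebra_simps)
  moreover have "hllc_mid_state \<gamma> U n S Ss = (r * (s / (S - Ss))) *\<^sub>R ?V"
    unfolding hllc_mid_state_def Let_def E using p
    by (simp flip: r_def q_def u_def s_def x_def)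
  moreover have "0 < r * (s / (S - Ss))"
    using mult_pos_pos[OF r pos] by (simp add: s_def q_def u_def)
  ultimately show ?thesis using admissible_scale by metis
qed

text \<open>Both intermediate fluxes have the form of an Euler flux with velocity \<open>Ss\<close> and some pressure. The
contact speed is chosen so that the two pressures agree, which yields the jump condition across the
contact.\<close>

lemma mid_flux_eq:
  assumes "0 < dens U" "S \<noteq> vel U \<bullet> n" "S \<noteq> Ss"
  shows "hllc_mid_flux \<gamma> U n S Ss = Ss *\<^sub>R hllc_mid_state \<gamma> U n S Ss +
    (pres \<gamma> U + dens U * (S - vel U \<bullet> n) * (Ss - vel U \<bullet> n)) *\<^sub>R (0, n, Ss)"
proof -
  define r u q E p s x where "r = dens U" and "u = vel U" and "q = u \<bullet> n" and "E = ener U"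
    and "p = pres \<gamma> U" and "s = S - q" and "x = Ss - q"
  have m: "mom U = r *\<^sub>R u" using assms by (simp add: r_def u_def vel_def)
  define k where "k = r * (s / (S - Ss))"
  have k: "k * (S - Ss) = r * s" using assms by (simp add: k_def)
  have rs: "r \<noteq> 0" "s \<noteq> 0" using assms by (auto simp: r_def s_def q_def u_def)
  let ?V = "(1, u + x *\<^sub>R n, E / r + x * (Ss + p / (r * s))) :: state"
  have V: "hllc_mid_state \<gamma> U n S Ss = k *\<^sub>R ?V"
    unfolding hllc_mid_state_def Let_def k_def
    by (simp flip: r_def q_def u_def s_def x_def p_def E_def)
  have e: "(r * s) *\<^sub>R ?V = (r * s, (r * s) *\<^sub>R u + (r * s * x) *\<^sub>R n, s * E + x * (r * s * Ss + p))"
    using rs by (simp add: algebra_simps)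
  have F: "flux \<gamma> U n - S *\<^sub>R U + (r * s) *\<^sub>R ?V = (p + r * s * x) *\<^sub>R (0, n, Ss)"
    unfolding e by (rule state_eqI)
      (simp_all add: flux_def m algebra_simps s_def x_def flip: r_def q_def u_def p_def E_def)
  have "hllc_mid_flux \<gamma> U n S Ss = flux \<gamma> U n - S *\<^sub>R U + (k * (S - Ss)) *\<^sub>R ?V + Ss *\<^sub>R k *\<^sub>R ?V"
    unfolding hllc_mid_flux_def V by (simp only: algebra_simps scaleR_scaleR)
  also have "\<dots> = (p + r * s * x) *\<^sub>R (0, n, Ss) + Ss *\<^sub>R k *\<^sub>R ?V"
    unfolding k F ..
  finally show ?thesis unfolding V by (simp add: r_def s_def x_def p_def q_def u_def)
qed

text \<open>Each inequality reduces to the fact that one pressure is less than \<open>\<rho> c\<^sup>2 = \<gamma> p\<close> of the same side,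
as the outer wave speeds differ from either normal velocity by at least the sound speed. The last
equation is the defining property of the contact speed.\<close>

lemma hllc_speed_order:
  fixes n :: "real^2"
  assumes g: "\<gamma> > 1" and L: "UL \<in> admissible" and R: "UR \<in> admissible"
  defines "SL \<equiv> hllc_SL \<gamma> UL UR n" and "SR \<equiv> hllc_SR \<gamma> UL UR n"
    and "Ss \<equiv> hllc_Sstar \<gamma> UL UR n"
  shows "SL < Ss" "Ss < SR"
    "pres \<gamma> UL + dens UL * (SL - vel UL \<bullet> n) * (Ss - vel UL \<bullet> n) =
     pres \<gamma> UR + dens UR * (SR - vel UR \<bullet> n) * (Ss - vel UR \<bullet> n)"
proof -
  define qL qR pL pR rL rR cL cR where "qL = vel UL \<bullet> n" and "qR = vel UR \<bullet> n"
    and "pL = pres \<gamma> UL" and "pR = pres \<gamma> UR" and "rL = dens UL" and "rR = dens UR"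
    and "cL = sound_speed \<gamma> UL" and "cR = sound_speed \<gamma> UR"
  note defs = qL_def qR_def pL_def pR_def rL_def rR_def cL_def cR_def
  have pos: "0 < rL" "0 < rR" "0 < pL" "0 < pR" "0 < cL" "0 < cR"
    using admissible_decomp(1) pres_pos[OF g] sound_speed_pos[OF g] L R by (auto simp: defs)
  have sq: "rL * cL\<^sup>2 = \<gamma> * pL" "rR * cR\<^sup>2 = \<gamma> * pR"
    using sound_speed_sq(1)[OF g] L R by (auto simp: defs)
  have lt: "pL < rL * cL\<^sup>2" "pR < rR * cR\<^sup>2" unfolding sq using g pos by auto
  have bd: "cL \<le> qL - SL" "cR \<le> qR - SL" "cL \<le> SR - qL" "cR \<le> SR - qR"
    by (auto simp: SL_def SR_def hllc_SL_def hllc_SR_def defs)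
  define a b where "a = rL * (qL - SL)" and "b = rR * (SR - qR)"
  have ca: "rL * cL \<le> a" "rR * cR \<le> b" unfolding a_def b_def using bd pos by auto
  have ab: "0 < a" "0 < b" using bd pos by (auto simp: a_def b_def)
  have Ss0: "Ss = (pR - pL - a * qL - b * qR) / (- a - b)"
    unfolding Ss_def hllc_Sstar_def Let_def a_def b_def
    by (simp add: algebra_simps flip: defs SL_def SR_def)
  then have Ss: "Ss * (a + b) = pL - pR + a * qL + b * qR"
    using ab by (simp add: field_simps)
  have "rR * cR * cR \<le> b * (qR - SL)" "rL * cL * cL \<le> a * (qL - SL)"
    using ca bd pos ab by (auto intro!: mult_mono)
  then have "0 < pL - pR + a * (qL - SL) + b * (qR - SL)"
    using lt pos by (simp add: power2_eq_square mult.assoc)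
  then have "SL * (a + b) < Ss * (a + b)" unfolding Ss by (simp add: algebra_simps)
  then show "SL < Ss" using ab by auto
  have "rL * cL * cL \<le> a * (SR - qL)" "rR * cR * cR \<le> b * (SR - qR)"
    using ca bd pos ab by (auto intro!: mult_mono)
  then have "0 < pR - pL + a * (SR - qL) + b * (SR - qR)"
    using lt pos by (simp add: power2_eq_square mult.assoc)
  then have "Ss * (a + b) < SR * (a + b)" unfolding Ss by (simp add: algebra_simps)
  then show "Ss < SR" using ab by auto
  have "pL - a * (Ss - qL) = pR + b * (Ss - qR)" using Ss by (simp add: algebra_simps)
  then show "pres \<gamma> UL + dens UL * (SL - vel UL \<bullet> n) * (Ss - vel UL \<bullet> n) =
     pres \<gamma> UR + dens UR * (SR - vel UR \<bullet> n) * (Ss - vel UR \<bullet> n)"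
    unfolding a_def b_def by (simp add: algebra_simps flip: defs)
qed

text \<open>The left-hand side is the integral over \<open>[-\<alpha>, 0]\<close> of the four-state approximate Riemann solution:
by the jump conditions, the HLLC flux differs from the left flux by \<open>S\<close> times the jump, summed over
all waves with \<open>S < 0\<close>. So the left-hand side is a combination of the four states, whose coefficients
are the lengths of the parts of \<open>[-\<alpha>, 0]\<close> between consecutive waves.\<close>

lemma hllc_left_average_admissible:
  assumes g: "\<gamma> > 1" and L: "UL \<in> admissible" and R: "UR \<in> admissible" and n: "norm n = 1"
    and aL: "max_speed \<gamma> n UL \<le> \<alpha>" and aR: "max_speed \<gamma> n UR \<le> \<alpha>"
  shows "\<alpha> *\<^sub>R UL - (hllc_flux \<gamma> UL UR n - flux \<gamma> UL n) \<in> admissible"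
proof -
  define SL SR Ss where "SL = hllc_SL \<gamma> UL UR n" and "SR = hllc_SR \<gamma> UL UR n"
    and "Ss = hllc_Sstar \<gamma> UL UR n"
  define VL VR where "VL = hllc_mid_state \<gamma> UL n SL Ss" and "VR = hllc_mid_state \<gamma> UR n SR Ss"
  note ord = hllc_speed_order[OF g L R, of n, folded SL_def SR_def Ss_def]
  have cpos: "0 < sound_speed \<gamma> UL" "0 < sound_speed \<gamma> UR"
    using sound_speed_pos[OF g] L R by auto
  have bd: "SL \<le> vel UL \<bullet> n - sound_speed \<gamma> UL" "vel UR \<bullet> n + sound_speed \<gamma> UR \<le> SR"
    by (auto simp: SL_def SR_def hllc_SL_def hllc_SR_def)
  have apos: "0 < \<alpha>"
    using aL cpos(1) abs_ge_zero[of "vel UL \<bullet> n"]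
    unfolding max_speed_def sound_speed_def[symmetric] by linarith
  have aS: "- SL \<le> \<alpha>"
    using aL aR cpos by (auto simp: SL_def hllc_SL_def max_speed_def sound_speed_def min_def)
  have VL: "VL \<in> admissible" unfolding VL_def
    using bd cpos ord by (intro mid_state_admissible g L n divide_neg_neg) auto
  have VR: "VR \<in> admissible" unfolding VR_def
    using bd cpos ord by (intro mid_state_admissible g R n divide_pos_pos) auto
  have FL: "hllc_mid_flux \<gamma> UL n SL Ss - flux \<gamma> UL n = SL *\<^sub>R (VL - UL)"
    by (simp add: hllc_mid_flux_def VL_def)
  have RH: "hllc_mid_flux \<gamma> UR n SR Ss - hllc_mid_flux \<gamma> UL n SL Ss = Ss *\<^sub>R (VR - VL)"
    using mid_flux_eq[of UL SL n Ss \<gamma>] mid_flux_eq[of UR SR n Ss \<gamma>] ord bd cpos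
      admissible_decomp(1)[OF L] admissible_decomp(1)[OF R]
    by (simp add: VL_def VR_def scaleR_diff_right)
  have FR: "flux \<gamma> UR n - hllc_mid_flux \<gamma> UR n SR Ss = SR *\<^sub>R (UR - VR)"
    by (simp add: hllc_mid_flux_def VR_def algebra_simps)
  consider "0 \<le> SL" | "SL < 0" "0 \<le> Ss" | "SL < 0" "Ss < 0" "0 \<le> SR" | "SL < 0" "Ss < 0" "SR < 0"
    by linarith
  then show ?thesis
  proof cases
    case 1
    then show ?thesis using admissible_scale[OF L apos]
      by (simp add: hllc_flux_def Let_def flip: SL_def SR_def Ss_def)
  next
    case 2
    then have "hllc_flux \<gamma> UL UR n = hllc_mid_flux \<gamma> UL n SL Ss"
      by (simp add: hllc_flux_def Let_def flip: SL_def SR_def Ss_def)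
    then have "\<alpha> *\<^sub>R UL - (hllc_flux \<gamma> UL UR n - flux \<gamma> UL n) = (\<alpha> + SL) *\<^sub>R UL + (- SL) *\<^sub>R VL"
      using FL by (simp add: algebra_simps)
    then show ?thesis using 2 aS apos by (simp only:) (intro admissible_combination L VL, auto)
  next
    case 3
    then have "hllc_flux \<gamma> UL UR n = hllc_mid_flux \<gamma> UR n SR Ss"
      by (simp add: hllc_flux_def Let_def flip: SL_def SR_def Ss_def)
    then have "hllc_flux \<gamma> UL UR n - flux \<gamma> UL n = SL *\<^sub>R (VL - UL) + Ss *\<^sub>R (VR - VL)"
      using FL RH by (simp add: algebra_simps)
    then have "\<alpha> *\<^sub>R UL - (hllc_flux \<gamma> UL UR n - flux \<gamma> UL n)
        = ((Ss - SL) *\<^sub>R VL + (- Ss) *\<^sub>R VR) + (\<alpha> + SL) *\<^sub>R UL"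
      by (simp add: algebra_simps)
    then show ?thesis using 3 aS apos ord L admissible_subset_cone
      by (simp only:) (intro admissible_add_cone admissible_combination VL VR energy_cone_scale, auto)
  next
    case 4
    then have "hllc_flux \<gamma> UL UR n = flux \<gamma> UR n"
      using ord by (simp add: hllc_flux_def Let_def flip: SL_def SR_def Ss_def)
    then have "hllc_flux \<gamma> UL UR n - flux \<gamma> UL n
        = SL *\<^sub>R (VL - UL) + Ss *\<^sub>R (VR - VL) + SR *\<^sub>R (UR - VR)"
      unfolding FL[symmetric] RH[symmetric] FR[symmetric] by simp
    then have "\<alpha> *\<^sub>R UL - (hllc_flux \<gamma> UL UR n - flux \<gamma> UL n)
        = (((Ss - SL) *\<^sub>R VL + (SR - Ss) *\<^sub>R VR) + (- SR) *\<^sub>R UR) + (\<alpha> + SL) *\<^sub>R UL"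
      by (simp add: algebra_simps)
    then show ?thesis using 4 aS apos ord L R admissible_subset_cone
      by (simp only:) (intro admissible_add_cone admissible_combination VL VR energy_cone_scale, auto)
  qed
qed

text \<open>One multiple of \<open>\<alpha> UL\<close> pays for the flux of \<open>UL\<close> itself, the other for the difference between the
HLLC flux and this flux.\<close>

lemma hllc_dominated:
  assumes "\<gamma> > 1" "UL \<in> admissible" "UR \<in> admissible" "norm n = 1"
    "max_speed \<gamma> n UL \<le> \<alpha>" "max_speed \<gamma> n UR \<le> \<alpha>"
  shows "(2 * \<alpha>) *\<^sub>R UL - hllc_flux \<gamma> UL UR n \<in> admissible"
proof -
  have "(\<alpha> *\<^sub>R UL - (hllc_flux \<gamma> UL UR n - flux \<gamma> UL n)) + (\<alpha> *\<^sub>R UL - flux \<gamma> UL n) \<in> admissible"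
    using assms by (intro admissible_add_cone hllc_left_average_admissible flux_dominated)
  then show ?thesis by (simp add: algebra_simps flip: scaleR_add_left mult_2)
qed

text \<open>Velocity and internal energy are homogeneous of degree 0, so the rescaling by stationary pressures
in the well-balanced flux does not affect the CFL speeds.\<close>

lemma max_speed_scale:
  assumes "0 < a" "U \<in> admissible" shows "max_speed \<gamma> n (a *\<^sub>R U) = max_speed \<gamma> n U"
  using assms admissible_decomp(1)[OF assms(2)]
  by (simp add: max_speed_def vel_def pres_def eint_def field_simps power2_eq_square)

text \<open>Adding the source changes \<open>2 \<rho> E - \<parallel>m\<parallel>\<^sup>2\<close> only by \<open>- \<rho>\<^sup>2 \<parallel>g\<parallel>\<^sup>2\<close>, because the work \<open>m\<cdot>g\<close> cancels
the mixed term of the momentum. The bound on \<open>g\<close> is the resulting inequality.\<close>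

lemma source_dominated:
  assumes U: "U \<in> admissible" and a: "0 \<le> \<alpha>" and g: "norm g \<le> \<alpha> * sqrt (2 * eint U)"
  shows "\<alpha> *\<^sub>R U + (0, dens U *\<^sub>R g, mom U \<bullet> g) \<in> energy_cone"
proof (cases "\<alpha> = 0")
  case True
  then have "g = 0" using g by simp
  then have "(0, dens U *\<^sub>R g, mom U \<bullet> g) = (0::state)" by (simp add: zero_prod_def)
  then show ?thesis using True by simp
next
  case False
  then have a: "0 < \<alpha>" using a by simp
  note d = admissible_decomp[OF U]
  define r e m where "r = dens U" and "e = eint U" and "m = mom U"
  have r: "0 < r" and e: "0 < e" using d by (auto simp: r_def e_def)
  have E: "2 * r * ener U = 2 * r\<^sup>2 * e + (norm m)\<^sup>2"
    using d(1) by (simp add: r_def e_def m_def eint_def field_simps power2_eq_square)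
  have "(norm g)\<^sup>2 \<le> (\<alpha> * sqrt (2 * e))\<^sup>2"
    using g by (intro power_mono) (auto simp: e_def)
  then have "r\<^sup>2 * (norm g)\<^sup>2 \<le> r\<^sup>2 * (\<alpha>\<^sup>2 * (2 * e))"
    using e by (intro mult_left_mono) (auto simp: power_mult_distrib)
  moreover have "2 * (\<alpha> * r) * (\<alpha> * ener U + m \<bullet> g) = \<alpha>\<^sup>2 * (2 * r * ener U) + 2 * \<alpha> * r * (m \<bullet> g)"
    by (simp add: algebra_simps power2_eq_square)
  ultimately have le: "(norm (\<alpha> *\<^sub>R m + r *\<^sub>R g))\<^sup>2 \<le> 2 * (\<alpha> * r) * (\<alpha> * ener U + m \<bullet> g)"
    unfolding norm_sq_add E by (simp add: power_mult_distrib algebra_simps)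
  have "0 \<le> 2 * (\<alpha> * r) * (\<alpha> * ener U + m \<bullet> g)" by (rule order_trans[OF zero_le_power2 le])
  moreover have "0 < 2 * (\<alpha> * r)" using a r by simp
  ultimately have "0 \<le> \<alpha> * ener U + m \<bullet> g"
    by (metis zero_le_mult_iff linorder_not_less)
  then show ?thesis using a r le by (simp add: energy_cone_def flip: r_def m_def)
qed

text \<open>The factor \<open>\<kappa>\<close> is the share of the interior state \<open>U\<close> that is left for the flux at one edge node,
and \<open>\<tau>\<close> is the coefficient of the flux. The inequality between them is the CFL condition.\<close>

lemma edge_term_admissible:
  assumes g: "\<gamma> > 1" and n: "norm n = 1" and U: "U \<in> admissible" "V \<in> admissible"
    and ab: "0 < a" "0 < b" and \<alpha>: "max_speed \<gamma> n U \<le> \<alpha>" "max_speed \<gamma> n V \<le> \<alpha>"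
    and l: "0 < \<tau>" "2 * \<alpha> * a * \<tau> \<le> \<kappa>"
  shows "\<kappa> *\<^sub>R U - \<tau> *\<^sub>R hllc_flux \<gamma> (a *\<^sub>R U) (b *\<^sub>R V) n \<in> admissible"
proof -
  let ?F = "hllc_flux \<gamma> (a *\<^sub>R U) (b *\<^sub>R V) n"
  have "(2 * \<alpha>) *\<^sub>R (a *\<^sub>R U) - ?F \<in> admissible"
    using max_speed_scale[OF ab(1) U(1), of \<gamma> n] max_speed_scale[OF ab(2) U(2), of \<gamma> n] \<alpha>
    by (intro hllc_dominated g n admissible_scale U ab) auto
  then have "\<tau> *\<^sub>R ((2 * \<alpha>) *\<^sub>R (a *\<^sub>R U) - ?F) + (\<kappa> - 2 * \<alpha> * a * \<tau>) *\<^sub>R U \<in> admissible"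
    using l U(1) admissible_subset_cone
    by (intro admissible_add_cone admissible_scale energy_cone_scale) auto
  then show ?thesis by (simp add: algebra_simps)
qed


section \<open>Sides of a polygon and outward normals\<close>

lemma vertex_eq_iff:
  "simple_polygon K \<Longrightarrow> i < length K \<Longrightarrow> j < length K \<Longrightarrow> K ! i = K ! j \<longleftrightarrow> i = j"
  by (simp add: simple_polygon_def nth_eq_iff_index_eq)

lemma side_endpoints_in_set:
  "i < length K \<Longrightarrow> K ! i \<in> set K" "i < length K \<Longrightarrow> K ! (Suc i mod length K) \<in> set K"
  by (auto intro!: nth_mem mod_less_divisor)

text \<open>The first \<open>m\<close> sides form an arc: two sides meet at most in a common endpoint, so a further side
can be appended.\<close>

lemma polygon_arc:
  assumes K: "simple_polygon K" and m: "0 < m" "m < length K"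
  shows "\<exists>g. arc g \<and> pathstart g = K ! 0 \<and> pathfinish g = K ! m \<and>
    path_image g = (\<Union>i<m. side K i)"
  using m
proof (induction m rule: nat_induct_non_zero)
  case 1
  have "K ! 0 \<noteq> K ! 1" using 1 vertex_eq_iff[OF K, of 0 1] by linarith
  then show ?case
    using 1 by (intro exI[of _ "linepath (K ! 0) (K ! 1)"]) (auto simp: side_def)
next
  case (Suc m)
  then obtain g where g: "arc g" "pathstart g = K ! 0" "pathfinish g = K ! m"
    "path_image g = (\<Union>i<m. side K i)" by auto
  let ?l = "linepath (K ! m) (K ! Suc m)"
  have ne: "K ! m \<noteq> K ! Suc m" using Suc.prems vertex_eq_iff[OF K, of m "Suc m"] by simp
  have l: "path_image ?l = side K m" using Suc.prems by (simp add: side_def)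
  have "side K i \<inter> side K m \<subseteq> {K ! m}" if "i < m" for i
  proof -
    have "side K i \<inter> side K m = {K ! i, K ! Suc i} \<inter> {K ! m, K ! Suc m}"
      using K Suc.prems that unfolding simple_polygon_def by auto
    then show ?thesis using Suc.prems that
      by (auto simp: vertex_eq_iff[OF K])
  qed
  then have "path_image g \<inter> path_image ?l \<subseteq> {pathstart ?l}" using g l by auto
  then have "arc (g +++ ?l)" using g ne by (intro arc_join) auto
  moreover have "path_image (g +++ ?l) = (\<Union>i<Suc m. side K i)"
    using g l by (subst path_image_join) (auto simp: lessThan_Suc)
  ultimately show ?case using g by (intro exI[of _ "g +++ ?l"]) auto
qed

text \<open>The last side closes the arc of all the others to a simple loop. The circle is taken in the plane of
the points themselves, as the Jordan-Brouwer theorem requires.\<close>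

lemma polygon_homeomorphic_circle:
  assumes K: "simple_polygon K" shows "\<Union>(edges K) homeomorphic sphere (0::real^2) 1"
proof -
  define m where "m = length K - 1"
  have m: "0 < m" "m < length K" "Suc m = length K" using K by (auto simp: m_def simple_polygon_def)
  obtain g where g: "arc g" "pathstart g = K ! 0" "pathfinish g = K ! m"
    "path_image g = (\<Union>i<m. side K i)" using polygon_arc[OF K m(1,2)] by auto
  let ?l = "linepath (K ! m) (K ! 0)"
  have ne: "K ! m \<noteq> K ! 0" using m vertex_eq_iff[OF K, of m 0] by linarith
  have l: "path_image ?l = side K m" using m by (simp add: side_def)
  have "side K i \<inter> side K m \<subseteq> {K ! 0, K ! m}" if "i < m" for i
  proof -
    have "side K i \<inter> side K m = {K ! i, K ! Suc i} \<inter> {K ! m, K ! 0}"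
      using K m that unfolding simple_polygon_def by auto
    then show ?thesis by auto
  qed
  then have "path_image g \<inter> path_image ?l \<subseteq> {pathstart g, pathstart ?l}" using g l by auto
  then have sp: "simple_path (g +++ ?l)" using g ne by (intro simple_path_join_loop) auto
  have "path_image (g +++ ?l) = (\<Union>i<Suc m. side K i)"
    using g l by (subst path_image_join) (auto simp: lessThan_Suc)
  also have "\<dots> = \<Union>(edges K)" by (simp add: m edges_def)
  finally have "\<Union>(edges K) homeomorphic sphere (0::complex) 1"
    using homeomorphic_simple_path_image_circle[OF sp, of 1 0] g by simp
  also have "sphere (0::complex) 1 homeomorphic sphere (0::real^2) 1"
    by (intro homeomorphic_spheres_gen) auto
  finally show ?thesis .
qed

lemma edge_side: "E \<in> edges K \<longleftrightarrow> (\<exists>i<length K. E = side K i)"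
  by (auto simp: edges_def)

lemma finite_edges [simp]: "finite (edges K)"
  by (simp add: edges_def)

lemma compact_boundary: "compact (\<Union>(edges K))"
  by (intro compact_Union) (auto simp: edges_def side_def)

lemma region_eq: "region K = - outside (\<Union>(edges K))"
  by (simp add: region_def union_with_inside)

lemma compact_region: "compact (region K)"
  using compact_boundary[of K]
  by (auto simp: compact_eq_bounded_closed region_eq closed_open open_outside)
    (metis bounded_Un bounded_inside union_with_inside)

text \<open>By the Jordan-Brouwer theorem the whole boundary is the frontier of every component of the
complement, and there are at least two components. As the outside is a single component, some
component is inside.\<close>

lemma boundary_accessible:
  assumes K: "simple_polygon K" and x: "x \<in> \<Union>(edges K)" and r: "0 < r"
  shows "ball x r \<inter> outside (\<Union>(edges K)) \<noteq> {}" "ball x r \<inter> inside (\<Union>(edges K)) \<noteq> {}"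
proof -
  let ?S = "\<Union>(edges K)"
  note hom = polygon_homeomorphic_circle[OF K]
  have bd: "bounded ?S" using compact_boundary compact_imp_bounded by blast
  have fr: "T \<in> components (- ?S) \<Longrightarrow> frontier T = ?S" for T
    using Jordan_Brouwer_frontier[OF hom] by simp
  have close: "ball x r \<inter> T \<noteq> {}" if "T \<in> components (- ?S)" for T
  proof -
    have "x \<in> closure T" using fr[OF that] x by (auto simp: frontier_def)
    then show ?thesis using r by (force simp: closure_approachable dist_commute)
  qed
  have out: "outside ?S \<in> components (- ?S)"
    using connected_outside[OF bd] outside_bounded_nonempty[OF bd] by (simp add: outside_in_components)
  then show "ball x r \<inter> outside ?S \<noteq> {}" using close by blast
  have "inside ?S \<noteq> {}"
  proof
    assume "inside ?S = {}"
    then have "- ?S = outside ?S" using inside_Un_outside[of ?S] by simp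
    then show False using Jordan_Brouwer_separation[OF hom] connected_outside[OF bd] by simp
  qed
  then obtain z where z: "z \<in> inside ?S" by auto
  let ?T = "connected_component_set (- ?S) z"
  have zS: "z \<notin> ?S" using z by (auto simp: inside_def)
  then have "?T \<in> components (- ?S)" by (auto simp: components_def)
  moreover have "?T \<subseteq> inside ?S" using z inside_same_component by blast
  ultimately show "ball x r \<inter> inside ?S \<noteq> {}" using close by blast
qed

text \<open>A two-sided version of the condition in \<open>outward_normal\<close>: near \<open>x\<close>, points strictly ahead of the
line through \<open>x\<close> orthogonal to \<open>n\<close> are outside and points strictly behind it are inside.\<close>

definition outer_normal_at :: "cell \<Rightarrow> real^2 \<Rightarrow> point \<Rightarrow> bool" where
  "outer_normal_at K n x \<longleftrightarrow> (\<exists>r>0. \<forall>y\<in>ball x r.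
     (0 < n \<bullet> (y - x) \<longrightarrow> y \<notin> region K) \<and> (n \<bullet> (y - x) < 0 \<longrightarrow> y \<in> region K))"

text \<open>Each open half disc is connected and avoids the boundary, so it lies completely inside or completely
outside. Inside and outside are open and both meet the disc, so both meet the union of the half
discs, and therefore each contains one of them.\<close>

lemma half_disc_dichotomy:
  assumes K: "simple_polygon K" and x: "x \<in> \<Union>(edges K)" and r: "0 < r" and n: "n \<noteq> 0"
    and flat: "\<And>y. y \<in> ball x r \<inter> \<Union>(edges K) \<Longrightarrow> n \<bullet> (y - x) = 0"
  shows "outer_normal_at K n x \<or> outer_normal_at K (- n) x"
proof -
  let ?S = "\<Union>(edges K)"
  let ?H = "\<lambda>m. ball x r \<inter> {y. 0 < m \<bullet> (y - x)}"
  have op: "open (inside ?S)" "open (outside ?S)"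
    using compact_boundary[of K] by (auto simp: open_inside open_outside compact_imp_closed)
  have dich: "?H m \<subseteq> inside ?S \<or> ?H m \<subseteq> outside ?S" if "m = n \<or> m = - n" for m
  proof -
    have "{y. 0 < m \<bullet> (y - x)} = {y. m \<bullet> x < m \<bullet> y}" by (auto simp: inner_diff_right)
    then have "convex (?H m)"
      by (intro convex_Int convex_ball) (simp add: convex_halfspace_gt)
    then have con: "connected (?H m)" by (rule convex_connected)
    have "?H m \<inter> ?S = {}"
      using flat that by (fastforce simp: inner_minus_left)
    then have "?H m \<subseteq> inside ?S \<union> outside ?S" unfolding inside_Un_outside by blast
    then have "inside ?S \<inter> ?H m = {} \<or> outside ?S \<inter> ?H m = {}"
      using connectedD[OF con op] by auto
    then show ?thesis using \<open>?H m \<subseteq> inside ?S \<union> outside ?S\<close> by blast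
  qed
  have meets: "T \<inter> ?H n \<noteq> {} \<or> T \<inter> ?H (- n) \<noteq> {}"
    if T: "open T" "ball x r \<inter> T \<noteq> {}" for T
  proof -
    obtain y where y: "y \<in> ball x r" "y \<in> T" using T by auto
    have "open (ball x r \<inter> T)" using T by auto
    then obtain d where d: "0 < d" "ball y d \<subseteq> ball x r \<inter> T" using y by (meson IntI openE)
    show ?thesis
    proof (cases "n \<bullet> (y - x) = 0")
      case False
      then show ?thesis using y by (auto simp: inner_minus_left linorder_neq_iff)
    next
      case True
      \<comment> \<open>A point of \<open>T\<close> on the dividing line can be pushed off it within \<open>T\<close>.\<close>
      define z where "z = y + (d / (2 * norm n)) *\<^sub>R n"
      have "dist y z < d" using d n by (simp add: z_def dist_norm)
      moreover have "n \<bullet> (z - x) = d / (2 * norm n) * (n \<bullet> n)"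
        using True by (simp add: z_def inner_diff_right inner_add_right)
      then have "0 < n \<bullet> (z - x)" using d n by simp
      moreover have "z \<in> ball x r \<inter> T" using d(2) \<open>dist y z < d\<close> by (auto simp: subset_eq)
      ultimately show ?thesis by blast
    qed
  qed
  have "ball x r \<inter> outside ?S \<noteq> {}" "ball x r \<inter> inside ?S \<noteq> {}"
    using boundary_accessible[OF K x r] by auto
  then have "(?H n \<subseteq> outside ?S \<and> ?H (- n) \<subseteq> inside ?S) \<or> (?H (- n) \<subseteq> outside ?S \<and> ?H n \<subseteq> inside ?S)"
    using dich[of n] dich[of "- n"] meets[OF op(1)] meets[OF op(2)] inside_Int_outside[of ?S] by blast
  then show ?thesis
  proof
    assume h: "?H n \<subseteq> outside ?S \<and> ?H (- n) \<subseteq> inside ?S"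
    have "outer_normal_at K n x" unfolding outer_normal_at_def
      by (rule exI[of _ r]) (use h r in \<open>auto simp: region_def inner_minus_left outside_inside\<close>)
    then show ?thesis ..
  next
    assume h: "?H (- n) \<subseteq> outside ?S \<and> ?H n \<subseteq> inside ?S"
    have "outer_normal_at K (- n) x" unfolding outer_normal_at_def
      by (rule exI[of _ r]) (use h r in \<open>auto simp: region_def inner_minus_left outside_inside\<close>)
    then show ?thesis ..
  qed
qed

lemma outer_normal_at_asym:
  assumes "outer_normal_at K n x" "n \<noteq> 0" shows "\<not> outer_normal_at K (- n) x"
proof
  assume "outer_normal_at K (- n) x"
  with assms obtain r s where rs: "0 < r" "0 < s"
    "\<forall>y\<in>ball x r. 0 < n \<bullet> (y - x) \<longrightarrow> y \<notin> region K"
    "\<forall>y\<in>ball x s. 0 < n \<bullet> (y - x) \<longrightarrow> y \<in> region K"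
    unfolding outer_normal_at_def inner_minus_left by auto
  define y where "y = x + (min r s / (2 * norm n)) *\<^sub>R n"
  have "y \<in> ball x r" "y \<in> ball x s" using rs assms by (auto simp: y_def dist_norm)
  moreover have "0 < n \<bullet> (y - x)" using rs assms by (simp add: y_def)
  ultimately show False using rs by blast
qed

text \<open>Moving along the line orthogonal to \<open>n\<close> does not change the two half planes. So the set of points
of an edge at which \<open>n\<close> points outward is open in the edge.\<close>

lemma outer_normal_at_transfer:
  assumes "outer_normal_at K n x"
  shows "\<exists>e>0. \<forall>y. dist x y < e \<longrightarrow> n \<bullet> (y - x) = 0 \<longrightarrow> outer_normal_at K n y"
proof -
  obtain r where r: "0 < r" "\<forall>y\<in>ball x r.
     (0 < n \<bullet> (y - x) \<longrightarrow> y \<notin> region K) \<and> (n \<bullet> (y - x) < 0 \<longrightarrow> y \<in> region K)"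
    using assms unfolding outer_normal_at_def by auto
  show ?thesis
  proof (rule exI[of _ r], intro conjI allI impI r)
    fix y assume y: "dist x y < r" "n \<bullet> (y - x) = 0"
    show "outer_normal_at K n y" unfolding outer_normal_at_def
    proof (rule exI[of _ "r - dist x y"], intro conjI ballI)
      show "0 < r - dist x y" using y by simp
      fix z assume "z \<in> ball y (r - dist x y)"
      then have "z \<in> ball x r" using dist_triangle[of x z y] by auto
      moreover have "n \<bullet> (z - y) = n \<bullet> (z - x)" using y by (simp add: inner_diff_right)
      ultimately show "0 < n \<bullet> (z - y) \<longrightarrow> z \<notin> region K" "n \<bullet> (z - y) < 0 \<longrightarrow> z \<in> region K"
        using r by auto
    qed
  qed
qed

lemma inner_real2: "(x::real^2) \<bullet> y = x $ 1 * y $ 1 + x $ 2 * y $ 2"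
  by (simp add: inner_vec_def UNIV_2)

text \<open>Two unit vectors orthogonal to \<open>d\<close> are parallel in the plane, so the square of their inner product
is 1.\<close>

lemma unit_normal_unique:
  fixes m n d :: "real^2"
  assumes "norm m = 1" "norm n = 1" "m \<bullet> d = 0" "n \<bullet> d = 0" "d \<noteq> 0"
  shows "m = n \<or> m = - n"
proof -
  have d: "d $ 1 \<noteq> 0 \<or> d $ 2 \<noteq> 0" using assms(5) by (auto simp: vec_eq_iff forall_2)
  \<comment> \<open>Two vectors orthogonal to the same nonzero vector have determinant 0.\<close>
  have eq: "m $ 1 * n $ 2 = m $ 2 * n $ 1"
    using assms(3,4) d unfolding inner_real2 by algebra
  have sq: "m $ 1 * m $ 1 + m $ 2 * m $ 2 = 1" "n $ 1 * n $ 1 + n $ 2 * n $ 2 = 1"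
    using assms(1,2) by (metis inner_real2 norm_eq_1)+
  have "(m \<bullet> n)\<^sup>2 = 1" using eq sq unfolding inner_real2 by algebra
  then consider "m \<bullet> n = 1" | "m \<bullet> n = -1" by (auto simp: power2_eq_1_iff)
  then show ?thesis
  proof cases
    case 1
    have "(norm (m - n))\<^sup>2 = 0" using 1 assms(1,2)
      by (simp add: power2_norm_eq_inner inner_diff inner_commute norm_eq_1)
    then show ?thesis by simp
  next
    case 2
    have "(norm (m + n))\<^sup>2 = 0" using 2 assms(1,2)
      by (simp add: power2_norm_eq_inner inner_add inner_commute norm_eq_1)
    then show ?thesis by (simp add: add_eq_0_iff)
  qed
qed

lemma unit_normal_exists:
  fixes d :: "real^2" assumes "d \<noteq> 0" shows "\<exists>n. norm n = 1 \<and> n \<bullet> d = 0"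
proof -
  let ?p = "vector [- (d $ 2), d $ 1] :: real^2"
  have "?p \<bullet> d = 0" by (simp add: inner_real2)
  moreover have "?p \<noteq> 0" using assms by (auto simp: vec_eq_iff forall_2)
  ultimately show ?thesis by (intro exI[of _ "(1 / norm ?p) *\<^sub>R ?p"]) simp
qed

lemma side_endpoints_distinct:
  assumes "simple_polygon K" "i < length K" shows "K ! i \<noteq> K ! (Suc i mod length K)"
proof -
  have "Suc i mod length K \<noteq> i" "Suc i mod length K < length K"
    using assms by (auto simp: simple_polygon_def mod_Suc)
  then show ?thesis using assms by (auto simp: simple_polygon_def nth_eq_iff_index_eq)
qed

lemma edge_endpoints:
  assumes K: "simple_polygon K" and E: "E \<in> edges K" "E = closed_segment a b"
  shows "a \<noteq> b" "a \<in> set K" "b \<in> set K"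
proof -
  obtain i where i: "i < length K" "E = side K i" using E edge_side by auto
  then have "closed_segment a b = closed_segment (K ! i) (K ! (Suc i mod length K))"
    using E by (simp add: side_def)
  then have "{a, b} = {K ! i, K ! (Suc i mod length K)}" by (simp only: closed_segment_eq)
  moreover have "K ! i \<in> set K" "K ! (Suc i mod length K) \<in> set K"
    using i side_endpoints_in_set by auto
  ultimately show "a \<noteq> b" "a \<in> set K" "b \<in> set K"
    using side_endpoints_distinct[OF K i(1)] by (auto simp: doubleton_eq_iff)
qed

text \<open>This makes the crossings of a line with different edges distinct if the line avoids the vertices.\<close>

lemma open_edge_disjoint:
  assumes K: "simple_polygon K" and E: "E \<in> edges K" "E = closed_segment a b" "x \<in> open_segment a b"
    and E': "E' \<in> edges K" "E' \<noteq> E"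
  shows "x \<notin> E'"
proof
  assume "x \<in> E'"
  obtain i where i: "i < length K" "E = side K i" using E(1) by (auto simp: edges_def)
  obtain j where j: "j < length K" "E' = side K j" using E'(1) edge_side by blast
  note ij = i j
  then have "i \<noteq> j" using E'(2) ij by metis
  then have "E \<inter> E' \<subseteq> {K ! i, K ! (Suc i mod length K)}"
    using K ij unfolding simple_polygon_def by blast
  moreover have "closed_segment a b = closed_segment (K ! i) (K ! (Suc i mod length K))"
    using E ij by (simp add: side_def)
  then have "{a, b} = {K ! i, K ! (Suc i mod length K)}" by (simp only: closed_segment_eq)
  ultimately show False using \<open>x \<in> E'\<close> E by (auto simp: open_segment_def)
qed

lemma orthogonal_to_segment:
  fixes n :: "'a::real_inner"
  assumes "n \<bullet> (b - a) = 0" "x \<in> closed_segment a b" "y \<in> closed_segment a b"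
  shows "n \<bullet> (y - x) = 0"
proof -
  obtain s t where "x = (1 - s) *\<^sub>R a + s *\<^sub>R b" "y = (1 - t) *\<^sub>R a + t *\<^sub>R b"
    using assms(2,3) by (auto simp: in_segment)
  then have "y - x = (t - s) *\<^sub>R (b - a)" by (simp only:) (simp add: algebra_simps)
  then show ?thesis using assms(1) by simp
qed

text \<open>The relative interior of an edge is the disjoint union of the sets where \<open>n\<close> and \<open>-n\<close> point outward.
Both are open in it, and it is connected.\<close>

lemma edge_outer_normal:
  assumes K: "simple_polygon K" and E: "E \<in> edges K" "E = closed_segment a b"
    and n: "n \<noteq> 0" "n \<bullet> (b - a) = 0"
  shows "(\<forall>x\<in>open_segment a b. outer_normal_at K n x) \<or>
         (\<forall>x\<in>open_segment a b. outer_normal_at K (- n) x)"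
proof -
  let ?O = "open_segment a b"
  have one: "outer_normal_at K n x \<or> outer_normal_at K (- n) x" if x: "x \<in> ?O" for x
  proof -
    let ?F = "\<Union>(edges K - {E})"
    have "closed ?F" by (intro closed_Union) (auto simp: edges_def side_def)
    moreover have "x \<notin> ?F" using open_edge_disjoint[OF K E x] by auto
    ultimately obtain r where r: "0 < r" "ball x r \<subseteq> - ?F"
      by (metis ComplI open_Compl openE)
    have xE: "x \<in> closed_segment a b" using x by (simp add: open_segment_def)
    show ?thesis
    proof (rule half_disc_dichotomy[OF K _ r(1) n(1)])
      show "x \<in> \<Union>(edges K)" using xE E by auto
      fix y assume "y \<in> ball x r \<inter> \<Union>(edges K)"
      then have "y \<in> closed_segment a b" using r E by auto
      then show "n \<bullet> (y - x) = 0" using orthogonal_to_segment[OF n(2) xE] by auto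
    qed
  qed
  have op: "openin (top_of_set ?O) {x \<in> ?O. outer_normal_at K m x}" if m: "m = n \<or> m = - n" for m
    unfolding openin_euclidean_subtopology_iff
  proof (intro conjI ballI)
    fix x assume "x \<in> {x \<in> ?O. outer_normal_at K m x}"
    then have x: "x \<in> ?O" "outer_normal_at K m x" by auto
    obtain e where e: "0 < e" "\<forall>y. dist x y < e \<longrightarrow> m \<bullet> (y - x) = 0 \<longrightarrow> outer_normal_at K m y"
      using outer_normal_at_transfer[OF x(2)] by auto
    have "m \<bullet> (y - x) = 0" if "y \<in> ?O" for y
      using orthogonal_to_segment[OF n(2), of x y] that x m by (auto simp: open_segment_def inner_minus_left)
    then show "\<exists>e>0. \<forall>x'\<in>?O. dist x' x < e \<longrightarrow> x' \<in> {x \<in> ?O. outer_normal_at K m x}"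
      using e by (auto simp: dist_commute)
  qed auto
  have disj: "{x \<in> ?O. outer_normal_at K n x} \<inter> {x \<in> ?O. outer_normal_at K (- n) x} = {}"
    using outer_normal_at_asym n(1) by blast
  have cov: "?O \<subseteq> {x \<in> ?O. outer_normal_at K n x} \<union> {x \<in> ?O. outer_normal_at K (- n) x}"
    using one by auto
  have "connected ?O" by (intro convex_connected convex_open_segment)
  then have "{x \<in> ?O. outer_normal_at K n x} = {} \<or> {x \<in> ?O. outer_normal_at K (- n) x} = {}"
    using op[of n] op[of "- n"] disj cov unfolding connected_openin by blast
  then show ?thesis using cov by auto
qed

text \<open>There are two unit normals and one of them points outward along the whole edge; the other one fails
already at the midpoint. So the definite description in \<open>outward_normal\<close> is well defined.\<close>

lemma outward_normal:
  assumes K: "simple_polygon K" and E: "E \<in> edges K" "E = closed_segment a b"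
  shows "norm (outward_normal K E) = 1" "outward_normal K E \<bullet> (b - a) = 0"
    "x \<in> open_segment a b \<Longrightarrow> outer_normal_at K (outward_normal K E) x"
proof -
  have ab: "a \<noteq> b" using edge_endpoints[OF K E] by simp
  then have ri: "rel_interior E = open_segment a b" by (simp add: E rel_interior_closed_segment)
  obtain n0 where n0: "norm n0 = 1" "n0 \<bullet> (b - a) = 0" using unit_normal_exists[of "b - a"] ab by auto
  have "n0 \<noteq> 0" using n0 by auto
  then obtain n where n: "norm n = 1" "n \<bullet> (b - a) = 0" "\<And>x. x \<in> open_segment a b \<Longrightarrow> outer_normal_at K n x"
    using edge_outer_normal[OF K E _ n0(2)] n0 by (metis inner_minus_left neg_equal_0_iff_equal norm_minus_cancel)
  have step: "\<exists>\<epsilon>>0. \<forall>t\<in>{0<..<\<epsilon>}. x + t *\<^sub>R n \<notin> region K \<and> x - t *\<^sub>R n \<in> region K"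
    if x: "x \<in> open_segment a b" for x
  proof -
    obtain r where r: "0 < r" "\<forall>y\<in>ball x r.
     (0 < n \<bullet> (y - x) \<longrightarrow> y \<notin> region K) \<and> (n \<bullet> (y - x) < 0 \<longrightarrow> y \<in> region K)"
      using n(3)[OF x] unfolding outer_normal_at_def by auto
    have nn: "n \<bullet> n = 1" using n(1) by (simp add: norm_eq_1)
    have "x + t *\<^sub>R n \<notin> region K" "x - t *\<^sub>R n \<in> region K" if "t \<in> {0<..<r}" for t
      using r(2)[rule_format, of "x + t *\<^sub>R n"] r(2)[rule_format, of "x - t *\<^sub>R n"] that n(1) nn
      by (auto simp: dist_norm)
    then show ?thesis using r(1) nn by auto
  qed
  have "outward_normal K E = n" unfolding outward_normal_def ri
  proof (rule the_equality)
    show "norm n = 1 \<and> (\<forall>x\<in>E. \<forall>y\<in>E. n \<bullet> (x - y) = 0) \<and>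
      (\<forall>x\<in>open_segment a b. \<exists>\<epsilon>>0. \<forall>t\<in>{0<..<\<epsilon>}. x + t *\<^sub>R n \<notin> region K)"
      using n orthogonal_to_segment[OF n(2)] step unfolding E(2) by meson
    fix m assume m: "norm m = 1 \<and> (\<forall>x\<in>E. \<forall>y\<in>E. m \<bullet> (x - y) = 0) \<and>
      (\<forall>x\<in>open_segment a b. \<exists>\<epsilon>>0. \<forall>t\<in>{0<..<\<epsilon>}. x + t *\<^sub>R m \<notin> region K)"
    then have "m \<bullet> (b - a) = 0" unfolding E(2) by auto
    then consider "m = n" | "m = - n" using unit_normal_unique[of m n "b - a"] m n ab by auto
    then show "m = n"
    proof cases
      case 2
      have x: "midpoint a b \<in> open_segment a b" using ab by simp
      obtain e1 where e1: "0 < e1" "\<forall>t\<in>{0<..<e1}. midpoint a b - t *\<^sub>R n \<in> region K"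
        using step[OF x] by meson
      obtain e2 where e2: "0 < e2" "\<forall>t\<in>{0<..<e2}. midpoint a b + t *\<^sub>R m \<notin> region K"
        using m x by meson
      have "min e1 e2 / 2 \<in> {0<..<e1}" "min e1 e2 / 2 \<in> {0<..<e2}" using e1 e2 by auto
      then show ?thesis using e1(2) e2(2) 2
        by (metis scaleR_minus_right add_uminus_conv_diff)
    qed simp
  qed
  then show "norm (outward_normal K E) = 1" "outward_normal K E \<bullet> (b - a) = 0"
    "x \<in> open_segment a b \<Longrightarrow> outer_normal_at K (outward_normal K E) x" using n by auto
qed


section \<open>Integration along lines\<close>

text \<open>The parameters are the components in the directions \<open>i\<close> and \<open>j\<close>; keeping both indices variable
treats the horizontal and the vertical slices together.\<close>

definition plane_point :: "2 \<Rightarrow> 2 \<Rightarrow> real \<Rightarrow> real \<Rightarrow> real^2" where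
  "plane_point i j t s = t *\<^sub>R axis i 1 + s *\<^sub>R axis j 1"

lemma plane_point_nth:
  assumes "i \<noteq> j" shows "plane_point i j t s $ i = t" "plane_point i j t s $ j = s"
  using assms by (simp_all add: plane_point_def axis_def)

lemma index2_cases: "(i::2) \<noteq> j \<Longrightarrow> k = i \<or> k = j"
  using exhaust_2[of i] exhaust_2[of j] exhaust_2[of k] by auto

lemma all_index2: "(i::2) \<noteq> j \<Longrightarrow> (\<forall>k. Q k) \<longleftrightarrow> Q i \<and> Q j"
  by (metis index2_cases)

lemma plane_point_eqI:
  assumes "i \<noteq> j" "x $ i = t" "x $ j = s" shows "plane_point i j t s = x"
  unfolding vec_eq_iff
proof
  fix k show "plane_point i j t s $ k = x $ k"
    using index2_cases[OF assms(1), of k] plane_point_nth[OF assms(1), of t s] assms(2,3) by auto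
qed

lemma UNIV_index2: "(i::2) \<noteq> j \<Longrightarrow> UNIV = {i, j}"
  using index2_cases by auto

lemma continuous_plane_point [continuous_intros]:
  "continuous_on A f \<Longrightarrow> continuous_on A g \<Longrightarrow> continuous_on A (\<lambda>x. plane_point i j (f x) (g x))"
  unfolding plane_point_def by (intro continuous_intros)

lemma lborel_plane_point:
  assumes ij: "i \<noteq> j"
  shows "lborel = distr (lborel \<Otimes>\<^sub>M lborel) borel (\<lambda>(s, t). plane_point i j t s)"
proof (rule lborel_eqI)
  fix l u :: "real^2" assume le: "\<And>b. b \<in> Basis \<Longrightarrow> l \<bullet> b \<le> u \<bullet> b"
  have lu: "l $ k \<le> u $ k" for k
    using le[of "axis k 1"] by (simp add: axis_in_Basis_iff inner_axis)
  have meas: "(\<lambda>(s, t). plane_point i j t s) \<in> lborel \<Otimes>\<^sub>M lborel \<rightarrow>\<^sub>M borel"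
    unfolding lborel_prod case_prod_unfold measurable_lborel2
    by (intro borel_measurable_continuous_onI continuous_intros)
  have pre: "(\<lambda>(s, t). plane_point i j t s) -` box l u \<inter> space (lborel \<Otimes>\<^sub>M lborel)
      = {l $ j<..<u $ j} \<times> {l $ i<..<u $ i}"
    by (auto simp: mem_box_cart all_index2[OF ij] plane_point_nth[OF ij] space_pair_measure)
  have B: "Basis = {axis i 1, axis j (1::real)}"
    unfolding Basis_vec_def using UNIV_index2[OF ij] by auto
  have "axis i (1::real) \<noteq> axis j 1" using ij by (simp add: axis_eq_axis)
  then have pr: "(\<Prod>b\<in>Basis. (u - l) \<bullet> b) = (u $ i - l $ i) * (u $ j - l $ j)"
    unfolding B by (simp add: inner_axis)
  have "emeasure (distr (lborel \<Otimes>\<^sub>M lborel) borel (\<lambda>(s, t). plane_point i j t s)) (box l u)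
      = emeasure (lborel \<Otimes>\<^sub>M lborel) ({l $ j<..<u $ j} \<times> {l $ i<..<u $ i})"
    using meas by (subst emeasure_distr) (auto simp: pre)
  also have "\<dots> = emeasure lborel {l $ j<..<u $ j} * emeasure lborel {l $ i<..<u $ i}"
    by (rule lborel.emeasure_pair_measure_Times) auto
  also have "\<dots> = ennreal ((u $ i - l $ i) * (u $ j - l $ j))"
    using lu by (simp add: ennreal_mult' mult.commute)
  finally show "emeasure (distr (lborel \<Otimes>\<^sub>M lborel) borel (\<lambda>(s, t). plane_point i j t s)) (box l u)
      = ennreal (\<Prod>b\<in>Basis. (u - l) \<bullet> b)" unfolding pr .
qed simp

lemma integral_slices:
  fixes g :: "real^2 \<Rightarrow> real"
  assumes ij: "i \<noteq> j" and R: "compact R" and g: "continuous_on UNIV g"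
  shows "integral R g =
    (\<integral>s. (\<integral>t. indicator R (plane_point i j t s) * g (plane_point i j t s) \<partial>lborel) \<partial>lborel)"
proof -
  let ?F = "\<lambda>x. indicator R x * g x"
  let ?P = "\<lambda>(s, t). plane_point i j t s"
  have int: "integrable lborel ?F"
    using borel_integrable_compact[OF R continuous_on_subset[OF g]] by simp
  have meas: "?P \<in> lborel \<Otimes>\<^sub>M lborel \<rightarrow>\<^sub>M borel"
    unfolding lborel_prod case_prod_unfold measurable_lborel2
    by (intro borel_measurable_continuous_onI continuous_intros)
  have [measurable]: "R \<in> sets borel" "g \<in> borel_measurable borel"
    using R g by (auto intro: borel_compact borel_measurable_continuous_onI)
  have mF: "?F \<in> borel_measurable borel" by measurable
  have "integral R g = (LINT x:R|lborel. g x)"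
    using int by (intro set_borel_integral_eq_integral(2)[symmetric]) (simp add: set_integrable_def)
  also have "\<dots> = integral\<^sup>L lborel ?F" by (simp add: set_lebesgue_integral_def)
  also have "\<dots> = integral\<^sup>L (distr (lborel \<Otimes>\<^sub>M lborel) borel ?P) ?F"
    by (subst lborel_plane_point[OF ij]) rule
  also have "\<dots> = integral\<^sup>L (lborel \<Otimes>\<^sub>M lborel) (\<lambda>x. ?F (?P x))"
    by (rule integral_distr[OF meas mF])
  also have "\<dots> = (\<integral>s. (\<integral>t. ?F (?P (s, t)) \<partial>lborel) \<partial>lborel)"
  proof (rule lborel_pair.integral_fst'[symmetric])
    have "integrable (distr (lborel \<Otimes>\<^sub>M lborel) borel ?P) ?F"
      using int by (subst (asm) lborel_plane_point[OF ij])
    then show "integrable (lborel \<Otimes>\<^sub>M lborel) (\<lambda>x. ?F (?P x))"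
      by (subst (asm) integrable_distr_eq[OF meas mF])
  qed
  finally show ?thesis by simp
qed

lemma eventually_nhds_split:
  fixes c :: real
  assumes "eventually P (at_left c)" "eventually P (at_right c)" "P c"
  shows "eventually P (nhds c)"
  using assms by (simp add: eventually_nhds_conv_at eventually_at_split)

text \<open>If a bounded set \<open>S\<close> of reals changes only at the points \<open>c k\<close>, then \<open>h\<close> times the indicator of
\<open>S\<close>, plus steps that compensate the jumps, is a continuous antiderivative of \<open>h'\<close> times this
indicator. It vanishes at \<open>a\<close>, and at \<open>b\<close> it is the sum of all the steps. The sign \<open>\<sigma> k\<close> is 1 where \<open>S\<close>
ends and -1 where it begins.\<close>

lemma crossing_formula:
  fixes S :: "real set" and c \<sigma> :: "'k \<Rightarrow> real" and h h' :: "real \<Rightarrow> real"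
  assumes fin: "finite I" and inj: "inj_on c I" and cS: "\<And>k. k \<in> I \<Longrightarrow> c k \<in> S"
    and S: "S \<subseteq> {a<..<b}" and ab: "a \<le> b" and h: "\<And>t. (h has_real_derivative h' t) (at t)"
    and off: "\<And>t. t \<notin> c ` I \<Longrightarrow>
      eventually (\<lambda>x. x \<in> S) (nhds t) \<or> eventually (\<lambda>x. x \<notin> S) (nhds t)"
    and cross: "\<And>k. k \<in> I \<Longrightarrow>
      \<sigma> k = 1 \<and> eventually (\<lambda>x. x \<in> S) (at_left (c k)) \<and> eventually (\<lambda>x. x \<notin> S) (at_right (c k)) \<or>
      \<sigma> k = -1 \<and> eventually (\<lambda>x. x \<notin> S) (at_left (c k)) \<and> eventually (\<lambda>x. x \<in> S) (at_right (c k))"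
  shows "((\<lambda>t. indicator S t * h' t) has_integral (\<Sum>k\<in>I. \<sigma> k * h (c k))) {a..b}"
proof -
  \<comment> \<open>The value of a step at the crossing itself matters: as the crossing belongs to \<open>S\<close>, a step that
    ends a component starts strictly after it, and one that begins a component starts at it.\<close>
  define step where "step k t = (if \<sigma> k = 1 then if c k < t then h (c k) else 0
      else if c k \<le> t then - h (c k) else 0)" for k t
  define \<Phi> where "\<Phi> t = indicator S t * h t + (\<Sum>k\<in>I. step k t)" for t
  have sg: "\<sigma> k = 1 \<or> \<sigma> k = -1" if "k \<in> I" for k using cross[OF that] by auto
  have step_const: "eventually (\<lambda>t. step k t = step k t0) (nhds t0)" if "c k \<noteq> t0" for k t0
  proof (cases "c k < t0")
    case True
    then have "eventually (\<lambda>t. t \<in> {c k<..}) (nhds t0)" by (intro eventually_nhds_in_open) auto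
    then show ?thesis by eventually_elim (use True in \<open>auto simp: step_def\<close>)
  next
    case False
    then have "eventually (\<lambda>t. t \<in> {..<c k}) (nhds t0)"
      using that by (intro eventually_nhds_in_open) auto
    then show ?thesis by eventually_elim (use False that in \<open>auto simp: step_def\<close>)
  qed
  have sum_const: "eventually (\<lambda>t. (\<Sum>k\<in>J. step k t) = (\<Sum>k\<in>J. step k t0)) (nhds t0)"
    if J: "J \<subseteq> I" "t0 \<notin> c ` J" for J t0
  proof -
    have "eventually (\<lambda>t. \<forall>k\<in>J. step k t = step k t0) (nhds t0)"
      using J fin by (intro eventually_ball_finite) (auto intro: finite_subset step_const)
    then show ?thesis by eventually_elim (auto intro: sum.cong)
  qed
  have conth: "isCont h t" for t using h DERIV_isCont by blast
  have off_form: "\<exists>u k. (u = 0 \<or> u = 1) \<and> indicator S t0 = u \<and> eventually (\<lambda>t. \<Phi> t = u * h t + k) (nhds t0)"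
    if t0: "t0 \<notin> c ` I" for t0
  proof -
    have ev: "eventually (\<lambda>t. (indicator S t :: real) = indicator S t0) (nhds t0)"
      using off[OF t0]
    proof
      assume e: "eventually (\<lambda>x. x \<in> S) (nhds t0)"
      then have "t0 \<in> S" using eventually_nhds_x_imp_x by blast
      then show ?thesis using e by (auto elim: eventually_mono)
    next
      assume e: "eventually (\<lambda>x. x \<notin> S) (nhds t0)"
      then have "t0 \<notin> S" using eventually_nhds_x_imp_x by fastforce
      then show ?thesis using e by (auto elim: eventually_mono)
    qed
    have "eventually (\<lambda>t. \<Phi> t = indicator S t0 * h t + (\<Sum>k\<in>I. step k t0)) (nhds t0)"
      using ev sum_const[OF order_refl t0] by eventually_elim (simp add: \<Phi>_def)
    then show ?thesis by (intro exI conjI) (auto simp: indicator_def)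
  qed
  have cont: "isCont \<Phi> t0" for t0
  proof (cases "t0 \<in> c ` I")
    case False
    obtain u k where "eventually (\<lambda>t. \<Phi> t = u * h t + k) (nhds t0)" using off_form[OF False] by auto
    then show ?thesis using isCont_cong[of \<Phi> "\<lambda>t. u * h t + k" t0] conth by auto
  next
    case True
    then obtain k where k: "k \<in> I" "t0 = c k" by auto
    define q where "q = (\<Sum>k\<in>I - {k}. step k t0)"
    have split: "\<Phi> t = (indicator S t * h t + step k t) + (\<Sum>k\<in>I - {k}. step k t)" for t
      unfolding \<Phi>_def using fin k(1) by (simp add: sum.remove)
    have "t0 \<notin> c ` (I - {k})" using inj k by (auto simp: inj_on_def)
    then have rest: "eventually (\<lambda>t. (\<Sum>k\<in>I - {k}. step k t) = q) (nhds t0)"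
      unfolding q_def by (intro sum_const) auto
    have tS: "t0 \<in> S" using cS k by simp
    have lt: "eventually (\<lambda>t. t < t0) (at_left t0)" and gt: "eventually (\<lambda>t. t0 < t) (at_right t0)"
      by (simp_all add: eventually_at_filter)
    consider (down) "\<sigma> k = 1" "eventually (\<lambda>x. x \<in> S) (at_left t0)" "eventually (\<lambda>x. x \<notin> S) (at_right t0)"
      | (up) "\<sigma> k = -1" "eventually (\<lambda>x. x \<notin> S) (at_left t0)" "eventually (\<lambda>x. x \<in> S) (at_right t0)"
      using cross[OF k(1)] k(2) by auto
    then show ?thesis
    proof cases
      case down
      \<comment> \<open>Beyond the crossing, the step freezes the value of \<open>h\<close>.\<close>
      have "eventually (\<lambda>t. indicator S t * h t + step k t = h (min t t0)) (nhds t0)"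
      proof (rule eventually_nhds_split)
        show "eventually (\<lambda>t. indicator S t * h t + step k t = h (min t t0)) (at_left t0)"
          using down(2) lt
          by eventually_elim (auto simp: step_def down(1) k(2))
        show "eventually (\<lambda>t. indicator S t * h t + step k t = h (min t t0)) (at_right t0)"
          using down(3) gt
          by eventually_elim (auto simp: step_def down(1) k(2))
      qed (use tS in \<open>simp add: step_def down(1) k(2)\<close>)
      then have e: "eventually (\<lambda>t. \<Phi> t = h (min t t0) + q) (nhds t0)"
        using rest by eventually_elim (simp add: split)
      have "isCont (\<lambda>t. h (min t t0)) t0"
        by (rule isCont_o2[where g = h]) (intro continuous_intros conth)+
      then have "isCont (\<lambda>t. h (min t t0) + q) t0"
        by (intro continuous_intros)
      then show ?thesis by (simp only: isCont_cong[OF e])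
    next
      case up
      \<comment> \<open>The step subtracts the value of \<open>h\<close> with which the component begins.\<close>
      have "eventually (\<lambda>t. indicator S t * h t + step k t = h (max t t0) - h t0) (nhds t0)"
      proof (rule eventually_nhds_split)
        show "eventually (\<lambda>t. indicator S t * h t + step k t = h (max t t0) - h t0) (at_left t0)"
          using up(2) lt
          by eventually_elim (auto simp: step_def up(1) k(2))
        show "eventually (\<lambda>t. indicator S t * h t + step k t = h (max t t0) - h t0) (at_right t0)"
          using up(3) gt
          by eventually_elim (auto simp: step_def up(1) k(2))
      qed (use tS in \<open>simp add: step_def up(1) k(2)\<close>)
      then have e: "eventually (\<lambda>t. \<Phi> t = h (max t t0) - h t0 + q) (nhds t0)"
        using rest by eventually_elim (simp add: split)
      have "isCont (\<lambda>t. h (max t t0)) t0"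
        by (rule isCont_o2[where g = h]) (intro continuous_intros conth)+
      then have "isCont (\<lambda>t. h (max t t0) - h t0 + q) t0"
        by (intro continuous_intros)
      then show ?thesis by (simp only: isCont_cong[OF e])
    qed
  qed
  have der: "(\<Phi> has_vector_derivative indicator S t0 * h' t0) (at t0)" if t0: "t0 \<notin> c ` I" for t0
  proof -
    obtain u k where uk: "indicator S t0 = u" "eventually (\<lambda>t. \<Phi> t = u * h t + k) (nhds t0)"
      using off_form[OF t0] by auto
    have "((\<lambda>t. u * h t + k) has_real_derivative u * h' t0) (at t0)"
      by (auto intro!: derivative_eq_intros h)
    then have "(\<Phi> has_real_derivative u * h' t0) (at t0)"
      using DERIV_cong_ev[OF refl uk(2) refl] by simp
    then show ?thesis using uk(1) by (simp add: has_real_derivative_iff_has_vector_derivative)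
  qed
  have "((\<lambda>t. indicator S t * h' t) has_integral (\<Phi> b - \<Phi> a)) {a..b}"
    using fin ab der cont
    by (intro fundamental_theorem_of_calculus_interior_strong[of "c ` I"])
      (auto intro: continuous_at_imp_continuous_on)
  moreover have "\<Phi> a = 0" "\<Phi> b = (\<Sum>k\<in>I. \<sigma> k * h (c k))"
  proof -
    have cab: "a < c k" "c k < b" if "k \<in> I" for k using cS[OF that] S by auto
    have "a \<notin> S" "b \<notin> S" using S by auto
    moreover have "(\<Sum>k\<in>I. step k a) = 0"
      using cab(1) by (intro sum.neutral) (fastforce simp: step_def)
    moreover have "(\<Sum>k\<in>I. step k b) = (\<Sum>k\<in>I. \<sigma> k * h (c k))"
    proof (rule sum.cong[OF refl])
      fix k assume "k \<in> I"
      then show "step k b = \<sigma> k * h (c k)" using cab(2)[of k] sg[of k] by (auto simp: step_def)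
    qed
    ultimately show "\<Phi> a = 0" "\<Phi> b = (\<Sum>k\<in>I. \<sigma> k * h (c k))" by (simp_all add: \<Phi>_def)
  qed
  ultimately show ?thesis by simp
qed


section \<open>Divergence theorem for polygons\<close>

lemma normal_component_nonzero:
  fixes n d :: "real^2"
  assumes "i \<noteq> j" "n \<noteq> 0" "n \<bullet> d = 0" "d $ j \<noteq> 0" shows "n $ i \<noteq> 0"
proof
  assume "n $ i = 0"
  moreover have "n \<bullet> d = n $ i * d $ i + n $ j * d $ j"
    unfolding inner_vec_def UNIV_index2[OF assms(1)] using assms(1) by simp
  ultimately have "n $ j = 0" using assms by simp
  then have "n $ k = 0" for k using \<open>n $ i = 0\<close> index2_cases[OF assms(1), of k] by auto
  then have "n = 0" by (simp add: vec_eq_iff)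
  then show False using assms by simp
qed

text \<open>The cosine of the angle between the normal and the axis \<open>i\<close> is, up to sign, the sine of the angle
between the edge and this axis. It converts lengths on the transversal axis into lengths on the edge.\<close>

lemma normal_times_length:
  fixes n d :: "real^2"
  assumes ij: "i \<noteq> j" and n: "norm n = 1" "n \<bullet> d = 0"
  shows "sgn (n $ i) * \<bar>d $ j\<bar> = norm d * n $ i"
proof -
  have i2: "x \<bullet> y = x $ i * y $ i + x $ j * y $ j" for x y :: "real^2"
    unfolding inner_vec_def UNIV_index2[OF ij] using ij by simp
  have 1: "n $ i * n $ i + n $ j * n $ j = 1" using n(1) unfolding norm_eq_1 i2 .
  have 2: "n $ i * d $ i + n $ j * d $ j = 0" using n(2) unfolding i2 .
  have "(norm d)\<^sup>2 = d $ i * d $ i + d $ j * d $ j" by (simp add: power2_norm_eq_inner i2)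
  then have "(norm d * \<bar>n $ i\<bar>)\<^sup>2 = \<bar>d $ j\<bar>\<^sup>2" using 1 2
    unfolding power_mult_distrib power2_abs by algebra
  then have "norm d * \<bar>n $ i\<bar> = \<bar>d $ j\<bar>" by (metis abs_ge_zero norm_ge_zero mult_nonneg_nonneg power2_eq_iff_nonneg)
  then have "sgn (n $ i) * \<bar>d $ j\<bar> = norm d * (sgn (n $ i) * \<bar>n $ i\<bar>)" by simp
  then show ?thesis by (simp add: sgn_mult_abs)
qed

text \<open>The component \<open>i\<close> of the point at which the line through \<open>a\<close> and \<open>b\<close> has component \<open>j\<close> equal to
\<open>s\<close>.\<close>

definition crossing :: "2 \<Rightarrow> 2 \<Rightarrow> point \<Rightarrow> point \<Rightarrow> real \<Rightarrow> real" where
  "crossing i j a b s = a $ i + (s - a $ j) / (b $ j - a $ j) * (b $ i - a $ i)"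

lemma crossing_linepath:
  assumes ij: "i \<noteq> j" and "a $ j \<noteq> b $ j"
  shows "plane_point i j (crossing i j a b s) s = linepath a b ((s - a $ j) / (b $ j - a $ j))"
proof -
  define v where "v = (s - a $ j) / (b $ j - a $ j)"
  have "v * (b $ j - a $ j) = s - a $ j" using assms by (simp add: v_def)
  then have "linepath a b v $ j = s" by (simp add: linepath_def algebra_simps)
  moreover have "linepath a b v $ i = crossing i j a b s"
    unfolding crossing_def by (simp add: linepath_def algebra_simps flip: v_def)
  ultimately show ?thesis using ij by (intro plane_point_eqI) (simp_all flip: v_def)
qed

lemma crossing_in_open_segment:
  assumes ij: "i \<noteq> j" and s: "s \<in> open_segment (a $ j) (b $ j)"
  shows "plane_point i j (crossing i j a b s) s \<in> open_segment a b"
proof -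
  have ne: "a $ j \<noteq> b $ j" using s by auto
  have "0 < (s - a $ j) / (b $ j - a $ j)" "(s - a $ j) / (b $ j - a $ j) < 1"
    using s by (auto simp: open_segment_eq_real_ivl field_simps split: if_splits)
  then show ?thesis unfolding crossing_linepath[OF ij ne] in_segment linepath_def using ne by blast
qed

lemma in_segment_imp_crossing:
  assumes ij: "i \<noteq> j" and x: "plane_point i j t s \<in> closed_segment a b" and s: "s \<noteq> a $ j" "s \<noteq> b $ j"
  shows "s \<in> open_segment (a $ j) (b $ j)" "t = crossing i j a b s"
proof -
  obtain v where v: "0 \<le> v" "v \<le> 1" "plane_point i j t s = (1 - v) *\<^sub>R a + v *\<^sub>R b"
    using x by (auto simp: in_segment)
  have sv: "s = (1 - v) * a $ j + v * b $ j" and tv: "t = (1 - v) * a $ i + v * b $ i"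
    using arg_cong[OF v(3), of "\<lambda>x. x $ j"] arg_cong[OF v(3), of "\<lambda>x. x $ i"]
    by (simp_all add: plane_point_nth[OF ij])
  have ne: "a $ j \<noteq> b $ j"
  proof
    assume "a $ j = b $ j"
    then have "s = a $ j" using sv by (simp add: algebra_simps)
    then show False using s by simp
  qed
  have "v \<noteq> 0" "v \<noteq> 1" using sv s by auto
  then show "s \<in> open_segment (a $ j) (b $ j)"
    unfolding in_segment using v sv ne by (intro conjI exI[of _ v]) auto
  have "(s - a $ j) / (b $ j - a $ j) = v" using ne sv by (simp add: field_simps)
  then show "t = crossing i j a b s" unfolding crossing_def tv by (simp add: algebra_simps)
qed

text \<open>On a line that avoids all vertices, every boundary point is a transversal crossing of exactly one
edge, in its relative interior, and the outward normal there decides whether the polygon is left or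
entered. Elsewhere on the line, inside and outside are open. So the crossing formula applies.\<close>

lemma polygon_slice:
  fixes f :: "point \<Rightarrow> real" and G :: "point \<Rightarrow> real^2"
  assumes K: "simple_polygon K" and ij: "i \<noteq> j"
    and AB: "\<And>E. E \<in> edges K \<Longrightarrow> E = closed_segment (A E) (B E)"
    and G: "\<And>x. GDERIV f x :> G x" and contG: "continuous_on UNIV G"
    and s: "s \<notin> (\<lambda>v. v $ j) ` set K"
  shows "(\<integral>t. indicator (region K) (plane_point i j t s) * (G (plane_point i j t s) $ i) \<partial>lborel) =
    (\<Sum>E\<in>edges K. indicator (open_segment (A E $ j) (B E $ j)) s *
       (sgn (outward_normal K E $ i) * f (plane_point i j (crossing i j (A E) (B E) s) s)))"
proof -
  define P where "P t = plane_point i j t s" for t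
  define S where "S = {t. P t \<in> region K}"
  define I where "I = {E \<in> edges K. s \<in> open_segment (A E $ j) (B E $ j)}"
  define c where "c E = crossing i j (A E) (B E) s" for E
  define \<sigma> where "\<sigma> E = sgn (outward_normal K E $ i)" for E
  have contP: "continuous_on UNIV P" unfolding P_def by (intro continuous_intros)
  have Pdiff: "P t - P t' = (t - t') *\<^sub>R axis i 1" for t t'
    by (simp add: P_def plane_point_def algebra_simps)
  have IE: "E \<in> edges K" if "E \<in> I" for E using that by (simp add: I_def)
  have Pc: "P (c E) \<in> open_segment (A E) (B E)" if "E \<in> I" for E
    using that crossing_in_open_segment[OF ij] by (simp add: I_def P_def c_def)
  have PcE: "P (c E) \<in> E" if "E \<in> I" for E
    using Pc[OF that] AB[OF IE[OF that]] by (auto simp: open_segment_def)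
  have bdry: "t \<in> c ` I" if t: "P t \<in> \<Union>(edges K)" for t
  proof -
    obtain E where E: "E \<in> edges K" "P t \<in> E" using t by auto
    then have seg: "P t \<in> closed_segment (A E) (B E)" using AB by auto
    have "s \<noteq> A E $ j" "s \<noteq> B E $ j" using edge_endpoints[OF K E(1) AB[OF E(1)]] s by auto
    then have "E \<in> I" "t = c E"
      using in_segment_imp_crossing[OF ij seg[unfolded P_def]] E by (auto simp: I_def c_def)
    then show ?thesis by auto
  qed
  have inj: "inj_on c I"
  proof (rule inj_onI)
    fix E E' assume E: "E \<in> I" "E' \<in> I" "c E = c E'"
    show "E = E'"
    proof (rule ccontr)
      assume "E \<noteq> E'"
      then have "P (c E) \<notin> E'"
        using open_edge_disjoint[OF K IE[OF E(1)] AB[OF IE[OF E(1)]] Pc[OF E(1)]] IE[OF E(2)] by auto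
      then show False using PcE[OF E(2)] E(3) by simp
    qed
  qed
  obtain M where M: "\<And>x. x \<in> region K \<Longrightarrow> norm x \<le> M"
    using compact_region[of K] by (metis bounded_iff compact_imp_bounded)
  have SM: "S \<subseteq> {- (\<bar>M\<bar> + 1)<..<\<bar>M\<bar> + 1}"
  proof
    fix t assume "t \<in> S"
    then have "norm (P t) \<le> M" using M by (simp add: S_def)
    moreover have "\<bar>t\<bar> \<le> norm (P t)"
      using component_le_norm_cart[of "P t" i] by (simp add: P_def plane_point_nth[OF ij])
    ultimately show "t \<in> {- (\<bar>M\<bar> + 1)<..<\<bar>M\<bar> + 1}" by auto
  qed
  have der: "((\<lambda>t. f (P t)) has_real_derivative G (P t) $ i) (at t)" for t
  proof -
    have "(P has_derivative (\<lambda>h. h *\<^sub>R axis i 1)) (at t)"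
      unfolding P_def plane_point_def by (auto intro!: derivative_eq_intros)
    moreover have "(f has_derivative (\<lambda>h. h \<bullet> G (P t))) (at (P t))"
      using G unfolding gderiv_def .
    ultimately have "((f \<circ> P) has_derivative (\<lambda>h. h \<bullet> G (P t)) \<circ> (\<lambda>h. h *\<^sub>R axis i 1)) (at t)"
      by (rule diff_chain_at)
    moreover have "(\<lambda>h. h \<bullet> G (P t)) \<circ> (\<lambda>h. h *\<^sub>R axis i 1) = (*) (G (P t) $ i)"
      by (simp add: fun_eq_iff inner_axis')
    ultimately show ?thesis by (simp add: o_def has_field_derivative_def)
  qed
  have off: "eventually (\<lambda>x. x \<in> S) (nhds t) \<or> eventually (\<lambda>x. x \<notin> S) (nhds t)" if t: "t \<notin> c ` I" for t
  proof -
    let ?S = "\<Union>(edges K)"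
    have "P t \<notin> ?S" using bdry t by auto
    then have "P t \<in> inside ?S \<or> P t \<in> outside ?S" using inside_Un_outside[of ?S] by blast
    moreover have op: "open (inside ?S)" "open (outside ?S)"
      using compact_boundary[of K] by (auto simp: open_inside open_outside compact_imp_closed)
    have ev: "eventually (\<lambda>x. P x \<in> T) (nhds t)" if T: "open T" "P t \<in> T" for T
    proof -
      have "open (P -` T)" using contP T(1) by (simp add: open_vimage)
      then show ?thesis using eventually_nhds_in_open[of "P -` T" t] T by simp
    qed
    moreover have "eventually (\<lambda>x. x \<in> S) (nhds t)" if "eventually (\<lambda>x. P x \<in> inside ?S) (nhds t)"
      using that by eventually_elim (auto simp: S_def region_def)
    moreover have "eventually (\<lambda>x. x \<notin> S) (nhds t)" if "eventually (\<lambda>x. P x \<in> outside ?S) (nhds t)"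
      using that by eventually_elim (auto simp: S_def region_eq)
    ultimately show ?thesis using op by blast
  qed
  have cross: "\<sigma> E = 1 \<and> eventually (\<lambda>x. x \<in> S) (at_left (c E)) \<and> eventually (\<lambda>x. x \<notin> S) (at_right (c E)) \<or>
      \<sigma> E = -1 \<and> eventually (\<lambda>x. x \<notin> S) (at_left (c E)) \<and> eventually (\<lambda>x. x \<in> S) (at_right (c E))"
    if E: "E \<in> I" for E
  proof -
    let ?n = "outward_normal K E"
    note n = outward_normal[OF K IE[OF E] AB[OF IE[OF E]]]
    obtain r where r: "0 < r" "\<forall>y\<in>ball (P (c E)) r.
      (0 < ?n \<bullet> (y - P (c E)) \<longrightarrow> y \<notin> region K) \<and> (?n \<bullet> (y - P (c E)) < 0 \<longrightarrow> y \<in> region K)"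
      using n(3)[OF Pc[OF E]] unfolding outer_normal_at_def by auto
    have near: "(0 < (t - c E) * ?n $ i \<longrightarrow> t \<notin> S) \<and> ((t - c E) * ?n $ i < 0 \<longrightarrow> t \<in> S)"
      if "\<bar>t - c E\<bar> < r" for t
    proof -
      have "dist (P (c E)) (P t) < r" using that Pdiff[of t "c E"] by (simp add: dist_norm norm_minus_commute)
      then show ?thesis using r(2)[rule_format, of "P t"] Pdiff[of t "c E"]
        by (simp add: S_def inner_axis)
    qed
    have left: "eventually (\<lambda>t. t < c E \<and> \<bar>t - c E\<bar> < r) (at_left (c E))"
      using r(1) by (auto simp: eventually_at_left_field intro!: exI[of _ "c E - r"])
    have right: "eventually (\<lambda>t. c E < t \<and> \<bar>t - c E\<bar> < r) (at_right (c E))"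
      using r(1) by (auto simp: eventually_at_right_field intro!: exI[of _ "c E + r"])
    have "?n \<noteq> 0" "(B E - A E) $ j \<noteq> 0" using n(1) E by (auto simp: I_def)
    then have "?n $ i \<noteq> 0" using normal_component_nonzero[OF ij _ n(2)] by blast
    then consider "0 < ?n $ i" | "?n $ i < 0" by linarith
    then show ?thesis
    proof cases
      case 1
      have "eventually (\<lambda>x. x \<in> S) (at_left (c E))" using left
        by eventually_elim (use near 1 in \<open>auto simp: mult_less_0_iff\<close>)
      moreover have "eventually (\<lambda>x. x \<notin> S) (at_right (c E))" using right
        by eventually_elim (use near 1 in \<open>auto simp: zero_less_mult_iff\<close>)
      ultimately show ?thesis using 1 by (simp add: \<sigma>_def)
    next
      case 2
      have "eventually (\<lambda>x. x \<notin> S) (at_left (c E))" using left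
        by eventually_elim (use near 2 in \<open>auto simp: zero_less_mult_iff\<close>)
      moreover have "eventually (\<lambda>x. x \<in> S) (at_right (c E))" using right
        by eventually_elim (use near 2 in \<open>auto simp: mult_less_0_iff\<close>)
      ultimately show ?thesis using 2 by (simp add: \<sigma>_def)
    qed
  qed
  have fin: "finite I" by (simp add: I_def)
  have cS: "c E \<in> S" if "E \<in> I" for E using PcE[OF that] IE[OF that] by (auto simp: S_def region_def)
  have hi: "((\<lambda>t. indicator S t * (G (P t) $ i)) has_integral (\<Sum>E\<in>I. \<sigma> E * f (P (c E)))) {- (\<bar>M\<bar> + 1)..\<bar>M\<bar> + 1}"
    by (rule crossing_formula[OF fin inj cS SM _ der off cross]) auto
  have hiU: "((\<lambda>t. indicator S t * (G (P t) $ i)) has_integral (\<Sum>E\<in>I. \<sigma> E * f (P (c E)))) UNIV"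
    by (rule has_integral_on_superset[OF hi]) (use SM in \<open>auto simp: indicator_def subset_eq\<close>)
  have "closed (P -` region K)"
    using contP compact_region[of K] by (intro closed_vimage compact_imp_closed)
  then have "closed S" by (simp add: S_def vimage_def)
  then have "compact S" using SM bounded_subset[of "{- (\<bar>M\<bar> + 1)<..<\<bar>M\<bar> + 1}" S]
    by (simp add: compact_eq_bounded_closed)
  moreover have "continuous_on UNIV (\<lambda>t. G (P t))"
    by (rule continuous_on_compose2[OF contG contP]) auto
  then have "continuous_on UNIV (\<lambda>t. G (P t) $ i)" by (intro continuous_intros)
  then have "continuous_on S (\<lambda>t. G (P t) $ i)" by (rule continuous_on_subset) auto
  ultimately have "integrable lborel (\<lambda>t. indicator S t *\<^sub>R (G (P t) $ i))"
    by (intro borel_integrable_compact)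
  then have "((\<lambda>t. indicator S t * (G (P t) $ i)) has_integral (\<integral>t. indicator S t * (G (P t) $ i) \<partial>lborel)) UNIV"
    using has_integral_integral_lborel[of "\<lambda>t. indicator S t * (G (P t) $ i)"] by simp
  then have "(\<integral>t. indicator S t * (G (P t) $ i) \<partial>lborel) = (\<Sum>E\<in>I. \<sigma> E * f (P (c E)))"
    using hiU has_integral_unique by blast
  also have "\<dots> = (\<Sum>E\<in>edges K. indicator (open_segment (A E $ j) (B E $ j)) s * (\<sigma> E * f (P (c E))))"
    by (rule sum.mono_neutral_cong_left) (auto simp: I_def)
  finally show ?thesis by (simp add: S_def P_def \<sigma>_def c_def indicator_def)
qed

text \<open>The parametrization of the edge by \<open>[0, 1]\<close> is an affine substitution of the transversal variable.
The lemma covers the edges parallel to the slices, for which both sides vanish.\<close>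

lemma edge_slice_integral:
  fixes f :: "point \<Rightarrow> real" and a b :: point
  assumes ij: "i \<noteq> j" and f: "continuous_on UNIV f"
  defines "g \<equiv> \<lambda>s. indicator (open_segment (a $ j) (b $ j)) s * f (plane_point i j (crossing i j a b s) s)"
  shows "integrable lborel g"
    "integral\<^sup>L lborel g = \<bar>b $ j - a $ j\<bar> * integral {0..1} (\<lambda>t. f (linepath a b t))"
proof -
  define q where "q s = f (plane_point i j (crossing i j a b s) s)" for s
  define c where "c = b $ j - a $ j"
  have contq: "continuous_on UNIV q" unfolding q_def
  proof (rule continuous_on_compose2[OF f])
    show "continuous_on UNIV (\<lambda>s. plane_point i j (crossing i j a b s) s)"
      unfolding crossing_def divide_inverse by (intro continuous_intros)
  qed auto
  have opn: "open_segment (a $ j) (b $ j) \<in> sets lborel"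
    by (auto simp: open_segment_eq_real_ivl)
  have "integrable lborel (\<lambda>s. indicator (closed_segment (a $ j) (b $ j)) s *\<^sub>R q s)"
    by (intro borel_integrable_compact compact_segment continuous_on_subset[OF contq]) auto
  then have "integrable lborel (\<lambda>s. indicator (open_segment (a $ j) (b $ j)) s *\<^sub>R
      (indicator (closed_segment (a $ j) (b $ j)) s *\<^sub>R q s))"
    by (rule integrable_mult_indicator[OF opn])
  moreover have "(\<lambda>s. indicator (open_segment (a $ j) (b $ j)) s *\<^sub>R
      (indicator (closed_segment (a $ j) (b $ j)) s *\<^sub>R q s)) = g"
    by (auto simp: g_def q_def open_segment_def indicator_def)
  ultimately show "integrable lborel g" by simp
  show "integral\<^sup>L lborel g = \<bar>b $ j - a $ j\<bar> * integral {0..1} (\<lambda>t. f (linepath a b t))"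
  proof (cases "c = 0")
    case True
    then show ?thesis by (simp add: g_def c_def)
  next
    case False
    have ne: "a $ j \<noteq> b $ j" using False by (auto simp: c_def)
    have seg: "a $ j + c * x \<in> open_segment (a $ j) (b $ j) \<longleftrightarrow> x \<in> {0<..<1}" for x
    proof -
      have "a $ j + c * x \<in> open_segment (a $ j) (b $ j) \<longleftrightarrow> (\<exists>u. 0 < u \<and> u < 1 \<and> c * x = c * u)"
        unfolding in_segment using ne by (simp add: c_def algebra_simps)
      then show ?thesis using False by auto
    qed
    have "integral\<^sup>L lborel g = \<bar>c\<bar> * (\<integral>x. g (a $ j + c * x) \<partial>lborel)"
      using lborel_integral_real_affine[OF False, of g "a $ j"] by simp
    also have "(\<lambda>x. g (a $ j + c * x)) = (\<lambda>x. indicator {0<..<1} x *\<^sub>R f (linepath a b x))"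
    proof
      fix x
      have "(a $ j + c * x - a $ j) / (b $ j - a $ j) = x" using False by (simp flip: c_def)
      then show "g (a $ j + c * x) = indicator {0<..<1} x *\<^sub>R f (linepath a b x)"
        unfolding g_def crossing_linepath[OF ij ne] using seg by (simp add: indicator_def)
    qed
    also have "(\<integral>x. indicator {0<..<1} x *\<^sub>R f (linepath a b x) \<partial>lborel) = integral {0<..<1} (\<lambda>t. f (linepath a b t))"
    proof -
      have "set_integrable lborel {0..1} (\<lambda>t. f (linepath a b t))"
        by (intro borel_integrable_atLeastAtMost' continuous_on_compose2[OF f] continuous_on_linepath) auto
      then have "set_integrable lborel {0<..<1} (\<lambda>t. f (linepath a b t))"
        by (rule set_integrable_subset) auto
      then show ?thesis using set_borel_integral_eq_integral(2)[of "{0<..<1}" "\<lambda>t. f (linepath a b t)"]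
        by (simp add: set_lebesgue_integral_def)
    qed
    finally show ?thesis by (simp add: c_def integral_open_interval_real)
  qed
qed

text \<open>Almost every line avoids the finitely many vertices, so the slices can be integrated. The functions
\<open>A\<close> and \<open>B\<close> choose an orientation of each edge arbitrarily, since a segment as a set does not
determine one.\<close>

theorem polygon_divergence:
  fixes f :: "point \<Rightarrow> real" and G :: "point \<Rightarrow> real^2"
  assumes K: "simple_polygon K"
    and AB: "\<And>E. E \<in> edges K \<Longrightarrow> E = closed_segment (A E) (B E)"
    and G: "\<And>x. GDERIV f x :> G x" and contG: "continuous_on UNIV G"
  shows "integral (region K) (\<lambda>x. G x $ i) =
    (\<Sum>E\<in>edges K. dist (A E) (B E) * (outward_normal K E $ i) * integral {0..1} (\<lambda>t. f (linepath (A E) (B E) t)))"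
proof -
  obtain j :: 2 where ij: "i \<noteq> j" using exhaust_2[of i] by (metis zero_neq_one)
  have contf: "continuous_on UNIV f"
    using G gderiv_def has_derivative_continuous by (metis continuous_at_imp_continuous_on)
  define g where "g E s = indicator (open_segment (A E $ j) (B E $ j)) s * f (plane_point i j (crossing i j (A E) (B E) s) s)" for E s
  note gint = edge_slice_integral[OF ij contf, of "A E" "B E" for E, folded g_def]
  let ?F = "\<lambda>s. \<integral>t. indicator (region K) (plane_point i j t s) * (G (plane_point i j t s) $ i) \<partial>lborel"
  let ?H = "\<lambda>s. \<Sum>E\<in>edges K. sgn (outward_normal K E $ i) * g E s"
  have contGi: "continuous_on UNIV (\<lambda>x. G x $ i)" using contG by (intro continuous_intros)
  have "integral (region K) (\<lambda>x. G x $ i) = integral\<^sup>L lborel ?F"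
    by (rule integral_slices[OF ij compact_region contGi])
  also have "\<dots> = integral\<^sup>L lborel ?H"
  proof (rule integral_cong_AE)
    have [measurable]: "region K \<in> sets borel" "(\<lambda>x. G x $ i) \<in> borel_measurable borel"
      using compact_region[of K] contGi by (auto intro: borel_compact borel_measurable_continuous_onI)
    have [measurable]: "(\<lambda>x. plane_point i j (snd x) (fst x)) \<in> borel \<Otimes>\<^sub>M borel \<rightarrow>\<^sub>M borel"
      unfolding borel_prod by (intro borel_measurable_continuous_onI continuous_intros)
    have "(\<lambda>x. (\<lambda>y. indicator (region K) y * (G y $ i)) (plane_point i j (snd x) (fst x))) \<in> borel_measurable (borel \<Otimes>\<^sub>M borel)"
      by measurable
    then have "(\<lambda>(s, t). indicator (region K) (plane_point i j t s) * (G (plane_point i j t s) $ i)) \<in> borel_measurable (lborel \<Otimes>\<^sub>M lborel)"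
      by (simp add: case_prod_unfold cong: measurable_cong_sets sets_pair_measure_cong)
    then show "?F \<in> borel_measurable lborel"
      by (rule lborel.borel_measurable_lebesgue_integral)
    show "?H \<in> borel_measurable lborel"
      using gint(1) by (intro borel_measurable_sum borel_measurable_times) auto
    have "finite ((\<lambda>v. v $ j) ` set K)" by simp
    then have "(\<lambda>v. v $ j) ` set K \<in> null_sets lborel" by (rule finite_imp_null_set_lborel)
    then have "AE s in lborel. s \<notin> (\<lambda>v. v $ j) ` set K" by (rule AE_not_in)
    then show "AE s in lborel. ?F s = ?H s"
    proof eventually_elim
      case (elim s)
      have "?F s = (\<Sum>E\<in>edges K. indicator (open_segment (A E $ j) (B E $ j)) s *
          (sgn (outward_normal K E $ i) * f (plane_point i j (crossing i j (A E) (B E) s) s)))"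
        by (rule polygon_slice[OF K ij AB G contG elim])
      also have "\<dots> = ?H s" unfolding g_def by (simp only: mult.left_commute)
      finally show ?case .
    qed
  qed
  also have "\<dots> = (\<Sum>E\<in>edges K. sgn (outward_normal K E $ i) * integral\<^sup>L lborel (g E))"
    using gint(1) by (subst Bochner_Integration.integral_sum) auto
  also have "\<dots> = (\<Sum>E\<in>edges K. dist (A E) (B E) * (outward_normal K E $ i) * integral {0..1} (\<lambda>t. f (linepath (A E) (B E) t)))"
  proof (rule sum.cong[OF refl])
    fix E assume E: "E \<in> edges K"
    have "sgn (outward_normal K E $ i) * \<bar>B E $ j - A E $ j\<bar> = dist (A E) (B E) * (outward_normal K E $ i)"
      using normal_times_length[OF ij outward_normal(1,2)[OF K E AB[OF E]]]
      by (simp add: dist_norm norm_minus_commute)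
    then show "sgn (outward_normal K E $ i) * integral\<^sup>L lborel (g E) =
        dist (A E) (B E) * (outward_normal K E $ i) * integral {0..1} (\<lambda>t. f (linepath (A E) (B E) t))"
      unfolding gint(2) by (simp only: mult.assoc[symmetric])
  qed
  finally show ?thesis .
qed


section \<open>Bivariate polynomials and Gauss quadrature\<close>

lemma edge_length_segment: "edge_length (closed_segment a b) = dist a b"
proof -
  have "norm (x - y) \<le> dist a b" if xy: "x \<in> closed_segment a b" "y \<in> closed_segment a b" for x y
  proof -
    obtain s t where st: "x = (1 - s) *\<^sub>R a + s *\<^sub>R b" "y = (1 - t) *\<^sub>R a + t *\<^sub>R b"
      "0 \<le> s" "s \<le> 1" "0 \<le> t" "t \<le> 1" using xy by (auto simp: in_segment)
    then have "x - y = (s - t) *\<^sub>R (b - a)" by (simp only:) (simp add: algebra_simps)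
    then have "norm (x - y) = \<bar>s - t\<bar> * dist a b" by (simp add: dist_norm norm_minus_commute)
    also have "\<dots> \<le> 1 * dist a b" using st by (intro mult_right_mono) auto
    finally show ?thesis by simp
  qed
  then have "diameter (closed_segment a b) \<le> dist a b" by (intro diameter_le) auto
  moreover have "dist a b \<le> diameter (closed_segment a b)"
    by (intro diameter_bounded_bound) (auto simp: bounded_closed_segment)
  ultimately show ?thesis by (simp add: edge_length_def)
qed

lemma poly2_monomial: "i + j \<le> k \<Longrightarrow> (\<lambda>x. c * (x $ 1) ^ i * (x $ 2) ^ j) \<in> poly2 k"
proof -
  assume ij: "i + j \<le> k"
  define d where "d i' j' = (if i' = i then if j' = j then c else 0 else 0)" for i' j'
  have inner: "(\<Sum>j'\<le>k - i'. d i' j' * (x $ 1) ^ i' * (x $ 2) ^ j') =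
      (if i' = i then c * (x $ 1) ^ i * (x $ 2) ^ j else 0)" for i' and x :: "real^2"
  proof -
    have "(\<Sum>j'\<le>k - i'. d i' j' * (x $ 1) ^ i' * (x $ 2) ^ j') =
        (\<Sum>j'\<le>k - i'. if j' = j then d i' j * (x $ 1) ^ i' * (x $ 2) ^ j else 0)"
      by (rule sum.cong) (auto simp: d_def)
    then show ?thesis using ij by (auto simp: d_def)
  qed
  have "(\<Sum>i'\<le>k. \<Sum>j'\<le>k - i'. d i' j' * (x $ 1) ^ i' * (x $ 2) ^ j') = c * (x $ 1) ^ i * (x $ 2) ^ j"
    for x :: "real^2" unfolding inner using ij by simp
  then show ?thesis unfolding poly2_def by (auto intro!: exI[of _ d])
qed

lemma poly2_zero: "(\<lambda>x. 0) \<in> poly2 k"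
  unfolding poly2_def by (auto intro!: exI[of _ "\<lambda>i j. 0"])

lemma poly2_one: "(\<lambda>x. 1) \<in> poly2 k"
  using poly2_monomial[of 0 0 k 1] by simp

lemma poly2_add:
  assumes "f \<in> poly2 k" "g \<in> poly2 k" shows "(\<lambda>x. f x + g x) \<in> poly2 k"
proof -
  obtain c d where "\<And>x. f x = (\<Sum>i\<le>k. \<Sum>j\<le>k - i. c i j * (x $ 1) ^ i * (x $ 2) ^ j)"
    "\<And>x. g x = (\<Sum>i\<le>k. \<Sum>j\<le>k - i. d i j * (x $ 1) ^ i * (x $ 2) ^ j)"
    using assms unfolding poly2_def by auto
  then show ?thesis unfolding poly2_def
    by (auto intro!: exI[of _ "\<lambda>i j. c i j + d i j"] simp: sum.distrib distrib_right)
qed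

lemma poly2_induct [consumes 1, case_names zero monomial add]:
  assumes f: "f \<in> poly2 k" and zero: "P (\<lambda>x. 0)"
    and mono: "\<And>i j c. i + j \<le> k \<Longrightarrow> P (\<lambda>x. c * (x $ 1) ^ i * (x $ 2) ^ j)"
    and add: "\<And>f g. P f \<Longrightarrow> P g \<Longrightarrow> P (\<lambda>x. f x + g x)"
  shows "P f"
proof -
  have P_sum: "P (\<lambda>x. \<Sum>a\<in>A. F a x)" if "finite A" "\<And>a. a \<in> A \<Longrightarrow> P (F a)"
    for A :: "nat set" and F
    using that by (induction A rule: finite_induct) (auto intro: zero add)
  obtain c where "\<And>x. f x = (\<Sum>i\<le>k. \<Sum>j\<le>k - i. c i j * (x $ 1) ^ i * (x $ 2) ^ j)"
    using f unfolding poly2_def by auto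
  then have f_eq: "f = (\<lambda>x. \<Sum>i\<le>k. \<Sum>j\<le>k - i. c i j * (x $ 1) ^ i * (x $ 2) ^ j)" by auto
  show ?thesis unfolding f_eq by (intro P_sum mono) auto
qed

lemma continuous_poly2: "f \<in> poly2 k \<Longrightarrow> continuous_on A f"
  by (induction rule: poly2_induct) (auto intro!: continuous_intros)

lemma gradient_eq:
  assumes "GDERIV f x :> D" shows "gradient f x = D"
  unfolding gradient_def
proof (rule the_equality, rule assms)
  fix D' assume "GDERIV f x :> D'"
  then have "(\<lambda>h. h \<bullet> D') = (\<lambda>h. h \<bullet> D)"
    using assms has_derivative_unique unfolding gderiv_def by blast
  then show "D' = D" by (metis vector_eq_ldot)
qed

lemma poly2_has_gradient:
  assumes "f \<in> poly2 k"
  shows "\<exists>G. (\<forall>x. GDERIV f x :> G x) \<and> (\<forall>i. (\<lambda>x. G x $ i) \<in> poly2 k)"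
  using assms
proof (induction rule: poly2_induct)
  case zero
  show ?case by (rule exI[of _ "\<lambda>x. 0"]) (auto simp: GDERIV_const poly2_zero)
next
  case (monomial i j c)
  let ?G = "\<lambda>x::real^2. vector [c * real i * (x $ 1) ^ (i - 1) * (x $ 2) ^ j,
    c * real j * (x $ 1) ^ i * (x $ 2) ^ (j - 1)] :: real^2"
  have nth: "((\<lambda>x. x $ m) has_derivative (\<lambda>h. h $ m)) (at x)" for m and x :: "real^2"
    by (rule bounded_linear.has_derivative[OF bounded_linear_vec_nth]) (rule has_derivative_ident)
  have "GDERIV (\<lambda>x. c * (x $ 1) ^ i * (x $ 2) ^ j) x :> ?G x" for x
    unfolding gderiv_def
    by (rule has_derivative_eq_rhs, (rule derivative_intros nth)+)
      (auto simp: fun_eq_iff inner_real2 algebra_simps)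
  moreover have "(\<lambda>x. ?G x $ m) \<in> poly2 k" for m
    using exhaust_2[of m] poly2_monomial[of "i - 1" j k "c * real i"] poly2_monomial[of i "j - 1" k "c * real j"]
      monomial by auto
  ultimately show ?case by (intro exI[of _ ?G]) blast
next
  case (add f g)
  then obtain F G where "\<forall>x. GDERIV f x :> F x" "\<forall>i. (\<lambda>x. F x $ i) \<in> poly2 k"
    "\<forall>x. GDERIV g x :> G x" "\<forall>i. (\<lambda>x. G x $ i) \<in> poly2 k" by auto
  then show ?case by (intro exI[of _ "\<lambda>x. F x + G x"]) (auto intro: GDERIV_add poly2_add)
qed

lemma poly2_gradient:
  assumes "f \<in> poly2 k"
  shows "GDERIV f x :> gradient f x" "(\<lambda>x. gradient f x $ i) \<in> poly2 k"
proof -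
  obtain G where G: "\<And>x. GDERIV f x :> G x" "\<And>i. (\<lambda>x. G x $ i) \<in> poly2 k"
    using poly2_has_gradient[OF assms] by auto
  have "gradient f = G" using gradient_eq[OF G(1)] by auto
  then show "GDERIV f x :> gradient f x" "(\<lambda>x. gradient f x $ i) \<in> poly2 k" using G by auto
qed

lemma poly2_on_line:
  assumes "f \<in> poly2 k"
  shows "\<exists>p. degree p \<le> k \<and> (\<forall>t. f (linepath a b t) = poly p t)"
  using assms
proof (induction rule: poly2_induct)
  case zero
  show ?case by (rule exI[of _ 0]) auto
next
  case (monomial i j c)
  let ?l = "\<lambda>m. [:a $ m, b $ m - a $ m:]"
  let ?p = "[:c:] * ?l 1 ^ i * ?l 2 ^ j"
  have le1: "degree (?l m) \<le> 1" for m by (simp add: degree_pCons_le)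
  have pow: "degree (?l m ^ q) \<le> q" for m q
    by (rule order_trans[OF degree_power_le]) (use mult_right_mono[OF le1] in simp)
  have "degree ([:c:] * ?l 1 ^ i) \<le> 0 + i"
    by (intro order_trans[OF degree_mult_le] add_mono pow) auto
  then have "degree ?p \<le> i + j"
    using degree_mult_le[of "[:c:] * ?l 1 ^ i" "?l 2 ^ j"] pow[of 2 j] by linarith
  then show ?case using monomial
    by (intro exI[of _ ?p]) (auto simp: linepath_def algebra_simps simp del: mult_pCons_left)
next
  case (add f g)
  then obtain p q where "degree p \<le> k" "\<forall>t. f (linepath a b t) = poly p t"
    "degree q \<le> k" "\<forall>t. g (linepath a b t) = poly q t" by auto
  then show ?case by (intro exI[of _ "p + q"]) (auto intro: degree_add_le)
qed

text \<open>The test polynomial is the square of the product of the linear factors of all other nodes. Its degree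
\<open>2 N - 2\<close> is in the range of exactness, it vanishes at all nodes but one, and it has a positive
integral.\<close>

lemma gauss_weight_pos:
  assumes G: "gauss_rule N \<xi> \<omega>" and \<mu>: "\<mu> \<in> {1..N}" shows "0 < \<omega> \<mu>"
proof -
  define l where "l = (\<Prod>\<nu>\<in>{1..N} - {\<mu>}. [:- \<xi> \<nu>, 1:])"
  have inj: "inj_on \<xi> {1..N}" using G by (simp add: gauss_rule_def)
  have "degree l \<le> (\<Sum>\<nu>\<in>{1..N} - {\<mu>}. 1)"
    unfolding l_def by (rule order_trans[OF degree_prod_sum_le]) auto
  then have "degree l \<le> N - 1" using \<mu> by simp
  then have "degree (l\<^sup>2) \<le> 2 * N - 1"
    using degree_power_le[of l 2] \<mu> by auto
  then have quad: "(\<Sum>\<nu>=1..N. \<omega> \<nu> * poly (l\<^sup>2) (\<xi> \<nu>)) = integral {0..1} (poly (l\<^sup>2))"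
    using G unfolding gauss_rule_def by blast
  have l0: "poly l (\<xi> \<nu>) = 0 \<longleftrightarrow> \<nu> \<noteq> \<mu>" if "\<nu> \<in> {1..N}" for \<nu>
    using that \<mu> inj by (auto simp: l_def poly_prod inj_on_eq_iff)
  have "(\<Sum>\<nu>=1..N. \<omega> \<nu> * poly (l\<^sup>2) (\<xi> \<nu>)) = (\<Sum>\<nu>=1..N. if \<nu> = \<mu> then \<omega> \<mu> * (poly l (\<xi> \<mu>))\<^sup>2 else 0)"
    using l0 by (intro sum.cong) auto
  then have w: "\<omega> \<mu> * (poly l (\<xi> \<mu>))\<^sup>2 = integral {0..1} (poly (l\<^sup>2))"
    using quad \<mu> by simp
  have ne: "l \<noteq> 0" using l0[OF \<mu>] by auto
  have cont: "continuous_on {0..1} (poly (l\<^sup>2))" by (intro continuous_intros)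
  have "integral {0..1} (poly (l\<^sup>2)) \<noteq> 0"
  proof
    assume "integral {0..1} (poly (l\<^sup>2)) = 0"
    then have "{0..1} \<subseteq> {x. poly l x = 0}"
      using integral_eq_0_iff[of 0 1 "poly (l\<^sup>2)"] cont by auto
    then have "finite {0..1::real}" using poly_roots_finite[OF ne] finite_subset by blast
    then show False using infinite_Icc[of 0 "1::real"] by linarith
  qed
  moreover have "0 \<le> integral {0..1} (poly (l\<^sup>2))"
    by (intro integral_nonneg integrable_continuous_interval cont) auto
  ultimately have "0 < \<omega> \<mu> * (poly l (\<xi> \<mu>))\<^sup>2" using w by linarith
  then show ?thesis by (simp add: zero_less_mult_iff)
qed

lemma gauss_poly2:
  assumes G: "gauss_rule N \<xi> \<omega>" and N: "k < N" and f: "f \<in> poly2 k"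
  shows "integral {0..1} (\<lambda>t. f (linepath a b t)) = (\<Sum>\<mu>=1..N. \<omega> \<mu> * f (linepath a b (\<xi> \<mu>)))"
proof -
  obtain p where p: "degree p \<le> k" "\<And>t. f (linepath a b t) = poly p t"
    using poly2_on_line[OF f] by blast
  then have "degree p \<le> 2 * N - 1" using N by linarith
  then show ?thesis using G p(2) unfolding gauss_rule_def by simp
qed


section \<open>Quadrature on cells\<close>

lemma integrable_on_region: "continuous_on (region K) f \<Longrightarrow> f integrable_on region K"
  for f :: "point \<Rightarrow> 'a::euclidean_space"
proof -
  assume "continuous_on (region K) f"
  then have "set_integrable lborel (region K) f"
    using borel_integrable_compact[OF compact_region] by (simp add: set_integrable_def)
  then show ?thesis by (rule set_borel_integral_eq_integral)
qed

lemma cell_avg_linear: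
  fixes f :: "point \<Rightarrow> 'a::euclidean_space" and h :: "'a \<Rightarrow> 'b::euclidean_space"
  assumes "continuous_on (region K) f" "bounded_linear h"
  shows "h (cell_avg K f) = cell_avg K (\<lambda>x. h (f x))"
proof -
  have "integral (region K) (h \<circ> f) = h (integral (region K) f)"
    using assms by (intro integral_linear integrable_on_region)
  then show ?thesis using assms(2)
    by (simp add: cell_avg_def o_def linear_cmul bounded_linear.linear)
qed

text \<open>The restriction of \<open>Vh_state\<close> to a single cell.\<close>

definition state_poly :: "nat \<Rightarrow> (point \<Rightarrow> state) set" where
  "state_poly k = {V. (\<lambda>x. dens (V x)) \<in> poly2 k \<and> (\<forall>i. (\<lambda>x. mom (V x) $ i) \<in> poly2 k) \<and>
     (\<lambda>x. ener (V x)) \<in> poly2 k}"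

lemma cell_avg_state:
  assumes "V \<in> state_poly k"
  shows "dens (cell_avg K V) = cell_avg K (\<lambda>x. dens (V x))"
    "mom (cell_avg K V) $ i = cell_avg K (\<lambda>x. mom (V x) $ i)"
    "ener (cell_avg K V) = cell_avg K (\<lambda>x. ener (V x))"
proof -
  have "continuous_on (region K) (\<lambda>x. (dens (V x), mom (V x), ener (V x)))"
  proof (intro continuous_on_Pair)
    show "continuous_on (region K) (\<lambda>x. dens (V x))" "continuous_on (region K) (\<lambda>x. ener (V x))"
      using assms by (auto simp: state_poly_def intro: continuous_poly2)
    have "continuous_on (region K) (\<lambda>x. \<chi> i. mom (V x) $ i)"
      using assms by (intro continuous_on_vec_lambda) (auto simp: state_poly_def intro: continuous_poly2)
    then show "continuous_on (region K) (\<lambda>x. mom (V x))" by simp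
  qed
  then have c: "continuous_on (region K) V" by (simp add: dens_def mom_def ener_def)
  show "dens (cell_avg K V) = cell_avg K (\<lambda>x. dens (V x))"
    unfolding dens_def by (rule cell_avg_linear[OF c bounded_linear_fst])
  show "ener (cell_avg K V) = cell_avg K (\<lambda>x. ener (V x))"
    unfolding ener_def
    by (rule cell_avg_linear[OF c bounded_linear_compose[OF bounded_linear_snd bounded_linear_snd]])
  show "mom (cell_avg K V) $ i = cell_avg K (\<lambda>x. mom (V x) $ i)"
    unfolding mom_def
    by (rule cell_avg_linear[OF c bounded_linear_compose[OF bounded_linear_vec_nth
          bounded_linear_compose[OF bounded_linear_fst bounded_linear_snd]]])
qed

lemma state_sum:
  "dens (\<Sum>a\<in>A. F a) = (\<Sum>a\<in>A. dens (F a))" "mom (\<Sum>a\<in>A. F a) = (\<Sum>a\<in>A. mom (F a))"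
  "ener (\<Sum>a\<in>A. F a) = (\<Sum>a\<in>A. ener (F a))"
  by (induction A rule: infinite_finite_induct) auto

lemma cell_quadrature_state:
  assumes "cell_quadrature D K" "V \<in> state_poly (deg D)"
  shows "cell_avg K V = (\<Sum>q=1..cq_num D K. cq_wt D K q *\<^sub>R V (cq_node D K q))"
proof (rule state_eqI)
  have q: "f \<in> poly2 (deg D) \<Longrightarrow> cell_avg K f = (\<Sum>q=1..cq_num D K. cq_wt D K q * f (cq_node D K q))" for f
    using assms(1) by (auto simp: cell_quadrature_def)
  note V = assms(2)[unfolded state_poly_def]
  show "dens (cell_avg K V) = dens (\<Sum>q=1..cq_num D K. cq_wt D K q *\<^sub>R V (cq_node D K q))"
    "ener (cell_avg K V) = ener (\<Sum>q=1..cq_num D K. cq_wt D K q *\<^sub>R V (cq_node D K q))"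
    "mom (cell_avg K V) = mom (\<Sum>q=1..cq_num D K. cq_wt D K q *\<^sub>R V (cq_node D K q))"
    using V by (simp_all add: cell_avg_state[OF assms(2)] q state_sum vec_eq_iff)
qed

lemma special_quadrature_state:
  assumes "special_quadrature D K" "V \<in> state_poly (deg D)"
  shows "cell_avg K V =
    (\<Sum>E\<in>edges K. \<Sum>\<mu>=1..edge_num D. sq_edge_wt D K E \<mu> *\<^sub>R V (edge_node D E \<mu>)) +
    (\<Sum>q=1..sq_num D K. sq_wt D K q *\<^sub>R V (sq_node D K q))"
proof (rule state_eqI)
  let ?Q = "(\<Sum>E\<in>edges K. \<Sum>\<mu>=1..edge_num D. sq_edge_wt D K E \<mu> *\<^sub>R V (edge_node D E \<mu>)) +
    (\<Sum>q=1..sq_num D K. sq_wt D K q *\<^sub>R V (sq_node D K q))"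
  have q: "f \<in> poly2 (deg D) \<Longrightarrow> cell_avg K f =
      (\<Sum>E\<in>edges K. \<Sum>\<mu>=1..edge_num D. sq_edge_wt D K E \<mu> * f (edge_node D E \<mu>)) +
      (\<Sum>q=1..sq_num D K. sq_wt D K q * f (sq_node D K q))" for f
    using assms(1) by (auto simp: special_quadrature_def)
  note V = assms(2)[unfolded state_poly_def]
  show "dens (cell_avg K V) = dens ?Q" "ener (cell_avg K V) = ener ?Q" "mom (cell_avg K V) = mom ?Q"
    using V by (simp_all add: cell_avg_state[OF assms(2)] q state_sum vec_eq_iff)
qed

text \<open>A cell of area 0 would have all averages equal to 0, while the quadrature gives 1 for the constant
1.\<close>

lemma area_pos:
  assumes "cell_quadrature D K" shows "0 < area K"
proof -
  have "cell_avg K (\<lambda>x. 1 :: real) = (\<Sum>q=1..cq_num D K. cq_wt D K q)"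
    using assms poly2_one[of "deg D"] unfolding cell_quadrature_def by fastforce
  then have "cell_avg K (\<lambda>x. 1 :: real) = 1" using assms by (simp add: cell_quadrature_def)
  then have "area K \<noteq> 0" by (auto simp: cell_avg_def)
  then show ?thesis by (simp add: area_def less_le)
qed

text \<open>The quadrature on the cell is exact for the derivatives, and the Gauss rule on the edges is exact
for the boundary integrals. Both sides are thus the average of the gradient, by the divergence
theorem.\<close>

lemma gradient_quadrature:
  assumes K: "simple_polygon K" "cell_quadrature D K" and eq: "edge_quadrature D" "K \<in> cells D"
    and f: "f \<in> poly2 (deg D)"
  shows "(\<Sum>q=1..cq_num D K. cq_wt D K q *\<^sub>R gradient f (cq_node D K q)) = (1 / area K) *\<^sub>R
    (\<Sum>E\<in>edges K. (edge_length E * (\<Sum>\<mu>=1..edge_num D. edge_wt D \<mu> * f (edge_node D E \<mu>))) *\<^sub>R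
      outward_normal K E)"
  unfolding vec_eq_iff
proof
  fix i
  obtain \<xi> where gauss: "gauss_rule (edge_num D) \<xi> (edge_wt D)"
    and nodes: "\<forall>E\<in>edges K. \<exists>a b. E = closed_segment a b \<and>
        (\<forall>\<mu>\<in>{1..edge_num D}. edge_node D E \<mu> = linepath a b (\<xi> \<mu>))"
    using eq unfolding edge_quadrature_def by blast
  obtain A B where AB: "\<And>E. E \<in> edges K \<Longrightarrow> E = closed_segment (A E) (B E)"
    and node: "\<And>E \<mu>. E \<in> edges K \<Longrightarrow> \<mu> \<in> {1..edge_num D} \<Longrightarrow> edge_node D E \<mu> = linepath (A E) (B E) (\<xi> \<mu>)"
    using nodes by metis
  have "continuous_on UNIV (\<lambda>x. \<chi> i. gradient f x $ i)"
    using poly2_gradient(2)[OF f] by (intro continuous_on_vec_lambda continuous_poly2)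
  then have "continuous_on UNIV (gradient f)" by simp
  then have "integral (region K) (\<lambda>x. gradient f x $ i) = (\<Sum>E\<in>edges K. dist (A E) (B E) *
      (outward_normal K E $ i) * integral {0..1} (\<lambda>t. f (linepath (A E) (B E) t)))"
    by (intro polygon_divergence K AB poly2_gradient(1)[OF f])
  also have "\<dots> = (\<Sum>E\<in>edges K. (edge_length E * (\<Sum>\<mu>=1..edge_num D. edge_wt D \<mu> * f (edge_node D E \<mu>))) *
      (outward_normal K E $ i))"
  proof (rule sum.cong[OF refl])
    fix E assume E: "E \<in> edges K"
    have "deg D < edge_num D" by (simp add: edge_num_def)
    from gauss_poly2[OF gauss this f]
    have "integral {0..1} (\<lambda>t. f (linepath (A E) (B E) t)) = (\<Sum>\<mu>=1..edge_num D. edge_wt D \<mu> * f (edge_node D E \<mu>))"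
      using node[OF E] by simp
    moreover have "edge_length E = dist (A E) (B E)" using edge_length_segment AB[OF E] by metis
    ultimately show "dist (A E) (B E) * (outward_normal K E $ i) * integral {0..1} (\<lambda>t. f (linepath (A E) (B E) t)) =
      (edge_length E * (\<Sum>\<mu>=1..edge_num D. edge_wt D \<mu> * f (edge_node D E \<mu>))) * (outward_normal K E $ i)"
      by simp
  qed
  finally have int: "integral (region K) (\<lambda>x. gradient f x $ i) = \<dots>" .
  have "(\<Sum>q=1..cq_num D K. cq_wt D K q * (gradient f (cq_node D K q) $ i)) = cell_avg K (\<lambda>x. gradient f x $ i)"
    using K(2) poly2_gradient(2)[OF f, of i] unfolding cell_quadrature_def by simp
  also have "\<dots> = (1 / area K) * (\<Sum>E\<in>edges K. (edge_length E * (\<Sum>\<mu>=1..edge_num D. edge_wt D \<mu> * f (edge_node D E \<mu>))) *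
      (outward_normal K E $ i))" unfolding cell_avg_def int by simp
  finally show "(\<Sum>q=1..cq_num D K. cq_wt D K q *\<^sub>R gradient f (cq_node D K q)) $ i = ((1 / area K) *\<^sub>R
    (\<Sum>E\<in>edges K. (edge_length E * (\<Sum>\<mu>=1..edge_num D. edge_wt D \<mu> * f (edge_node D E \<mu>))) *\<^sub>R
      outward_normal K E)) $ i" by simp
qed


section \<open>Decomposition of the updated cell average\<close>

text \<open>An edge node inside the domain belongs to the point sets of both adjacent cells, since the nodes
depend on the edge alone.\<close>

lemma exterior_trace:
  assumes mesh: "polygonal_mesh (domain D) (cells D)" and K: "K \<in> cells D" "E \<in> edges K"
    and int: "\<forall>K\<in>cells D. \<forall>x\<in>points D K. P (v K x)"
    and bd: "E \<subseteq> frontier (domain D) \<Longrightarrow> P (vb K E \<mu>)" and \<mu>: "\<mu> \<in> {1..edge_num D}"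
  shows "P (ext_trace D vb v K E \<mu>)"
proof (cases "E \<subseteq> frontier (domain D)")
  case True
  then show ?thesis using bd by (simp add: ext_trace_def)
next
  case False
  then have "\<exists>K'. K' \<in> cells D \<and> K' \<noteq> K \<and> E \<in> edges K'"
    using mesh K unfolding polygonal_mesh_def by meson
  then have "neighbour D K E \<in> cells D \<and> neighbour D K E \<noteq> K \<and> E \<in> edges (neighbour D K E)"
    unfolding neighbour_def by (rule someI_ex)
  moreover from this have "edge_node D E \<mu> \<in> points D (neighbour D K E)"
    unfolding points_def using \<mu> by blast
  ultimately have "P (v (neighbour D K E) (edge_node D E \<mu>))" using int by blast
  then show ?thesis using False by (simp add: ext_trace_def)
qed

text \<open>The vector whose norm enters the second source speed.\<close>

definition source_jump ::
    "discretization \<Rightarrow> (cell \<Rightarrow> point set \<Rightarrow> nat \<Rightarrow> real) \<Rightarrow> (cell \<Rightarrow> point \<Rightarrow> real) \<Rightarrow> cell \<Rightarrow> real^2" where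
  "source_jump D pb pe K = (\<Sum>E\<in>edges K.
     (edge_length E * (\<Sum>\<mu>=1..edge_num D. edge_wt D \<mu> * jump D pb pe K E \<mu>)) *\<^sub>R outward_normal K E)"

text \<open>By \<open>gradient_quadrature\<close>, the correction in the source turns the boundary sum of \<open>p\<^sup>\<star> n\<close> into a sum
of \<open>p\<^sup>\<star> - p\<^sup>i\<^sup>n\<^sup>t\<close>, which is half the jump. The outcome is a source for the point values, driven by
\<open>\<nabla>p\<^sup>e / \<rho>\<^sup>e\<close>, and a source for the cell average, driven by the jumps; both have the form treated in
\<open>source_dominated\<close>.\<close>

lemma source_split:
  fixes re pe :: "cell \<Rightarrow> point \<Rightarrow> real" and U :: "cell \<Rightarrow> point \<Rightarrow> state"
    and pb :: "cell \<Rightarrow> point set \<Rightarrow> nat \<Rightarrow> real"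
  assumes K: "simple_polygon K" "cell_quadrature D K" and eq: "edge_quadrature D" "K \<in> cells D"
    and pe: "pe K \<in> poly2 (deg D)"
  defines "g \<equiv> \<lambda>q. (1 / re K (cq_node D K q)) *\<^sub>R gradient (pe K) (cq_node D K q)"
    and "h \<equiv> (1 / (2 * (cell_avg K (re K) * area K))) *\<^sub>R source_jump D pb pe K"
    and "Um \<equiv> cell_avg K (U K)" and "Uq \<equiv> \<lambda>q. U K (cq_node D K q)"
  shows "(0 :: real, source_mom D pb re pe U K, source_ener D pb re pe U K) =
    (\<Sum>q=1..cq_num D K. cq_wt D K q *\<^sub>R (0, dens (Uq q) *\<^sub>R g q, mom (Uq q) \<bullet> g q)) +
    (0, dens Um *\<^sub>R h, mom Um \<bullet> h)"
proof -
  define r where "r = cell_avg K (re K)"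
  define c where "c = 1 / (r * area K)"
  define G where "G = (\<Sum>q=1..cq_num D K. cq_wt D K q *\<^sub>R gradient (pe K) (cq_node D K q))"
  have "b_vec D pb pe K = (\<Sum>E\<in>edges K. (edge_length E * (\<Sum>\<mu>=1..edge_num D. edge_wt D \<mu> * pe K (edge_node D E \<mu>))) *\<^sub>R
      outward_normal K E) + (1 / 2) *\<^sub>R source_jump D pb pe K"
  proof -
    have star: "p_star D pb pe K E \<mu> = pe K (edge_node D E \<mu>) + (1 / 2) * jump D pb pe K E \<mu>" for E \<mu>
      by (simp add: p_star_def jump_def int_trace_def field_simps)
    have "edge_length E *\<^sub>R (\<Sum>\<mu>=1..edge_num D. (edge_wt D \<mu> * p_star D pb pe K E \<mu>) *\<^sub>R outward_normal K E)
      = (edge_length E * (\<Sum>\<mu>=1..edge_num D. edge_wt D \<mu> * pe K (edge_node D E \<mu>))) *\<^sub>R outward_normal K E +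
        (1 / 2) *\<^sub>R (edge_length E * (\<Sum>\<mu>=1..edge_num D. edge_wt D \<mu> * jump D pb pe K E \<mu>)) *\<^sub>R outward_normal K E" for E
    proof -
      have "(\<Sum>\<mu>=1..edge_num D. edge_wt D \<mu> * p_star D pb pe K E \<mu>) =
          (\<Sum>\<mu>=1..edge_num D. edge_wt D \<mu> * pe K (edge_node D E \<mu>)) +
          (1 / 2) * (\<Sum>\<mu>=1..edge_num D. edge_wt D \<mu> * jump D pb pe K E \<mu>)"
        unfolding star sum_distrib_left sum.distrib[symmetric] by (simp add: algebra_simps)
      then show ?thesis
        by (simp add: scaleR_sum_left[symmetric] algebra_simps)
    qed
    then show ?thesis unfolding b_vec_def source_jump_def scaleR_sum_right sum.distrib[symmetric] by simp
  qed
  then have b: "c *\<^sub>R b_vec D pb pe K = (1 / r) *\<^sub>R G + h"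
    unfolding G_def gradient_quadrature[OF K eq pe] h_def c_def
    by (simp add: scaleR_add_right r_def)
  have mom: "source_mom D pb re pe U K = (\<Sum>q=1..cq_num D K. cq_wt D K q *\<^sub>R dens (Uq q) *\<^sub>R g q) + dens Um *\<^sub>R h"
  proof -
    have "source_mom D pb re pe U K = (\<Sum>q=1..cq_num D K. cq_wt D K q *\<^sub>R dens (Uq q) *\<^sub>R g q)
        - (dens Um / r) *\<^sub>R G + dens Um *\<^sub>R (c *\<^sub>R b_vec D pb pe K)"
      unfolding source_mom_def G_def scaleR_sum_right sum_subtractf[symmetric]
      by (simp add: Um_def Uq_def r_def c_def g_def algebra_simps diff_divide_distrib)
    then show ?thesis unfolding b by (simp add: algebra_simps)
  qed
  have ener: "source_ener D pb re pe U K = (\<Sum>q=1..cq_num D K. cq_wt D K q * (mom (Uq q) \<bullet> g q)) + mom Um \<bullet> h"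
  proof -
    have "source_ener D pb re pe U K = (\<Sum>q=1..cq_num D K. cq_wt D K q * (mom (Uq q) \<bullet> g q))
        - mom Um \<bullet> ((1 / r) *\<^sub>R G) + mom Um \<bullet> (c *\<^sub>R b_vec D pb pe K)"
      unfolding source_ener_def G_def scaleR_sum_right inner_sum_right sum_subtractf[symmetric]
      by (simp add: Um_def Uq_def r_def c_def g_def algebra_simps inner_diff_left inner_add_left)
    then show ?thesis unfolding b by (simp add: inner_add_right)
  qed
  show ?thesis by (rule state_eqI) (simp_all add: state_sum mom ener)
qed

lemma Max_ge_image2:
  assumes "finite A" "finite B" "a \<in> A" "b \<in> B"
  shows "F a b \<le> Max {F x y |x y. x \<in> A \<and> y \<in> B}"
proof (rule Max_ge)
  have "{F x y |x y. x \<in> A \<and> y \<in> B} = (\<lambda>(x, y). F x y) ` (A \<times> B)" by auto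
  then show "finite {F x y |x y. x \<in> A \<and> y \<in> B}" using assms by simp
qed (use assms in auto)

text \<open>The statement for one cell, with the traces from the neighbours and from the boundary conditions
on an equal footing. The terms that are only known to be in the cone are harmless, since the edge
terms are admissible and there is at least one of them.\<close>

lemma cell_average_update_admissible:
  fixes \<gamma> \<Delta>t :: real and D :: discretization and re pe :: "cell \<Rightarrow> point \<Rightarrow> real"
    and U :: "cell \<Rightarrow> point \<Rightarrow> state" and Ub :: "cell \<Rightarrow> point set \<Rightarrow> nat \<Rightarrow> state"
    and pb :: "cell \<Rightarrow> point set \<Rightarrow> nat \<Rightarrow> real"
  assumes gamma: "\<gamma> > 1" and K: "simple_polygon K" "K \<in> cells D"
    and quad: "edge_quadrature D" "cell_quadrature D K" "special_quadrature D K"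
    and re: "re K \<in> poly2 (deg D)" and pe: "pe K \<in> poly2 (deg D)" and sol: "U K \<in> state_poly (deg D)"
    and pos: "\<And>x. x \<in> points D K \<Longrightarrow> re K x > 0 \<and> pe K x > 0 \<and> U K x \<in> admissible"
    and ext: "\<And>E \<mu>. E \<in> edges K \<Longrightarrow> \<mu> \<in> {1..edge_num D} \<Longrightarrow>
      ext_trace D Ub U K E \<mu> \<in> admissible \<and> ext_trace D pb pe K E \<mu> > 0"
    and dt: "\<Delta>t > 0"
    and cfl: "\<And>E \<mu>. E \<in> edges K \<Longrightarrow> \<mu> \<in> {1..edge_num D} \<Longrightarrow>
      \<Delta>t * (alpha_F \<gamma> D Ub U K *
              (2 * edge_length E * p_star D pb pe K E \<mu> / (area K * int_trace D pe K E \<mu>))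
            + alpha_S D pb re pe U K * (sq_edge_wt D K E \<mu> / edge_wt D \<mu>))
      \<le> sq_edge_wt D K E \<mu> / edge_wt D \<mu>"
  shows "cell_avg K (U K) + \<Delta>t *\<^sub>R L_op \<gamma> D Ub pb re pe U K \<in> admissible"
proof -
  define Um where "Um = cell_avg K (U K)"
  define Uq where "Uq q = U K (cq_node D K q)" for q
  define g where "g q = (1 / re K (cq_node D K q)) *\<^sub>R gradient (pe K) (cq_node D K q)" for q
  define h where "h = (1 / (2 * (cell_avg K (re K) * area K))) *\<^sub>R source_jump D pb pe K"
  define aS1 where "aS1 = alpha_S1 D re pe U K"
  define aS2 where "aS2 = alpha_S2 D pb re pe U K"
  define aF where "aF = alpha_F \<gamma> D Ub U K"
  define \<theta> where "\<theta> = 1 - \<Delta>t * (aS1 + aS2)"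
  define n where "n E = outward_normal K E" for E
  define Ui where "Ui E \<mu> = int_trace D U K E \<mu>" for E \<mu>
  define pint where "pint E \<mu> = int_trace D pe K E \<mu>" for E \<mu>
  define ps where "ps E \<mu> = p_star D pb pe K E \<mu>" for E \<mu>
  define w where "w E \<mu> = sq_edge_wt D K E \<mu>" for E \<mu>
  define l where "l E \<mu> = \<Delta>t / area K * edge_length E * edge_wt D \<mu>" for E \<mu>
  let ?M = "{1..edge_num D}" and ?Q = "{1..cq_num D K}" and ?R = "{1..sq_num D K}"
  have area: "0 < area K" using area_pos quad(2) .
  have wq: "q \<in> ?Q \<Longrightarrow> 0 < cq_wt D K q" "(\<Sum>q\<in>?Q. cq_wt D K q) = 1" for q
    using quad(2) by (auto simp: cell_quadrature_def)
  have Qne: "?Q \<noteq> {}" using wq(2) by force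
  have "side K 0 \<in> edges K" using K(1) unfolding edge_side by (force simp: simple_polygon_def)
  then have Ene: "edges K \<noteq> {}" by auto
  have Mne: "?M \<noteq> {}" by (simp add: edge_num_def)
  have Uq: "Uq q \<in> admissible" "0 < re K (cq_node D K q)" if "q \<in> ?Q" for q
    using pos[of "cq_node D K q"] that by (auto simp: points_def Uq_def)
  have Um_sum: "Um = (\<Sum>q\<in>?Q. cq_wt D K q *\<^sub>R Uq q)"
    unfolding Um_def Uq_def by (rule cell_quadrature_state[OF quad(2) sol])
  have Um: "Um \<in> admissible" unfolding Um_sum
    using Qne wq Uq by (intro admissible_sum admissible_scale) auto
  have rm: "0 < cell_avg K (re K)"
  proof -
    have "cell_avg K (re K) = (\<Sum>q\<in>?Q. cq_wt D K q * re K (cq_node D K q))"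
      using quad(2) re by (simp add: cell_quadrature_def)
    also have "0 < \<dots>" using Qne wq Uq by (intro sum_pos mult_pos_pos) auto
    finally show ?thesis .
  qed
  have aS1: "norm (g q) \<le> aS1 * sqrt (2 * eint (Uq q))" if q: "q \<in> ?Q" for q
  proof -
    have "norm (gradient (pe K) (cq_node D K q)) / (re K (cq_node D K q) * sqrt (2 * eint (Uq q))) \<le> aS1"
      unfolding aS1_def alpha_S1_def Uq_def using q by (intro Max_ge) auto
    moreover have "0 < sqrt (2 * eint (Uq q))" using admissible_decomp(2)[OF Uq(1)[OF q]] by simp
    ultimately show ?thesis using Uq(2)[OF q] by (simp add: g_def field_simps)
  qed
  have aS1_nonneg: "0 \<le> aS1"
  proof -
    obtain q where q: "q \<in> ?Q" using Qne by auto
    have "0 < sqrt (2 * eint (Uq q))" using admissible_decomp(2)[OF Uq(1)[OF q]] by simp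
    moreover have "0 \<le> aS1 * sqrt (2 * eint (Uq q))" using aS1[OF q] norm_ge_zero order_trans by blast
    ultimately show ?thesis by (simp add: zero_le_mult_iff)
  qed
  have em: "0 < sqrt (2 * eint Um)" using admissible_decomp(2)[OF Um] by simp
  have aS2: "norm h \<le> aS2 * sqrt (2 * eint Um)"
    using em area rm by (simp add: aS2_def alpha_S2_def h_def source_jump_def Um_def mult_ac)
  have aS2_nonneg: "0 \<le> aS2"
    using em area rm unfolding aS2_def alpha_S2_def Um_def[symmetric] by (intro divide_nonneg_pos) auto
  obtain \<xi> where gauss: "gauss_rule (edge_num D) \<xi> (edge_wt D)"
    using quad(1) by (auto simp: edge_quadrature_def)
  have edge: "0 < edge_length E" "norm (n E) = 1" if E: "E \<in> edges K" for E
  proof -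
    obtain i where i: "i < length K" "E = side K i" using E edge_side by auto
    then have s: "E = closed_segment (K ! i) (K ! (Suc i mod length K))" by (simp add: side_def)
    show "norm (n E) = 1" unfolding n_def by (rule outward_normal(1)[OF K(1) E s])
    show "0 < edge_length E" unfolding s edge_length_segment
      using edge_endpoints(1)[OF K(1) E s] by simp
  qed
  have node: "Ui E \<mu> \<in> admissible" "0 < pint E \<mu>" "0 < ps E \<mu>" "0 < w E \<mu>" "0 < l E \<mu>"
    "max_speed \<gamma> (n E) (Ui E \<mu>) \<le> aF" "max_speed \<gamma> (n E) (ext_trace D Ub U K E \<mu>) \<le> aF"
    "2 * aF * (ps E \<mu> / pint E \<mu>) * l E \<mu> \<le> \<theta> * w E \<mu>"
    if E: "E \<in> edges K" "\<mu> \<in> ?M" for E \<mu>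
  proof -
    have x: "edge_node D E \<mu> \<in> points D K" using E by (auto simp: points_def)
    show 1: "Ui E \<mu> \<in> admissible" "0 < pint E \<mu>" using pos[OF x] by (auto simp: Ui_def pint_def int_trace_def)
    show "0 < ps E \<mu>" using 1(2) ext[OF E] by (simp add: ps_def p_star_def pint_def)
    show "0 < w E \<mu>" using quad(3) E by (simp add: special_quadrature_def w_def)
    have ew: "0 < edge_wt D \<mu>" by (rule gauss_weight_pos[OF gauss E(2)])
    then show "0 < l E \<mu>" using dt area edge(1)[OF E(1)] by (simp add: l_def)
    show "max_speed \<gamma> (n E) (Ui E \<mu>) \<le> aF" "max_speed \<gamma> (n E) (ext_trace D Ub U K E \<mu>) \<le> aF"
      using Max_ge_image2[of "edges K" ?M E \<mu> "\<lambda>E \<mu>. max_speed \<gamma> (outward_normal K E) (int_trace D U K E \<mu>)"]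
        Max_ge_image2[of "edges K" ?M E \<mu> "\<lambda>E \<mu>. max_speed \<gamma> (outward_normal K E) (ext_trace D Ub U K E \<mu>)"] E
      unfolding aF_def alpha_F_def n_def Ui_def by auto
    have c: "\<Delta>t * (aF * (2 * edge_length E * ps E \<mu> / (area K * pint E \<mu>)) + (aS1 + aS2) * (w E \<mu> / edge_wt D \<mu>))
        \<le> w E \<mu> / edge_wt D \<mu>"
      using cfl[OF E] by (simp add: aF_def ps_def pint_def aS1_def aS2_def w_def alpha_S_def)
    have "2 * aF * (ps E \<mu> / pint E \<mu>) * l E \<mu> + \<Delta>t * (aS1 + aS2) * w E \<mu> =
        edge_wt D \<mu> * (\<Delta>t * (aF * (2 * edge_length E * ps E \<mu> / (area K * pint E \<mu>)) + (aS1 + aS2) * (w E \<mu> / edge_wt D \<mu>)))"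
      using ew area 1(2) by (simp add: l_def field_simps)
    also have "\<dots> \<le> edge_wt D \<mu> * (w E \<mu> / edge_wt D \<mu>)" using c ew by (intro mult_left_mono) auto
    also have "\<dots> = w E \<mu>" using ew by simp
    finally show "2 * aF * (ps E \<mu> / pint E \<mu>) * l E \<mu> \<le> \<theta> * w E \<mu>" by (simp add: \<theta>_def algebra_simps)
  qed
  \<comment> \<open>The share left for the fluxes is nonnegative because the CFL condition bounds it from below by the
    nonnegative flux speed at any one edge node.\<close>
  have theta: "0 \<le> \<theta>"
  proof -
    obtain E \<mu> where E: "E \<in> edges K" "\<mu> \<in> ?M" using Ene Mne by auto
    have "0 \<le> max_speed \<gamma> (n E) (Ui E \<mu>)"
      using sound_speed_pos[OF gamma node(1)[OF E]] by (simp add: max_speed_def sound_speed_def)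
    then have "0 \<le> aF" using node(6)[OF E] by linarith
    then have "0 \<le> 2 * aF * (ps E \<mu> / pint E \<mu>) * l E \<mu>"
      using node(2,3,5)[OF E] by simp
    then have "0 \<le> \<theta> * w E \<mu>" using node(8)[OF E] by linarith
    then show ?thesis using node(4)[OF E] by (simp add: zero_le_mult_iff)
  qed
  define F where "F E \<mu> = num_flux \<gamma> D Ub pb pe U K E \<mu>" for E \<mu>
  have flux_part: "(\<theta> * w E \<mu>) *\<^sub>R Ui E \<mu> - l E \<mu> *\<^sub>R F E \<mu> \<in> admissible" if E: "E \<in> edges K" "\<mu> \<in> ?M" for E \<mu>
    unfolding F_def num_flux_def ps_def[symmetric] pint_def[symmetric] Ui_def[symmetric] n_def[symmetric]
    using node[OF E] ext[OF E] edge(2)[OF E(1)]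
    by (intro edge_term_admissible[where \<alpha> = aF] gamma) auto
  have edges_part: "(\<Sum>E\<in>edges K. \<Sum>\<mu>\<in>?M. (\<theta> * w E \<mu>) *\<^sub>R Ui E \<mu> - l E \<mu> *\<^sub>R F E \<mu>) \<in> admissible"
    using Ene Mne flux_part by (intro admissible_sum) auto
  have inner_part: "\<theta> *\<^sub>R (\<Sum>q\<in>?R. sq_wt D K q *\<^sub>R U K (sq_node D K q)) \<in> energy_cone"
    using theta quad(3) pos admissible_subset_cone
    by (intro energy_cone_scale energy_cone_sum) (auto simp: special_quadrature_def points_def intro: less_imp_le)
  have source1: "\<Delta>t *\<^sub>R (\<Sum>q\<in>?Q. cq_wt D K q *\<^sub>R (aS1 *\<^sub>R Uq q + (0, dens (Uq q) *\<^sub>R g q, mom (Uq q) \<bullet> g q))) \<in> energy_cone"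
    using dt wq(1) aS1 aS1_nonneg Uq(1)
    by (intro energy_cone_scale energy_cone_sum source_dominated) (auto intro: less_imp_le)
  have source2: "\<Delta>t *\<^sub>R (aS2 *\<^sub>R Um + (0, dens Um *\<^sub>R h, mom Um \<bullet> h)) \<in> energy_cone"
    using dt aS2 aS2_nonneg Um by (intro energy_cone_scale source_dominated) auto
  \<comment> \<open>The share \<open>\<theta>\<close> of the average is expanded by the special quadrature, the share of the first source
    speed by the quadrature of the source, and the share of the second one is kept as it is.\<close>
  define A where "A = (\<Sum>E\<in>edges K. \<Sum>\<mu>\<in>?M. (\<theta> * w E \<mu>) *\<^sub>R Ui E \<mu>)"
  define B where "B = (\<Sum>E\<in>edges K. \<Sum>\<mu>\<in>?M. l E \<mu> *\<^sub>R F E \<mu>)"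
  define R where "R = (\<Sum>q\<in>?R. sq_wt D K q *\<^sub>R U K (sq_node D K q))"
  define S1 :: state where
    "S1 = (\<Sum>q\<in>?Q. cq_wt D K q *\<^sub>R (0, dens (Uq q) *\<^sub>R g q, mom (Uq q) \<bullet> g q))"
  define S2 :: state where "S2 = (0, dens Um *\<^sub>R h, mom Um \<bullet> h)"
  have "Um = (\<Sum>E\<in>edges K. \<Sum>\<mu>\<in>?M. w E \<mu> *\<^sub>R Ui E \<mu>) + R"
    unfolding Um_def w_def Ui_def int_trace_def R_def by (rule special_quadrature_state[OF quad(3) sol])
  then have avg: "\<theta> *\<^sub>R Um = A + \<theta> *\<^sub>R R"
    by (simp add: scaleR_add_right scaleR_sum_right A_def)
  have "Um = \<theta> *\<^sub>R Um + (\<Delta>t * aS1 + \<Delta>t * aS2) *\<^sub>R Um"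
    by (simp add: \<theta>_def distrib_left flip: scaleR_add_left)
  then have Um_eq: "Um = A + \<theta> *\<^sub>R R + \<Delta>t *\<^sub>R aS1 *\<^sub>R Um + \<Delta>t *\<^sub>R aS2 *\<^sub>R Um"
    unfolding avg by (simp add: scaleR_add_left add.assoc)
  have src: "(0, source_mom D pb re pe U K, source_ener D pb re pe U K) = S1 + S2"
    unfolding S1_def S2_def g_def h_def Um_def Uq_def
    by (rule source_split[where pe = pe and K = K, OF K(1) quad(2,1) K(2) pe])
  have B: "B = (\<Delta>t * (1 / area K)) *\<^sub>R
      (\<Sum>E\<in>edges K. edge_length E *\<^sub>R (\<Sum>\<mu>\<in>?M. edge_wt D \<mu> *\<^sub>R F E \<mu>))"
    by (simp add: B_def scaleR_sum_right l_def mult.assoc)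
  have L: "\<Delta>t *\<^sub>R L_op \<gamma> D Ub pb re pe U K = \<Delta>t *\<^sub>R S1 + \<Delta>t *\<^sub>R S2 - B"
    unfolding L_op_def src B F_def by (simp add: scaleR_add_right scaleR_diff_right)
  have S1: "(\<Sum>q\<in>?Q. cq_wt D K q *\<^sub>R (aS1 *\<^sub>R Uq q + (0, dens (Uq q) *\<^sub>R g q, mom (Uq q) \<bullet> g q)))
      = aS1 *\<^sub>R Um + S1"
    unfolding Um_sum S1_def scaleR_sum_right sum.distrib[symmetric] scaleR_add_right
    by (simp add: mult.commute)
  have AB: "(\<Sum>E\<in>edges K. \<Sum>\<mu>\<in>?M. (\<theta> * w E \<mu>) *\<^sub>R Ui E \<mu> - l E \<mu> *\<^sub>R F E \<mu>) = A - B"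
    by (simp add: A_def B_def sum_subtractf)
  have "Um + \<Delta>t *\<^sub>R L_op \<gamma> D Ub pb re pe U K =
      (A - B) + \<theta> *\<^sub>R R + \<Delta>t *\<^sub>R (aS1 *\<^sub>R Um + S1) + \<Delta>t *\<^sub>R (aS2 *\<^sub>R Um + S2)"
    unfolding L by (subst Um_eq) (simp add: scaleR_add_right algebra_simps)
  also have "\<dots> \<in> admissible"
    using edges_part inner_part source1 source2 unfolding AB S1 R_def[symmetric] S2_def[symmetric]
    by (intro admissible_add_cone)
  finally show ?thesis unfolding Um_def .
qed

theorem theorem4p3:
  fixes \<gamma> \<Delta>t :: real
    and D :: discretization
    and \<phi> rho_e p_e :: "point \<Rightarrow> real"
    and re pe :: "cell \<Rightarrow> point \<Rightarrow> real"
    and U :: "cell \<Rightarrow> point \<Rightarrow> state"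
    and Ub :: "cell \<Rightarrow> point set \<Rightarrow> nat \<Rightarrow> state"
    and pb :: "cell \<Rightarrow> point set \<Rightarrow> nat \<Rightarrow> real"
  assumes gamma: "\<gamma> > 1"
    and disc: "dg_discretization D"
    and hydro: "hydrostatic (domain D) \<phi> rho_e p_e"
    and proj_rho: "re \<in> Vh D" "Vh_projection_of D rho_e re"
    and proj_p: "pe \<in> Vh D" "Vh_projection_of D p_e pe"
    and sol: "U \<in> Vh_state D"
    and eq_pos: "\<forall>K\<in>cells D. \<forall>x\<in>points D K. re K x > 0 \<and> pe K x > 0"
    and adm: "\<forall>K\<in>cells D. \<forall>x\<in>points D K. U K x \<in> admissible"
    and bdry: "\<forall>K\<in>cells D. \<forall>E\<in>edges K. E \<subseteq> frontier (domain D) \<longrightarrow>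
      (\<forall>\<mu>\<in>{1..edge_num D}. Ub K E \<mu> \<in> admissible \<and> pb K E \<mu> > 0)"
    and dt: "\<Delta>t > 0"
    and cfl: "\<forall>K\<in>cells D. \<forall>E\<in>edges K. \<forall>\<mu>\<in>{1..edge_num D}.
      \<Delta>t * (alpha_F \<gamma> D Ub U K *
              (2 * edge_length E * p_star D pb pe K E \<mu> / (area K * int_trace D pe K E \<mu>))
            + alpha_S D pb re pe U K * (sq_edge_wt D K E \<mu> / edge_wt D \<mu>))
      \<le> sq_edge_wt D K E \<mu> / edge_wt D \<mu>"
  shows "\<forall>K\<in>cells D. cell_avg K (U K) + \<Delta>t *\<^sub>R L_op \<gamma> D Ub pb re pe U K \<in> admissible"
proof
  fix K assume K: "K \<in> cells D"
  have mesh: "polygonal_mesh (domain D) (cells D)" and eq: "edge_quadrature D"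
    and cq: "cell_quadrature D K" and sq: "special_quadrature D K"
    using disc K by (auto simp: dg_discretization_def)
  show "cell_avg K (U K) + \<Delta>t *\<^sub>R L_op \<gamma> D Ub pb re pe U K \<in> admissible"
  proof (rule cell_average_update_admissible[OF gamma _ K eq cq sq])
    show "simple_polygon K" using mesh K by (auto simp: polygonal_mesh_def)
    show "re K \<in> poly2 (deg D)" "pe K \<in> poly2 (deg D)" "U K \<in> state_poly (deg D)"
      using proj_rho(1) proj_p(1) sol K by (auto simp: Vh_def Vh_state_def state_poly_def)
    show "re K x > 0 \<and> pe K x > 0 \<and> U K x \<in> admissible" if "x \<in> points D K" for x
      using eq_pos adm K that by blast
    show "ext_trace D Ub U K E \<mu> \<in> admissible \<and> ext_trace D pb pe K E \<mu> > 0"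
      if "E \<in> edges K" "\<mu> \<in> {1..edge_num D}" for E \<mu>
      using that K bdry eq_pos adm
        exterior_trace[OF mesh K that(1), where P = "\<lambda>V. V \<in> admissible" and v = U and vb = Ub and \<mu> = \<mu>]
        exterior_trace[OF mesh K that(1), where P = "\<lambda>p. p > (0::real)" and v = pe and vb = pb and \<mu> = \<mu>]
      by blast
  qed (use dt cfl K in auto)
qed

end
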